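(* Assume the standing assumptions of the context and let $\widetilde{\mathit{\Omega}}^{\rm t}=\bigcap_{p\in[p_0,q)}\bigcap_{\alpha\in(\underline{\alpha},\overline{\alpha}]}L^p(\mathsf{V},w_\alpha)$, endowed with the projective limit topology (a Fréchet space), whose Borel $\sigma$-field equals $\{A\cap\widetilde{\mathit{\Omega}}^{\rm t}:A \text{ Borel in }\mathit{\Omega}\}$. Let $\widetilde{\mathcal{G}}^{\rm t}=\{\mu\in\mathcal{G}:\mu(\widetilde{\mathit{\Omega}}^{\rm t})=1\}$, regarded as a set of probability measures on $\widetilde{\mathit{\Omega}}^{\rm t}$. Then $\widetilde{\mathcal{G}}^{\rm t}$ is non-void and compact in the weak topology of probability measures on $\widetilde{\mathit{\Omega}}^{\rm t}$ (generated by bounded continuous functions on $\widetilde{\mathit{\Omega}}^{\rm t}$).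
   Context: $\mathsf{G}=(\mathsf{V},\mathsf{E})$ is a countable, connected, locally finite undirected graph; $n(x)$ the degree, $\rho$ the path distance, $o\in\mathsf{V}$ a fixed root, $w_\alpha(x)=\exp[-\alpha\rho(o,x)]$. For $\theta>0$, $m_\theta(x)=\sum_{y\sim x}[n(x)n(y)]^\theta$, $\mathit{\Theta}(\alpha,\theta)=\sum_xm_\theta(x)w_\alpha(x)$. Standing assumptions: $\theta>0$ fixed with $\mathit{\Theta}(\alpha,\theta)<\infty$ for some $\alpha>0$; $W$ continuous, symmetric, $|W(u,v)|\le[I_W+J_W(|u|^r+|v|^r)]/2$ with $I_W,J_W,r>0$; $V$ continuous with $V(u)\ge a_V|u|^q-c_V$, $a_V,c_V>0$, $q>r+r/\theta$. $\underline{\alpha}=\inf\{\alpha:\mathit{\Theta}(\alpha,\theta)<\infty\}$, $\overline{\alpha}>\underline{\alpha}$ with $\mathit{\Theta}(\alpha,\theta)<\infty$ on $(\underline{\alpha},\overline{\alpha}]$, $p_0=r+r/\theta$. $\mathit{\Omega}=\mathbb{R}^{\mathsf{V}}$ with product topology; $\|\omega\|_{p,\alpha}=[\sum_x|\omega(x)|^pw_\alpha(x)]^{1/p}$, $L^p(\mathsf{V},w_\alpha)=\{\omega:\|\omega\|_{p,\alpha}<\infty\}$. For finite non-void $\mathit{\Lambda}\subset\mathsf{V}$, $\xi\in\mathit{\Omega}$: $H_{\mathit{\Lambda}}(\omega_{\mathit{\Lambda}}|\xi)=\sum_{\langle x,y\rangle:x,y\in\mathit{\Lambda}}W(\omega(x),\omega(y))+\sum_{\langle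 x,y\rangle:x\in\mathit{\Lambda},y\notin\mathit{\Lambda}}W(\omega(x),\xi(y))+\sum_{x\in\mathit{\Lambda}}V(\omega(x))$, $\pi_{\mathit{\Lambda}}(A|\xi)=Z_{\mathit{\Lambda}}(\xi)^{-1}\int\mathbb{I}_A(\omega_{\mathit{\Lambda}}\times\xi_{\mathit{\Lambda}^c})e^{-H_{\mathit{\Lambda}}(\omega_{\mathit{\Lambda}}|\xi)}d\omega_{\mathit{\Lambda}}$. $\mathcal{G}$ is the set of Borel probability measures $\mu$ on $\mathit{\Omega}$ with $\mu(A)=\int\pi_{\mathit{\Lambda}}(A|\omega)\mu(d\omega)$ for all Borel $A$ and finite non-void $\mathit{\Lambda}$. *)

theory Defs
  imports "HOL-Probability.Probability"
begin

text \<open>A graph on the vertex type 'v is given by an adjacency relation E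
  (symmetric, irreflexive: simple undirected graph).\<close>

definition deg :: "('v \<Rightarrow> 'v \<Rightarrow> bool) \<Rightarrow> 'v \<Rightarrow> real" where
  "deg E x = real (card {y. E x y})"

definition gdist :: "('v \<Rightarrow> 'v \<Rightarrow> bool) \<Rightarrow> 'v \<Rightarrow> 'v \<Rightarrow> nat" where
  "gdist E x y = (LEAST k. (E ^^ k) x y)"

definition wgt :: "('v \<Rightarrow> 'v \<Rightarrow> bool) \<Rightarrow> 'v \<Rightarrow> real \<Rightarrow> 'v \<Rightarrow> real" where
  "wgt E o\<^sub>0 \<alpha> x = exp (- \<alpha> * real (gdist E o\<^sub>0 x))"

definition mth :: "('v \<Rightarrow> 'v \<Rightarrow> bool) \<Rightarrow> real \<Rightarrow> 'v \<Rightarrow> real" where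
  "mth E \<theta> x = (\<Sum>y\<in>{y. E x y}. (deg E x * deg E y) powr \<theta>)"

text \<open>Theta(alpha,theta) < infinity (nonnegative summands, so summability
  is finiteness of the sum).\<close>
definition Theta_finite :: "('v \<Rightarrow> 'v \<Rightarrow> bool) \<Rightarrow> 'v \<Rightarrow> real \<Rightarrow> real \<Rightarrow> bool" where
  "Theta_finite E o\<^sub>0 \<alpha> \<theta> \<longleftrightarrow> (\<lambda>x. mth E \<theta> x * wgt E o\<^sub>0 \<alpha> x) summable_on UNIV"

definition alpha_low :: "('v \<Rightarrow> 'v \<Rightarrow> bool) \<Rightarrow> 'v \<Rightarrow> real \<Rightarrow> real" where
  "alpha_low E o\<^sub>0 \<theta> = Inf {\<alpha>. 0 < \<alpha> \<and> Theta_finite E o\<^sub>0 \<alpha> \<theta>}"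

definition in_Lp :: "('v \<Rightarrow> 'v \<Rightarrow> bool) \<Rightarrow> 'v \<Rightarrow> real \<Rightarrow> real \<Rightarrow> ('v \<Rightarrow> real) \<Rightarrow> bool" where
  "in_Lp E o\<^sub>0 p \<alpha> \<omega> \<longleftrightarrow> (\<lambda>x. \<bar>\<omega> x\<bar> powr p * wgt E o\<^sub>0 \<alpha> x) summable_on UNIV"

definition lp_norm :: "('v \<Rightarrow> 'v \<Rightarrow> bool) \<Rightarrow> 'v \<Rightarrow> real \<Rightarrow> real \<Rightarrow> ('v \<Rightarrow> real) \<Rightarrow> real" where
  "lp_norm E o\<^sub>0 p \<alpha> \<omega> = (\<Sum>\<^sub>\<infinity>x. \<bar>\<omega> x\<bar> powr p * wgt E o\<^sub>0 \<alpha> x) powr (1 / p)"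

definition adm :: "('v \<Rightarrow> 'v \<Rightarrow> bool) \<Rightarrow> 'v \<Rightarrow> real \<Rightarrow> real \<Rightarrow> real \<Rightarrow> real
    \<Rightarrow> real \<Rightarrow> real \<Rightarrow> bool" where
  "adm E o\<^sub>0 \<theta> r q \<alpha>up p \<alpha> \<longleftrightarrow>
     r + r / \<theta> \<le> p \<and> p < q \<and> alpha_low E o\<^sub>0 \<theta> < \<alpha> \<and> \<alpha> \<le> \<alpha>up"

definition Omega_t :: "('v \<Rightarrow> 'v \<Rightarrow> bool) \<Rightarrow> 'v \<Rightarrow> real \<Rightarrow> real \<Rightarrow> real \<Rightarrow> real
    \<Rightarrow> ('v \<Rightarrow> real) set" where
  "Omega_t E o\<^sub>0 \<theta> r q \<alpha>up =
     {\<omega>. \<forall>p \<alpha>. adm E o\<^sub>0 \<theta> r q \<alpha>up p \<alpha> \<longrightarrow> in_Lp E o\<^sub>0 p \<alpha> \<omega>}"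

text \<open>Projective limit topology on Omega-tilde^t: the topology generated by
  all balls of all the (quasi-)norms ||.||_{p,alpha}, p, alpha admissible.\<close>
definition Omega_t_top :: "('v \<Rightarrow> 'v \<Rightarrow> bool) \<Rightarrow> 'v \<Rightarrow> real \<Rightarrow> real \<Rightarrow> real \<Rightarrow> real
    \<Rightarrow> ('v \<Rightarrow> real) topology" where
  "Omega_t_top E o\<^sub>0 \<theta> r q \<alpha>up = topology_generated_by
     (insert (Omega_t E o\<^sub>0 \<theta> r q \<alpha>up)
       {{\<eta> \<in> Omega_t E o\<^sub>0 \<theta> r q \<alpha>up. lp_norm E o\<^sub>0 p \<alpha> (\<eta> - \<omega>) < \<epsilon>} | \<omega> p \<alpha> \<epsilon>.
          \<omega> \<in> Omega_t E o\<^sub>0 \<theta> r q \<alpha>up \<and> adm E o\<^sub>0 \<theta> r q \<alpha>up p \<alpha> \<and> 0 < \<epsilon>})"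

definition merge_cfg :: "'v set \<Rightarrow> ('v \<Rightarrow> real) \<Rightarrow> ('v \<Rightarrow> real) \<Rightarrow> ('v \<Rightarrow> real)" where
  "merge_cfg \<Lambda> \<omega> \<xi> = (\<lambda>x. if x \<in> \<Lambda> then \<omega> x else \<xi> x)"

text \<open>H_Lambda evaluated at the configuration eta = omega_Lambda x xi_Lambda^c.
  The sum over unordered edges inside Lambda is written as one half of the
  sum over ordered adjacent pairs (W is symmetric).\<close>
definition Ham :: "('v \<Rightarrow> 'v \<Rightarrow> bool) \<Rightarrow> (real \<Rightarrow> real \<Rightarrow> real) \<Rightarrow> (real \<Rightarrow> real)
    \<Rightarrow> 'v set \<Rightarrow> ('v \<Rightarrow> real) \<Rightarrow> real" where
  "Ham E W V \<Lambda> \<eta> =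
     (1/2) * (\<Sum>(x,y)\<in>{(x,y). x \<in> \<Lambda> \<and> y \<in> \<Lambda> \<and> E x y}. W (\<eta> x) (\<eta> y))
     + (\<Sum>(x,y)\<in>{(x,y). x \<in> \<Lambda> \<and> y \<notin> \<Lambda> \<and> E x y}. W (\<eta> x) (\<eta> y))
     + (\<Sum>x\<in>\<Lambda>. V (\<eta> x))"

definition Zpart :: "('v \<Rightarrow> 'v \<Rightarrow> bool) \<Rightarrow> (real \<Rightarrow> real \<Rightarrow> real) \<Rightarrow> (real \<Rightarrow> real)
    \<Rightarrow> 'v set \<Rightarrow> ('v \<Rightarrow> real) \<Rightarrow> real" where
  "Zpart E W V \<Lambda> \<xi> =
     (\<integral>\<omega>. exp (- Ham E W V \<Lambda> (merge_cfg \<Lambda> \<omega> \<xi>)) \<partial>(PiM \<Lambda> (\<lambda>_. lborel)))"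

definition kernel :: "('v \<Rightarrow> 'v \<Rightarrow> bool) \<Rightarrow> (real \<Rightarrow> real \<Rightarrow> real) \<Rightarrow> (real \<Rightarrow> real)
    \<Rightarrow> 'v set \<Rightarrow> ('v \<Rightarrow> real) set \<Rightarrow> ('v \<Rightarrow> real) \<Rightarrow> real" where
  "kernel E W V \<Lambda> A \<xi> =
     (\<integral>\<omega>. indicator A (merge_cfg \<Lambda> \<omega> \<xi>) * exp (- Ham E W V \<Lambda> (merge_cfg \<Lambda> \<omega> \<xi>))
        \<partial>(PiM \<Lambda> (\<lambda>_. lborel))) / Zpart E W V \<Lambda> \<xi>"

definition Gibbs :: "('v \<Rightarrow> 'v \<Rightarrow> bool) \<Rightarrow> (real \<Rightarrow> real \<Rightarrow> real) \<Rightarrow> (real \<Rightarrow> real)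
    \<Rightarrow> ('v \<Rightarrow> real) measure set" where
  "Gibbs E W V = {\<mu>. sets \<mu> = sets borel \<and> prob_space \<mu> \<and>
     (\<forall>\<Lambda> A. finite \<Lambda> \<and> \<Lambda> \<noteq> {} \<and> A \<in> sets borel \<longrightarrow>
        measure \<mu> A = (\<integral>\<xi>. kernel E W V \<Lambda> A \<xi> \<partial>\<mu>))}"

definition probs_on :: "('v \<Rightarrow> real) set \<Rightarrow> ('v \<Rightarrow> real) measure set" where
  "probs_on S = {\<nu>. sets \<nu> = sets (restrict_space borel S) \<and> prob_space \<nu>}"

definition weak_top :: "('v \<Rightarrow> real) topology \<Rightarrow> ('v \<Rightarrow> real) measure topology" where
  "weak_top T = topology_generated_by
     {{\<nu> \<in> probs_on (topspace T). (\<integral>x. f x \<partial>\<nu>) \<in> U} | f U.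
        continuous_map T euclideanreal f \<and> (\<exists>B. \<forall>x\<in>topspace T. \<bar>f x\<bar> \<le> B) \<and> open U}"

end

theory Submission
  imports Defs
begin

text \<open>Everything is done with cylinder events. For boundary values bounded on the outer boundary of a
  finite \<open>\<Lambda>\<close>, the kernel of \<open>\<Lambda>\<close> is dominated by one finite measure, so Gibbs measures with uniformly
  bounded moments are equicontinuous on the cylinder sets over \<open>\<Lambda>\<close>. Hence a pointwise limit, on cylinder
  sets, of such measures is again \<open>\<sigma>\<close>-additive and extends by Kolmogorov's theorem to a measure; the
  Gibbs property survives because kernels of cylinder events are cylinder functions. Tychonoff's theorem
  then yields both existence (limits of the kernels of balls with zero boundary values) and compactness
  for the topology of convergence on cylinder events.

  The uniform moment bound comes from a single-site estimate summed over the graph against the weights: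
  the neighbours' contribution carries an arbitrarily small constant and is absorbed. By the same bound
  tempered Gibbs measures are uniformly tight on subsets of the space
      of tempered configurations on which cutting a configuration
  off outside a large ball changes a continuous function by little, so integrals of bounded continuous
  functions are uniform limits of integrals of cylinder functions.\<close>

subsection \<open>Cylinder sets and measures on a countable product of real lines\<close>

text \<open>The small constant in front of the neighbours comes from an exponential moment. Since
  \<open>p < q\<close>, the self-interaction \<open>V\<close> swallows \<open>l * |u|^p\<close> for
  every \<open>l\<close>, at a price paid only in the additive constant, while the neighbours enter
  numerator and partition function with the fixed total coefficient \<open>J\<^sub>W\<close>. Taking
  logarithms leaves the large factor \<open>l\<close> on the left. Degrees are unbounded, so both
  Young remainders, one in the degree of the site and one in the degrees of its neighbours, have to
  stay of the order of \<open>M\<^sub>\<theta>\<close>, whose weighted sum is finite. Convergence on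
  cylinder events allows limits of kernels that are merely measurable in the boundary values. Its
  price is that sigma-additivity can be lost in the limit, and that the index set of all cylinder
  events is too large for sequences; hence filters and an encoding of measures as points of a cube.
  A function continuous for the projective limit topology need not be continuous for the product
  topology, so the weak topology is reached only through cut configurations.\<close>

text \<open>Invariance under changes off \<open>J\<close>, rather than a preimage description, makes
  Boolean operations and enlargement of \<open>J\<close> immediate; \<open>cyl_eq_prod_emb\<close>
  recovers the base set.\<close>

definition cyl :: "'v set \<Rightarrow> ('v::countable \<Rightarrow> real) set set" where
  "cyl J = {A \<in> sets borel. \<forall>\<omega> \<eta>. (\<forall>x\<in>J. \<omega> x = \<eta> x) \<longrightarrow> \<omega> \<in> A \<longrightarrow> \<eta> \<in> A}"

definition fcyl :: "('v::countable \<Rightarrow> real) set set" where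
  "fcyl = (\<Union>J\<in>{J. finite J}. cyl J)"

lemma cylI:
  assumes "A \<in> sets borel" "\<And>\<omega> \<eta>. (\<And>x. x \<in> J \<Longrightarrow> \<omega> x = \<eta> x) \<Longrightarrow> \<omega> \<in> A \<Longrightarrow> \<eta> \<in> A"
  shows "A \<in> cyl J"
  unfolding cyl_def using assms(1) by (auto intro: assms(2))

lemma cylD:
  assumes "A \<in> cyl J" "\<And>x. x \<in> J \<Longrightarrow> \<omega> x = \<eta> x"
  shows "\<omega> \<in> A \<longleftrightarrow> \<eta> \<in> A"
proof -
  have *: "\<And>\<omega> \<eta>. \<forall>x\<in>J. \<omega> x = \<eta> x \<Longrightarrow> \<omega> \<in> A \<Longrightarrow> \<eta> \<in> A"
    using assms(1) unfolding cyl_def by simp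
  show ?thesis using *[of \<omega> \<eta>] *[of \<eta> \<omega>] assms(2) by auto
qed

lemma cyl_sets: "A \<in> cyl J \<Longrightarrow> A \<in> sets borel"
  by (simp add: cyl_def)

lemma fcyl_sets: "A \<in> fcyl \<Longrightarrow> A \<in> sets borel"
  by (auto simp: fcyl_def cyl_sets)

lemma cyl_mono:
  assumes "J \<subseteq> H"
  shows "cyl J \<subseteq> cyl H"
proof
  fix A assume A: "A \<in> cyl J"
  show "A \<in> cyl H"
  proof (rule cylI)
    show "\<eta> \<in> A" if "\<And>x. x \<in> H \<Longrightarrow> \<omega> x = \<eta> x" "\<omega> \<in> A" for \<omega> \<eta>
      using that cylD[OF A, of \<omega> \<eta>] assms by auto
  qed (rule cyl_sets[OF A])
qed

lemma fcylI: "finite J \<Longrightarrow> A \<in> cyl J \<Longrightarrow> A \<in> fcyl"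
  by (auto simp: fcyl_def)

lemma fcyl_common:
  assumes "A \<in> fcyl" "B \<in> fcyl"
  obtains J where "finite J" "A \<in> cyl J" "B \<in> cyl J"
proof -
  obtain J H where "finite J" "A \<in> cyl J" "finite H" "B \<in> cyl H"
    using assms by (auto simp: fcyl_def)
  then show thesis
    using that[of "J \<union> H"] cyl_mono[of J "J \<union> H"] cyl_mono[of H "J \<union> H"] by auto
qed

lemma cyl_Int:
  assumes "A \<in> cyl J" "B \<in> cyl J"
  shows "A \<inter> B \<in> cyl J"
proof (rule cylI)
  show "A \<inter> B \<in> sets borel" using assms[THEN cyl_sets] by auto
  show "\<eta> \<in> A \<inter> B" if "\<And>x. x \<in> J \<Longrightarrow> \<omega> x = \<eta> x" "\<omega> \<in> A \<inter> B" for \<omega> \<eta>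
    using that(2) cylD[OF assms(1) that(1)] cylD[OF assms(2) that(1)] by simp
qed

lemma cyl_Un:
  assumes "A \<in> cyl J" "B \<in> cyl J"
  shows "A \<union> B \<in> cyl J"
proof (rule cylI)
  show "A \<union> B \<in> sets borel" using assms[THEN cyl_sets] by auto
  show "\<eta> \<in> A \<union> B" if "\<And>x. x \<in> J \<Longrightarrow> \<omega> x = \<eta> x" "\<omega> \<in> A \<union> B" for \<omega> \<eta>
    using that(2) cylD[OF assms(1) that(1)] cylD[OF assms(2) that(1)] by simp
qed

lemma UNIV_fcyl: "UNIV \<in> fcyl"
  by (rule fcylI[of "{}"]) (auto intro: cylI)

lemma measurable_restrict_borel:
  "(\<lambda>\<omega>. restrict \<omega> J) \<in> borel \<rightarrow>\<^sub>M PiM J (\<lambda>_. borel :: real measure)"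
  for J :: "'v::countable set"
  by (rule measurable_restrict) (rule measurable_product_coordinates)

lemma prod_emb_cyl:
  fixes J :: "'v::countable set"
  assumes "B \<in> sets (PiM J (\<lambda>_. borel :: real measure))"
  shows "prod_emb UNIV (\<lambda>_. borel) J B \<in> cyl J"
proof (rule cylI)
  have "(\<lambda>\<omega>. restrict \<omega> J) -` B \<inter> space borel \<in> sets borel"
    by (rule measurable_sets[OF measurable_restrict_borel assms])
  then show "prod_emb UNIV (\<lambda>_. borel) J B \<in> sets borel"
    by (simp add: prod_emb_def)
next
  fix \<omega> \<eta> :: "'v \<Rightarrow> real"
  assume "\<And>x. x \<in> J \<Longrightarrow> \<omega> x = \<eta> x" and *: "\<omega> \<in> prod_emb UNIV (\<lambda>_. borel) J B"
  then have "restrict \<omega> J = restrict \<eta> J" by (auto simp: restrict_def)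
  with * show "\<eta> \<in> prod_emb UNIV (\<lambda>_. borel) J B"
    by (simp add: prod_emb_def)
qed

text \<open>Extension by zero off \<open>J\<close> is measurable, and membership in \<open>A\<close>
  does not see the values off \<open>J\<close>; so the preimage of \<open>A\<close> under this
  extension is a base.\<close>

lemma cyl_eq_prod_emb:
  fixes J :: "'v::countable set"
  assumes A: "A \<in> cyl J"
  obtains B where "B \<in> sets (PiM J (\<lambda>_. borel :: real measure))"
    "A = prod_emb UNIV (\<lambda>_. borel) J B"
proof -
  let ?e = "\<lambda>\<omega> x. if x \<in> J then \<omega> x else 0 :: real"
  have e: "?e \<in> PiM J (\<lambda>_. borel) \<rightarrow>\<^sub>M borel"
  proof (rule measurable_coordinatewise_then_product)
    show "(\<lambda>\<omega>. ?e \<omega> i) \<in> borel_measurable (PiM J (\<lambda>_. borel))" for i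
      by (cases "i \<in> J") auto
  qed
  define B where "B = ?e -` A \<inter> space (PiM J (\<lambda>_. borel))"
  have "B \<in> sets (PiM J (\<lambda>_. borel))"
    unfolding B_def using measurable_sets[OF e cyl_sets[OF A]] .
  moreover have "A = prod_emb UNIV (\<lambda>_. borel) J B"
  proof -
    have "\<omega> \<in> A \<longleftrightarrow> ?e (restrict \<omega> J) \<in> A" for \<omega>
      by (rule cylD[OF A]) auto
    then show ?thesis
      by (auto simp: prod_emb_def B_def space_PiM)
  qed
  ultimately show thesis using that by blast
qed

text \<open>Boxes over finite index sets are cylinders and generate the product sigma-algebra, which
  for countably many real coordinates is the Borel one.\<close>

lemma sigma_sets_fcyl: "sigma_sets UNIV fcyl = sets (borel :: ('v::countable \<Rightarrow> real) measure)"
proof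
  show "sigma_sets UNIV fcyl \<subseteq> sets (borel :: ('v \<Rightarrow> real) measure)"
    using sets.sigma_sets_subset[of fcyl "borel :: ('v \<Rightarrow> real) measure"] by (auto intro: fcyl_sets)
  have "prod_algebra UNIV (\<lambda>_. borel) \<subseteq> (fcyl :: ('v \<Rightarrow> real) set set)"
  proof
    fix A :: "('v \<Rightarrow> real) set" assume "A \<in> prod_algebra UNIV (\<lambda>_. borel)"
    then obtain J X where "finite J" and X: "\<And>i. i \<in> J \<Longrightarrow> X i \<in> sets borel"
      and A: "A = prod_emb UNIV (\<lambda>_. borel) J (Pi\<^sub>E J X)"
      by (elim prod_algebraE) auto
    then show "A \<in> fcyl"
      by (auto intro!: fcylI[of J] prod_emb_cyl sets_PiM_I_finite)
  qed
  then have "sets (PiM UNIV (\<lambda>_. borel)) \<subseteq> sigma_sets UNIV (fcyl :: ('v \<Rightarrow> real) set set)"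
    unfolding sets_PiM by (simp add: sigma_sets_mono')
  then show "sets (borel :: ('v \<Rightarrow> real) measure) \<subseteq> sigma_sets UNIV fcyl"
    by (simp add: sets_PiM_equal_borel)
qed

lemma Int_stable_fcyl: "Int_stable fcyl"
  by (rule Int_stableI) (metis fcyl_common cyl_Int fcylI)

lemma measure_eqI_fcyl:
  fixes M N :: "('v::countable \<Rightarrow> real) measure"
  assumes M: "sets M = sets borel" "prob_space M" and N: "sets N = sets borel" "prob_space N"
    and eq: "\<And>A. A \<in> fcyl \<Longrightarrow> emeasure M A = emeasure N A"
  shows "M = N"
proof (rule measure_eqI_generator_eq[OF Int_stable_fcyl, of UNIV M N "\<lambda>_. UNIV"])
  interpret prob_space M by fact
  show "emeasure M UNIV \<noteq> \<infinity>" for i :: nat by simp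
qed (use assms UNIV_fcyl in \<open>auto simp: sigma_sets_fcyl\<close>)

text \<open>Continuity at the empty set is asked only along sequences over one fixed finite
  \<open>J\<close>. That makes every finite-dimensional marginal a measure; sigma-additivity across
  different \<open>J\<close> is then Kolmogorov's theorem for Polish factors.\<close>

theorem cylinder_extension:
  fixes \<phi> :: "('v::countable \<Rightarrow> real) set \<Rightarrow> real"
  assumes nonneg: "\<And>A. A \<in> fcyl \<Longrightarrow> 0 \<le> \<phi> A" and one: "\<phi> UNIV = 1"
    and add: "\<And>A B. A \<in> fcyl \<Longrightarrow> B \<in> fcyl \<Longrightarrow> A \<inter> B = {} \<Longrightarrow> \<phi> (A \<union> B) = \<phi> A + \<phi> B"
    and cont: "\<And>J A. finite J \<Longrightarrow> (\<And>n. A n \<in> cyl J) \<Longrightarrow> decseq A \<Longrightarrow> (\<Inter>n. A n) = {}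
      \<Longrightarrow> (\<lambda>n::nat. \<phi> (A n)) \<longlonglongrightarrow> 0"
  obtains M where "sets M = sets borel" "prob_space M" "\<And>A. A \<in> fcyl \<Longrightarrow> measure M A = \<phi> A"
proof -
  let ?S = "\<lambda>J. PiM J (\<lambda>_. borel :: real measure)"
  let ?emb = "\<lambda>J B. prod_emb UNIV (\<lambda>_. borel :: real measure) J B"
  \<comment> \<open>For infinite \<open>J\<close> the set function need not be a measure; the
    projective family refers to finite \<open>J\<close> only.\<close>
  define P where "P J = measure_of (space (?S J)) (sets (?S J)) (\<lambda>B. ennreal (\<phi> (?emb J B)))" for J
  have sets_P: "sets (P J) = sets (?S J)" for J
    unfolding P_def by (simp add: sets.space_closed)
  have space_P: "space (P J) = space (?S J)" for J
    using sets_P by (rule sets_eq_imp_space_eq)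
  have emb_fcyl: "?emb J B \<in> fcyl" if "finite J" "B \<in> sets (?S J)" for J B
    using that by (intro fcylI[of J] prod_emb_cyl)
  have empty: "\<phi> {} = 0"
  proof -
    have "{} \<in> (fcyl :: ('v \<Rightarrow> real) set set)" by (rule fcylI[of "{}"]) (auto intro: cylI)
    then show ?thesis using add[of "{}" "{}"] by simp
  qed
  have em: "emeasure (P J) B = ennreal (\<phi> (?emb J B))" if "finite J" "B \<in> sets (?S J)" for J B
    unfolding P_def
  proof (rule emeasure_measure_of_sigma)
    let ?f = "\<lambda>B. ennreal (\<phi> (?emb J B))"
    show "sigma_algebra (space (?S J)) (sets (?S J))" ..
    show pos: "positive (sets (?S J)) ?f"
      by (simp add: positive_def empty)
    show "countably_additive (sets (?S J)) ?f"
    proof (rule sets.empty_continuous_imp_countably_additive[OF pos])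
      show "additive (sets (?S J)) ?f"
        unfolding additive_def
      proof (intro ballI impI)
        fix x y assume xy: "x \<in> sets (?S J)" "y \<in> sets (?S J)" "x \<inter> y = {}"
        have "\<phi> (?emb J (x \<union> y)) = \<phi> (?emb J x) + \<phi> (?emb J y)"
          unfolding prod_emb_Un using xy that
          by (intro add emb_fcyl) (auto simp flip: prod_emb_Int)
        then show "?f (x \<union> y) = ?f x + ?f y"
          using xy that by (simp add: nonneg emb_fcyl ennreal_plus)
      qed
      show "\<forall>A\<in>sets (?S J). ?f A \<noteq> \<infinity>" by simp
      fix A :: "nat \<Rightarrow> _" assume A: "range A \<subseteq> sets (?S J)" "decseq A" "(\<Inter>i. A i) = {}"
      have "(\<lambda>n. \<phi> (?emb J (A n))) \<longlonglongrightarrow> 0"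
      proof (rule cont[OF \<open>finite J\<close>])
        show "?emb J (A n) \<in> cyl J" for n using A by (intro prod_emb_cyl) auto
        show "decseq (\<lambda>n. ?emb J (A n))"
          using A(2) unfolding decseq_def by (intro allI impI prod_emb_mono) auto
        show "(\<Inter>n. ?emb J (A n)) = {}"
          using A(3) by (auto simp: prod_emb_def)
      qed
      then have "(\<lambda>n. ennreal (\<phi> (?emb J (A n)))) \<longlonglongrightarrow> ennreal 0"
        by (rule tendsto_ennrealI)
      then show "(\<lambda>i. ?f (A i)) \<longlonglongrightarrow> 0" by simp
    qed
  qed fact
  have prob_P: "prob_space (P J)" if "finite J" for J
  proof -
    have "(\<lambda>x. restrict x J) -` (J \<rightarrow>\<^sub>E UNIV) = (UNIV :: ('v \<Rightarrow> real) set)" by auto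
    then show ?thesis
      using one that
      by (intro prob_spaceI) (simp add: space_P em space_PiM prod_emb_def PiE_UNIV_domain)
  qed
  have pf: "projective_family UNIV P (\<lambda>_. borel)"
  proof (rule projective_family.intro)
    fix J H :: "'v set" assume JH: "J \<subseteq> H" "finite H" "H \<subseteq> UNIV"
    then have fJ: "finite J" by (auto intro: finite_subset)
    have meas: "(\<lambda>f. restrict f J) \<in> P H \<rightarrow>\<^sub>M ?S J"
      using measurable_restrict_subset[OF JH(1)] sets_P[of H]
      by (metis measurable_cong_sets)
    show "P J = distr (P H) (?S J) (\<lambda>f. restrict f J)"
    proof (rule measure_eqI)
      show "sets (P J) = sets (distr (P H) (?S J) (\<lambda>f. restrict f J))" by (simp add: sets_P)
      fix B assume "B \<in> sets (P J)"
      then have B: "B \<in> sets (?S J)" by (simp add: sets_P)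
      have eq: "(\<lambda>f. restrict f J) -` B \<inter> space (P H) = prod_emb H (\<lambda>_. borel) J B"
        by (auto simp: prod_emb_def space_P space_PiM)
      have "?emb H (prod_emb H (\<lambda>_. borel) J B) = ?emb J B"
        using JH by (simp add: prod_emb_trans)
      then show "emeasure (P J) B = emeasure (distr (P H) (?S J) (\<lambda>f. restrict f J)) B"
        using B JH fJ by (subst emeasure_distr[OF meas]) (simp_all add: eq em)
    qed
  next
    show "prob_space (P J)" if "finite J" "J \<subseteq> UNIV" for J by (rule prob_P[OF that(1)])
  qed
  interpret polish_projective UNIV P
    by (rule polish_projective.intro[OF pf])
  have "sets lim = sets (borel :: ('v \<Rightarrow> real) measure)"
    by (simp add: sets_PiM_equal_borel)
  moreover have "prob_space lim" by (rule P.prob_space_axioms)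
  moreover have "measure lim A = \<phi> A" if A: "A \<in> fcyl" for A
  proof -
    obtain J where J: "finite J" "A \<in> cyl J" using A by (auto simp: fcyl_def)
    obtain B where B: "B \<in> sets (?S J)" "A = ?emb J B" using cyl_eq_prod_emb[OF J(2)] .
    have "emeasure lim A = ennreal (\<phi> A)"
      using emeasure_lim_emb[of J B] J B em[of J B] by simp
    then show ?thesis
      using nonneg[OF A] by (simp add: measure_def)
  qed
  ultimately show thesis using that by blast
qed

section \<open>Integrals of functions of finitely many coordinates\<close>

definition fcyl_meas :: "(('v::countable \<Rightarrow> real) \<Rightarrow> real) \<Rightarrow> bool" where
  "fcyl_meas g \<longleftrightarrow> g \<in> borel_measurable borel \<and>
     (\<exists>J. finite J \<and> (\<forall>\<omega> \<eta>. (\<forall>x\<in>J. \<omega> x = \<eta> x) \<longrightarrow> g \<omega> = g \<eta>))"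

lemma fcyl_measI:
  "g \<in> borel_measurable borel \<Longrightarrow> finite J \<Longrightarrow>
    (\<And>\<omega> \<eta>. (\<And>x. x \<in> J \<Longrightarrow> \<omega> x = \<eta> x) \<Longrightarrow> g \<omega> = g \<eta>) \<Longrightarrow> fcyl_meas g"
  unfolding fcyl_meas_def by blast

lemma fcyl_meas_superlevel:
  assumes "fcyl_meas g" shows "{\<omega>. c \<le> g \<omega>} \<in> fcyl"
proof -
  obtain J where [measurable]: "g \<in> borel_measurable borel" and J: "finite J"
    "\<And>\<omega> \<eta>. (\<forall>x\<in>J. \<omega> x = \<eta> x) \<Longrightarrow> g \<omega> = g \<eta>"
    using assms unfolding fcyl_meas_def by blast
  have "{\<omega> \<in> space borel. c \<le> g \<omega>} \<in> sets borel" by measurable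
  then have "{\<omega>. c \<le> g \<omega>} \<in> cyl J"
    by (intro cylI) (simp, metis J(2) mem_Collect_eq)
  then show ?thesis by (rule fcylI[OF J(1)])
qed

text \<open>A discrete layer-cake formula: the levels \<open>j / k\<close> lying below
  \<open>g\<close> number \<open>floor (k * g)\<close>. The error \<open>1 / k\<close> does not
  depend on the measure, which is what turns convergence on events into convergence of
  integrals.\<close>

lemma integral_layer_approx:
  fixes M :: "'a measure" and g :: "'a \<Rightarrow> real"
  assumes "prob_space M" and g[measurable]: "g \<in> borel_measurable M"
    and bd: "\<And>\<omega>. 0 \<le> g \<omega>" "\<And>\<omega>. g \<omega> \<le> 1" and k: "0 < (k::nat)"
  shows "\<bar>(\<integral>\<omega>. g \<omega> \<partial>M) - (\<Sum>j=1..k. measure M {\<omega>\<in>space M. real j / real k \<le> g \<omega>}) / k\<bar> \<le> 1 / k"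
proof -
  interpret prob_space M by fact
  let ?s = "\<lambda>\<omega>. (\<Sum>j=1..k. indicator {\<omega>\<in>space M. real j / real k \<le> g \<omega>} \<omega>) / real k :: real"
  have s_eq: "?s \<omega> = real_of_int \<lfloor>k * g \<omega>\<rfloor> / k" if "\<omega> \<in> space M" for \<omega>
  proof -
    define m where "m = nat \<lfloor>k * g \<omega>\<rfloor>"
    have m: "real m = real_of_int \<lfloor>k * g \<omega>\<rfloor>" using bd(1)[of \<omega>] by (simp add: m_def)
    have iff: "real j / real k \<le> g \<omega> \<longleftrightarrow> j \<le> m" for j
    proof -
      have "real j / real k \<le> g \<omega> \<longleftrightarrow> real j \<le> k * g \<omega>" using k by (simp add: field_simps)
      also have "\<dots> \<longleftrightarrow> int j \<le> \<lfloor>k * g \<omega>\<rfloor>" by (simp add: le_floor_iff)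
      also have "\<dots> \<longleftrightarrow> j \<le> m" using bd(1)[of \<omega>] by (auto simp: m_def le_nat_iff)
      finally show ?thesis .
    qed
    have "real k * g \<omega> \<le> real k * 1" using bd(2)[of \<omega>] by (intro mult_left_mono) auto
    then have "real m \<le> real k" unfolding m by linarith
    then have mk: "m \<le> k" by simp
    have "(\<Sum>j=1..k. indicator {\<omega>\<in>space M. real j / real k \<le> g \<omega>} \<omega>)
        = (\<Sum>j=1..k. if j \<le> m then 1 else 0 :: real)"
      using that by (intro sum.cong) (auto simp: iff)
    also have "\<dots> = card {j \<in> {1..k}. j \<le> m}"
      by (simp flip: sum.inter_filter)
    also have "{j \<in> {1..k}. j \<le> m} = {1..m}" using mk by auto
    finally show ?thesis by (simp add: m)
  qed
  have ineq: "\<bar>g \<omega> - ?s \<omega>\<bar> \<le> 1 / k" if "\<omega> \<in> space M" for \<omega>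
  proof -
    have "g \<omega> - ?s \<omega> = (k * g \<omega> - real_of_int \<lfloor>k * g \<omega>\<rfloor>) / k"
      unfolding s_eq[OF that] using k by (simp add: field_simps)
    moreover have "\<bar>k * g \<omega> - real_of_int \<lfloor>k * g \<omega>\<rfloor>\<bar> \<le> 1" by linarith
    ultimately show ?thesis using k by (simp add: abs_divide divide_right_mono)
  qed
  have "{\<omega> \<in> space M. real j / real k \<le> g \<omega>} \<in> sets M" for j by measurable
  then have int_ind: "integrable M (indicat_real {\<omega> \<in> space M. real j / real k \<le> g \<omega>})" for j
    by (intro integrable_real_indicator) (simp_all add: less_top[symmetric])
  then have int_s: "integrable M ?s"
    by (intro integrable_divide_zero Bochner_Integration.integrable_sum) auto
  have int_g: "integrable M g"
    by (rule integrable_const_bound[of _ 1]) (use bd in auto)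
  have "(\<integral>\<omega>. ?s \<omega> \<partial>M) = (\<Sum>j=1..k. measure M {\<omega>\<in>space M. real j / real k \<le> g \<omega>}) / k"
    by (subst integral_divide_zero, subst Bochner_Integration.integral_sum[OF int_ind]) simp
  then have "\<bar>(\<integral>\<omega>. g \<omega> \<partial>M) - (\<Sum>j=1..k. measure M {\<omega>\<in>space M. real j / real k \<le> g \<omega>}) / k\<bar>
      = \<bar>\<integral>\<omega>. g \<omega> - ?s \<omega> \<partial>M\<bar>"
    unfolding Bochner_Integration.integral_diff[OF int_g int_s] by (simp only:)
  also have "\<dots> \<le> (\<integral>\<omega>. \<bar>g \<omega> - ?s \<omega>\<bar> \<partial>M)"
    by (rule integral_abs_bound)
  also have "\<dots> \<le> (\<integral>\<omega>. 1 / k \<partial>M)"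
    using int_s int_g ineq by (intro integral_mono) auto
  finally show ?thesis by (simp add: prob_space)
qed

lemma tendsto_integral_fcyl_unit:
  fixes M :: "'i \<Rightarrow> ('v::countable \<Rightarrow> real) measure" and N :: "('v \<Rightarrow> real) measure"
  assumes M: "\<forall>\<^sub>F i in F. sets (M i) = sets borel \<and> prob_space (M i)"
    and N: "sets N = sets borel" "prob_space N"
    and conv: "\<And>A. A \<in> fcyl \<Longrightarrow> ((\<lambda>i. measure (M i) A) \<longlongrightarrow> measure N A) F"
    and g: "fcyl_meas g" "\<And>\<omega>. 0 \<le> g \<omega>" "\<And>\<omega>. g \<omega> \<le> 1"
  shows "((\<lambda>i. \<integral>\<omega>. g \<omega> \<partial>M i) \<longlongrightarrow> (\<integral>\<omega>. g \<omega> \<partial>N)) F"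
proof (rule tendstoI)
  fix e :: real assume "0 < e"
  then obtain k :: nat where k: "0 < k" "1 / k < e / 3"
    using reals_Archimedean[of "e/3"]
        by (metis nat.distinct(1) neq0_conv divide_pos_pos inverse_eq_divide zero_less_numeral)
  have gm: "g \<in> borel_measurable borel" using g(1) by (simp add: fcyl_meas_def)
  let ?S = "\<lambda>L. (\<Sum>j=1..k. measure L {\<omega>. real j / real k \<le> g \<omega>}) / real k"
  have approx: "\<bar>(\<integral>\<omega>. g \<omega> \<partial>L) - ?S L\<bar> \<le> 1 / k" if "sets L = sets borel" "prob_space L" for L
  proof -
    have "space L = UNIV" using sets_eq_imp_space_eq[OF that(1)] by simp
    moreover have "g \<in> borel_measurable L" using gm that(1) by (metis measurable_cong_sets)
    ultimately show ?thesis
      using integral_layer_approx[OF that(2), of g k] g k by simp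
  qed
  have "((\<lambda>i. ?S (M i)) \<longlongrightarrow> ?S N) F"
    by (intro tendsto_divide tendsto_sum conv fcyl_meas_superlevel g tendsto_const) (use k in auto)
  then have "\<forall>\<^sub>F i in F. dist (?S (M i)) (?S N) < e / 3"
    using \<open>0 < e\<close> by (intro tendstoD) auto
  with M show "\<forall>\<^sub>F i in F. dist (\<integral>\<omega>. g \<omega> \<partial>M i) (\<integral>\<omega>. g \<omega> \<partial>N) < e"
  proof eventually_elim
    case (elim i)
    then show ?case
      using approx[of "M i"] approx[OF N] k(2) unfolding dist_real_def by linarith
  qed
qed

lemma tendsto_integral_fcyl:
  fixes M :: "'i \<Rightarrow> ('v::countable \<Rightarrow> real) measure" and N :: "('v \<Rightarrow> real) measure"
  assumes M: "\<forall>\<^sub>F i in F. sets (M i) = sets borel \<and> prob_space (M i)"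
    and N: "sets N = sets borel" "prob_space N"
    and conv: "\<And>A. A \<in> fcyl \<Longrightarrow> ((\<lambda>i. measure (M i) A) \<longlongrightarrow> measure N A) F"
    and g: "fcyl_meas g" "\<And>\<omega>. \<bar>g \<omega>\<bar> \<le> B"
  shows "((\<lambda>i. \<integral>\<omega>. g \<omega> \<partial>M i) \<longlongrightarrow> (\<integral>\<omega>. g \<omega> \<partial>N)) F"
proof -
  \<comment> \<open>\<open>B + 1\<close> instead of \<open>B\<close>, so that the affine rescaling
    to the unit interval divides by a positive number also when \<open>B = 0\<close>.\<close>
  define C where "C = B + 1"
  have B0: "0 \<le> B" using g(2)[of undefined] by linarith
  have C: "0 < C" unfolding C_def using B0 by simp
  define h where "h \<omega> = (g \<omega> + C) / (2 * C)" for \<omega>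
  have "fcyl_meas h"
    using g(1) unfolding fcyl_meas_def h_def by (auto; metis)
  moreover have "0 \<le> h \<omega>" "h \<omega> \<le> 1" for \<omega>
    using g(2)[of \<omega>] C unfolding h_def C_def by (auto simp: field_simps)
  ultimately have lim: "((\<lambda>i. \<integral>\<omega>. h \<omega> \<partial>M i) \<longlongrightarrow> (\<integral>\<omega>. h \<omega> \<partial>N)) F"
    by (intro tendsto_integral_fcyl_unit[OF M N] conv)
  have eq: "(\<integral>\<omega>. g \<omega> \<partial>L) = 2 * C * (\<integral>\<omega>. h \<omega> \<partial>L) - C" if "sets L = sets borel" "prob_space L" for L
  proof -
    interpret prob_space L by fact
    have gm: "g \<in> borel_measurable L" 
      using g(1) that(1) unfolding fcyl_meas_def by (metis measurable_cong_sets)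
    have "integrable L g"
      by (rule integrable_const_bound[of _ B]) (use g gm in auto)
    then have "(\<integral>\<omega>. h \<omega> \<partial>L) = ((\<integral>\<omega>. g \<omega> \<partial>L) + C) / (2 * C)"
      unfolding h_def by (simp add: prob_space)
    then show ?thesis using C by (simp add: field_simps)
  qed
  have "((\<lambda>i. 2 * C * (\<integral>\<omega>. h \<omega> \<partial>M i) - C) \<longlongrightarrow> 2 * C * (\<integral>\<omega>. h \<omega> \<partial>N) - C) F"
    by (intro tendsto_intros lim)
  then show ?thesis
    unfolding eq[OF N] by (rule Lim_transform_eventually) (use M in eventually_elim, simp add: eq)
qed

subsection \<open>Elementary inequalities and one-dimensional integrals\<close>

text \<open>No optimisation is made: either the left side is below the first term, or
  \<open>t powr (q - r)\<close> is at most \<open>n / \<epsilon>\<close> and the second term takes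
  over. The exponent \<open>q / (q - r)\<close> of \<open>n\<close> is the one later compared with
  \<open>1 + \<theta>\<close>.\<close>

lemma young_powr:
  fixes t n \<epsilon> r q :: real
  assumes "0 \<le> t" "0 \<le> n" "0 < \<epsilon>" "0 < r" "r < q"
  shows "n * t powr r \<le> \<epsilon> * t powr q + n powr (q / (q - r)) * \<epsilon> powr (- (r / (q - r)))"
proof (cases "t = 0 \<or> n = 0")
  case True
  then show ?thesis using assms by auto
next
  case False
  then have t: "0 < t" and n: "0 < n" using assms by auto
  have tq: "t powr q = t powr (q - r) * t powr r" by (simp flip: powr_add)
  show ?thesis
  proof (cases "n \<le> \<epsilon> * t powr (q - r)")
    case True
    then have "n * t powr r \<le> \<epsilon> * t powr q"
      unfolding tq using mult_right_mono[OF True, of "t powr r"] by (simp add: mult_ac)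
    then show ?thesis
      by (smt (verit) assms(3) mult_nonneg_nonneg powr_ge_zero)
  next
    case False
    then have "t powr (q - r) \<le> n / \<epsilon>"
      using assms by (simp add: field_simps)
    then have "(t powr (q - r)) powr (r / (q - r)) \<le> (n / \<epsilon>) powr (r / (q - r))"
      using assms by (intro powr_mono2) auto
    then have "t powr r \<le> (n / \<epsilon>) powr (r / (q - r))"
      using assms by (simp add: powr_powr)
    also have "\<dots> = n powr (r / (q - r)) * \<epsilon> powr (- (r / (q - r)))"
      using n assms by (simp add: powr_divide powr_minus field_simps)
    finally have "n * t powr r \<le> n * (n powr (r / (q - r)) * \<epsilon> powr (- (r / (q - r))))"
      using n by (intro mult_left_mono) auto
    also have "n * (n powr (r / (q - r)) * \<epsilon> powr (- (r / (q - r))))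
        = (n powr 1 * n powr (r / (q - r))) * \<epsilon> powr (- (r / (q - r)))"
      using n by simp
    also have "n powr 1 * n powr (r / (q - r)) = n powr (q / (q - r))"
      unfolding powr_add[symmetric] using assms by (simp add: field_simps)
    finally show ?thesis
      by (smt (verit) assms(3) mult_nonneg_nonneg powr_ge_zero)
  qed
qed

text \<open>Reduces integrability of \<open>exp (- b * |u|^q)\<close>, for arbitrarily small
  \<open>q\<close>, to that of \<open>1 / (1 + u^2)\<close>.\<close>

lemma one_plus_square_le_exp_powr:
  fixes b q :: real
  assumes "0 < b" "0 < q"
  obtains C where "0 < C" "\<And>u. 1 + u\<^sup>2 \<le> C * exp (b * \<bar>u\<bar> powr q)"
proof -
  obtain k :: nat where k: "2 / q \<le> real k" "0 < k"
    by (metis real_arch_simple le_max_iff_disj max.strict_coboundedI2 of_nat_max zero_less_one max.cobounded1 order.trans of_nat_mono)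
  \<comment> \<open>With \<open>q * k >= 2\<close>, the square is at most
    \<open>(k/b)^k * (b * |u|^q / k)^k\<close> for \<open>|u| >= 1\<close>, and
    \<open>s <= exp s\<close> absorbs the last factor; the summand 2 covers
    \<open>|u| <= 1\<close>.\<close>
  define C where "C = 2 + (k / b) ^ k"
  have Ck: "0 \<le> (k / b) ^ k" using assms by auto
  have "1 + u\<^sup>2 \<le> C * exp (b * \<bar>u\<bar> powr q)" for u
  proof (cases "\<bar>u\<bar> \<le> 1")
    case True
    then have "1 + u\<^sup>2 \<le> 2" by (simp add: abs_square_le_1)
    also have "\<dots> \<le> C * 1" unfolding C_def using Ck by auto
    also have "\<dots> \<le> C * exp (b * \<bar>u\<bar> powr q)"
      using assms Ck unfolding C_def by (intro mult_left_mono) auto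
    finally show ?thesis .
  next
    case False
    have "u\<^sup>2 = \<bar>u\<bar> powr 2" using False by (simp add: powr_numeral)
    also have "\<dots> \<le> \<bar>u\<bar> powr (q * k)"
      using False k assms by (intro powr_mono) (auto simp: field_simps)
    also have "\<dots> = (\<bar>u\<bar> powr q) ^ k"
      using False k by (simp flip: powr_powr add: powr_realpow)
    also have "\<dots> = (k / b) ^ k * (b * \<bar>u\<bar> powr q / k) ^ k"
      unfolding power_mult_distrib[symmetric] using k assms by simp
    also have "\<dots> \<le> (k / b) ^ k * (exp (b * \<bar>u\<bar> powr q / k)) ^ k"
      using Ck assms by (intro mult_left_mono power_mono order_trans[OF _ exp_ge_add_one_self]) auto
    also have "(exp (b * \<bar>u\<bar> powr q / k)) ^ k = exp (b * \<bar>u\<bar> powr q)"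
      using k by (simp flip: exp_of_nat_mult)
    finally have 1: "u\<^sup>2 \<le> (k / b) ^ k * exp (b * \<bar>u\<bar> powr q)" .
    have "1 \<le> exp (b * \<bar>u\<bar> powr q)" using assms by simp
    then show ?thesis using 1 unfolding C_def distrib_right by linarith
  qed
  moreover have "0 < C" unfolding C_def using Ck by auto
  ultimately show thesis using that by blast
qed

lemma nn_integral_exp_neg_powr_finite:
  fixes b q :: real
  assumes "0 < b" "0 < q"
  shows "(\<integral>\<^sup>+u. ennreal (exp (- (b * \<bar>u\<bar> powr q))) \<partial>lborel) < \<infinity>"
proof -
  obtain C where C: "0 < C" "\<And>u. 1 + u\<^sup>2 \<le> C * exp (b * \<bar>u\<bar> powr q)"
    using one_plus_square_le_exp_powr[OF assms] by blast
  have "integrable lborel (\<lambda>x::real. inverse (1 + x\<^sup>2))"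
    using integrable_inverse_1_plus_square
    by (simp add: set_integrable_def einterval_def)
  then have "(\<integral>\<^sup>+u. ennreal (norm (inverse (1 + u\<^sup>2) :: real)) \<partial>lborel) < \<infinity>"
    by (simp add: integrable_iff_bounded)
  then have fin: "ennreal C * (\<integral>\<^sup>+u. ennreal (inverse (1 + u\<^sup>2) :: real) \<partial>lborel) < \<infinity>"
    by (simp add: ennreal_mult_less_top)
  have "exp (- (b * \<bar>u\<bar> powr q)) \<le> C * inverse (1 + u\<^sup>2)" for u
  proof -
    have "0 < 1 + u\<^sup>2" by (simp add: add_pos_nonneg)
    then show ?thesis using C(2)[of u] by (simp add: exp_minus field_simps)
  qed
  then have "(\<integral>\<^sup>+u. ennreal (exp (- (b * \<bar>u\<bar> powr q))) \<partial>lborel)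
      \<le> (\<integral>\<^sup>+u. ennreal C * ennreal (inverse (1 + u\<^sup>2)) \<partial>lborel)"
    using C(1) by (intro nn_integral_mono) (simp flip: ennreal_mult)
  also have "\<dots> = ennreal C * (\<integral>\<^sup>+u. ennreal (inverse (1 + u\<^sup>2)) \<partial>lborel)"
    by (rule nn_integral_cmult) measurable
  finally show ?thesis using fin by simp
qed

lemma ennreal_inverse_antimono:
  assumes "z \<le> Z" shows "inverse Z \<le> inverse (z :: ennreal)"
proof (cases "z = 0 \<or> Z = top")
  case False
  then obtain a b where "z = ennreal a" "Z = ennreal b" "0 < a" "a \<le> b"
    using assms by (cases z; cases Z) (auto simp: top_unique)
  then show ?thesis by (simp add: inverse_ennreal le_imp_inverse_le)
qed auto

text \<open>At each point the truncations are exact from some \<open>N\<close> on, so Fatou's lemma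
  removes them. Both dominated convergence and convergence on cylinder events reach moments only
  through their truncations.\<close>

lemma nn_integral_le_of_truncations:
  fixes f :: "'a \<Rightarrow> real"
  assumes [measurable]: "f \<in> borel_measurable M"
    and le: "\<And>N::nat. (\<integral>\<^sup>+\<omega>. min (ennreal (real N)) (ennreal (f \<omega>)) \<partial>M) \<le> C"
  shows "(\<integral>\<^sup>+\<omega>. ennreal (f \<omega>) \<partial>M) \<le> C"
proof -
  have "(\<integral>\<^sup>+\<omega>. ennreal (f \<omega>) \<partial>M)
      = (\<integral>\<^sup>+\<omega>. liminf (\<lambda>N. min (ennreal (real N)) (ennreal (f \<omega>))) \<partial>M)"
  proof (rule nn_integral_cong)
    fix \<omega>
    obtain N0 :: nat where N0: "f \<omega> \<le> real N0" using real_arch_simple by blast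
    have "min (ennreal (real N)) (ennreal (f \<omega>)) = ennreal (f \<omega>)" if "N0 \<le> N" for N
      using N0 that by (intro min_absorb2 ennreal_leI) (meson of_nat_le_iff order_trans)
    then have "(\<lambda>N. min (ennreal (real N)) (ennreal (f \<omega>))) \<longlonglongrightarrow> ennreal (f \<omega>)"
      by (intro tendsto_eventually) (auto simp: eventually_sequentially)
    then show "ennreal (f \<omega>) = liminf (\<lambda>N. min (ennreal (real N)) (ennreal (f \<omega>)))"
      by (simp add: lim_imp_Liminf)
  qed
  also have "\<dots> \<le> liminf (\<lambda>N. \<integral>\<^sup>+\<omega>. min (ennreal (real N)) (ennreal (f \<omega>)) \<partial>M)"
    by (rule nn_integral_liminf) measurable
  also have "\<dots> \<le> liminf (\<lambda>N::nat. C)"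
    by (intro Liminf_mono always_eventually allI le)
  also have "\<dots> = C" by (simp add: Liminf_const)
  finally show ?thesis .
qed

section \<open>Product topology on function spaces and an inequality for powers\<close>

lemma tendsto_fun_coordinates:
  fixes f :: "'i \<Rightarrow> 'a \<Rightarrow> 'b::topological_space"
  assumes "(f \<longlongrightarrow> l) F" shows "((\<lambda>i. f i x) \<longlongrightarrow> l x) F"
proof (rule topological_tendstoI)
  fix S :: "'b set" assume S: "open S" "l x \<in> S"
  have "open ((\<lambda>g::'a \<Rightarrow> 'b. g x) -` S)" by (rule open_vimage[OF S(1)]) simp
  from topological_tendstoD[OF assms this] S(2) show "\<forall>\<^sub>F i in F. f i x \<in> S" by simp
qed

text \<open>Tychonoff's theorem. It serves twice: with vertices as index set, to extract pointwise
  convergent sequences of configurations, and with sets of configurations as index set, to find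
  limits of set functions.\<close>

lemma compact_Pi_Icc: "compact {\<omega>::'a \<Rightarrow> real. \<forall>x. \<omega> x \<in> {l x..u x}}"
proof -
  have "compactin (product_topology (\<lambda>_. euclidean) UNIV) (PiE UNIV (\<lambda>x. {l x..u x}))"
    by (subst compactin_PiE) auto
  moreover have "PiE UNIV (\<lambda>x. {l x..u x}) = {\<omega>. \<forall>x. \<omega> x \<in> {l x..u x}}" by auto
  ultimately show ?thesis by (simp add: euclidean_product_topology)
qed

text \<open>A quasi-triangle inequality covering \<open>p < 1\<close> as well, which must be allowed
  since \<open>r + r / \<theta>\<close> may be below 1.\<close>

lemma abs_diff_powr_le:
  fixes a b p :: real
  assumes "0 < p" shows "\<bar>a - b\<bar> powr p \<le> 2 powr p * (\<bar>a\<bar> powr p + \<bar>b\<bar> powr p)"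
proof -
  have "\<bar>a - b\<bar> powr p \<le> (2 * max \<bar>a\<bar> \<bar>b\<bar>) powr p" using assms by (intro powr_mono2) auto
  also have "\<dots> = 2 powr p * (max \<bar>a\<bar> \<bar>b\<bar>) powr p" by (simp add: powr_mult)
  also have "(max \<bar>a\<bar> \<bar>b\<bar>) powr p \<le> \<bar>a\<bar> powr p + \<bar>b\<bar> powr p" by (simp add: max_def)
  finally show ?thesis by (simp add: mult_left_mono)
qed

subsection \<open>The model and its Gibbs kernels\<close>

locale spin_model =
  fixes E :: "'v::countable \<Rightarrow> 'v \<Rightarrow> bool"
    and o\<^sub>0 :: 'v
    and W :: "real \<Rightarrow> real \<Rightarrow> real" and V :: "real \<Rightarrow> real"
    and \<theta> I\<^sub>W J\<^sub>W r a\<^sub>V c\<^sub>V q \<alpha>up :: real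
  assumes sym: "\<And>x y. E x y \<Longrightarrow> E y x"
    and irrefl: "\<And>x. \<not> E x x"
    and loc_fin: "\<And>x. finite {y. E x y}"
    and connected: "\<And>x y. E\<^sup>*\<^sup>* x y"
    and theta_pos: "0 < \<theta>"
    and Theta_some: "\<exists>\<alpha>>0. Theta_finite E o\<^sub>0 \<alpha> \<theta>"
    and W_cont: "continuous_on UNIV (\<lambda>(u, v). W u v)"
    and W_sym: "\<And>u v. W u v = W v u"
    and IW: "0 < I\<^sub>W" and JW: "0 < J\<^sub>W" and r_pos: "0 < r"
    and W_bound: "\<And>u v. \<bar>W u v\<bar> \<le> (I\<^sub>W + J\<^sub>W * (\<bar>u\<bar> powr r + \<bar>v\<bar> powr r)) / 2"
    and V_cont: "continuous_on UNIV V"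
    and aV: "0 < a\<^sub>V" and cV: "0 < c\<^sub>V"
    and V_bound: "\<And>u. V u \<ge> a\<^sub>V * \<bar>u\<bar> powr q - c\<^sub>V"
    and q_gt: "q > r + r / \<theta>"
    and alpha_up: "\<alpha>up > alpha_low E o\<^sub>0 \<theta>"
    and Theta_range: "\<And>\<alpha>. alpha_low E o\<^sub>0 \<theta> < \<alpha> \<Longrightarrow> \<alpha> \<le> \<alpha>up \<Longrightarrow> Theta_finite E o\<^sub>0 \<alpha> \<theta>"
begin

lemma r_less_q: "r < q"
  using q_gt r_pos theta_pos by (smt (verit) divide_pos_pos)

lemma V_measurable [measurable]: "V \<in> borel_measurable borel"
  using V_cont by (rule borel_measurable_continuous_onI)

lemma W_measurable [measurable]: "case_prod W \<in> borel_measurable borel"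
  using W_cont by (intro borel_measurable_continuous_onI)

lemma nn_integral_single_site_finite:
  assumes "0 < p" "p < q"
  shows "(\<integral>\<^sup>+u. ennreal (exp (d * \<bar>u\<bar> powr p - V u)) \<partial>lborel) < \<infinity>"
proof -
  \<comment> \<open>Half of the growth of \<open>V\<close> absorbs \<open>d * |u|^p\<close>; the
    other half keeps the integral finite.\<close>
  define C where "C = \<bar>d\<bar> powr (q / (q - p)) * (a\<^sub>V/2) powr (- (p / (q - p))) + c\<^sub>V"
  have "d * \<bar>u\<bar> powr p - V u \<le> C - a\<^sub>V/2 * \<bar>u\<bar> powr q" for u
  proof -
    have "d * \<bar>u\<bar> powr p \<le> \<bar>d\<bar> * \<bar>u\<bar> powr p" by (intro mult_right_mono) auto
    also have "\<dots> \<le> (a\<^sub>V/2) * \<bar>u\<bar> powr q + (C - c\<^sub>V)"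
      unfolding C_def using young_powr[of "\<bar>u\<bar>" "\<bar>d\<bar>" "a\<^sub>V/2" p q] aV assms by simp
    finally show ?thesis using V_bound[of u] by simp
  qed
  then have "exp (d * \<bar>u\<bar> powr p - V u) \<le> exp C * exp (- (a\<^sub>V/2 * \<bar>u\<bar> powr q))" for u
    by (simp flip: exp_add)
  then have "(\<integral>\<^sup>+u. ennreal (exp (d * \<bar>u\<bar> powr p - V u)) \<partial>lborel)
      \<le> (\<integral>\<^sup>+u. ennreal (exp C) * ennreal (exp (- (a\<^sub>V/2 * \<bar>u\<bar> powr q))) \<partial>lborel)"
    by (intro nn_integral_mono) (simp flip: ennreal_mult)
  also have "\<dots> = ennreal (exp C) * (\<integral>\<^sup>+u. ennreal (exp (- (a\<^sub>V/2 * \<bar>u\<bar> powr q))) \<partial>lborel)"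
    by (rule nn_integral_cmult) measurable
  also have "\<dots> < \<infinity>"
    using nn_integral_exp_neg_powr_finite[of "a\<^sub>V/2" q] aV assms
    by (simp add: ennreal_mult_less_top)
  finally show ?thesis .
qed

text \<open>Integrating over \<open>[-1, 1]\<close> only, where \<open>|u|^r <= 1\<close> and
  \<open>V\<close> is bounded by continuity. As \<open>b\<close> does not depend on
  \<open>d\<close>, the loss is exactly \<open>exp (- d)\<close>, hence linear in the degree once
  logarithms are taken.\<close>

lemma single_site_lower_bound:
  obtains b where "0 < b"
    "\<And>d. 0 \<le> d \<Longrightarrow> ennreal (b * exp (- d)) \<le> (\<integral>\<^sup>+u. ennreal (exp (- d * \<bar>u\<bar> powr r - V u)) \<partial>lborel)"
proof -
  have "compact (V ` {-1..1})"
    by (intro compact_continuous_image continuous_on_subset[OF V_cont]) auto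
  then obtain B where B: "\<And>u. u \<in> {-1..1} \<Longrightarrow> V u \<le> B"
    by (metis bounded_imp_bdd_above compact_imp_bounded bdd_above.unfold imageI)
  have "ennreal (2 * exp (- B) * exp (- d)) \<le> (\<integral>\<^sup>+u. ennreal (exp (- d * \<bar>u\<bar> powr r - V u)) \<partial>lborel)"
    if "0 \<le> d" for d
  proof -
    have le: "exp (- B) * exp (- d) \<le> exp (- d * \<bar>u\<bar> powr r - V u)" if "u \<in> {-1..1}" for u
    proof -
      have "\<bar>u\<bar> powr r \<le> 1" using that r_pos by (intro powr_le1) auto
      then have "d * \<bar>u\<bar> powr r \<le> d * 1" using \<open>0 \<le> d\<close> by (intro mult_left_mono) auto
      then show ?thesis using B[OF that] by (simp flip: exp_add)
    qed
    have "(\<integral>\<^sup>+u. ennreal (exp (- B) * exp (- d)) * indicator {-1..1::real} u \<partial>lborel)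
        = ennreal (exp (- B) * exp (- d)) * emeasure lborel {-1..1::real}"
      by (rule nn_integral_cmult_indicator) simp
    also have "\<dots> = ennreal (2 * exp (- B) * exp (- d))"
      by (simp add: ennreal_mult mult_ac)
    finally have "ennreal (2 * exp (- B) * exp (- d))
        = (\<integral>\<^sup>+u. ennreal (exp (- B) * exp (- d)) * indicator {-1..1::real} u \<partial>lborel)" ..
    also have "\<dots> \<le> (\<integral>\<^sup>+u. ennreal (exp (- d * \<bar>u\<bar> powr r - V u)) \<partial>lborel)"
      by (intro nn_integral_mono) (auto simp: le[simplified] split: split_indicator)
    finally show ?thesis .
  qed
  then show thesis using that[of "2 * exp (- B)"] by simp
qed

text \<open>Ordered pairs, so every edge touching \<open>\<Lambda>\<close> occurs twice, including
  those that leave it. With the symmetry of \<open>W\<close> the interaction energy becomes one half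
  of a single sum.\<close>

definition edges :: "'v set \<Rightarrow> ('v \<times> 'v) set" where
  "edges \<Lambda> = {(x, y). E x y \<and> (x \<in> \<Lambda> \<or> y \<in> \<Lambda>)}"

lemma finite_edges:
  assumes "finite \<Lambda>" shows "finite (edges \<Lambda>)"
proof -
  have "edges \<Lambda> \<subseteq> (SIGMA x:\<Lambda>. {y. E x y}) \<union> prod.swap ` (SIGMA x:\<Lambda>. {y. E x y})"
    unfolding edges_def by (auto simp: image_iff dest: sym)
  then show ?thesis
    by (rule finite_subset) (intro finite_UnI finite_imageI finite_SigmaI assms loc_fin)
qed

definition bdry :: "'v set \<Rightarrow> 'v set" where
  "bdry \<Lambda> = {y. y \<notin> \<Lambda> \<and> (\<exists>x\<in>\<Lambda>. E x y)}"

lemma finite_bdry: "finite \<Lambda> \<Longrightarrow> finite (bdry \<Lambda>)"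
  by (rule finite_subset[of _ "\<Union>x\<in>\<Lambda>. {y. E x y}"]) (auto simp: bdry_def loc_fin)

lemma Ham_edges:
  assumes "finite \<Lambda>"
  shows "Ham E W V \<Lambda> \<eta> = (1/2) * (\<Sum>(x,y)\<in>edges \<Lambda>. W (\<eta> x) (\<eta> y)) + (\<Sum>x\<in>\<Lambda>. V (\<eta> x))"
proof -
  let ?A = "{(x,y). x \<in> \<Lambda> \<and> y \<in> \<Lambda> \<and> E x y}" and ?B = "{(x,y). x \<in> \<Lambda> \<and> y \<notin> \<Lambda> \<and> E x y}"
    and ?C = "{(x,y). x \<notin> \<Lambda> \<and> y \<in> \<Lambda> \<and> E x y}"
  let ?f = "\<lambda>(x,y). W (\<eta> x) (\<eta> y)"
  have e: "edges \<Lambda> = ?A \<union> ?B \<union> ?C" unfolding edges_def by auto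
  have fin: "finite ?A" "finite ?B" "finite ?C"
    using finite_edges[OF assms] unfolding e by auto
  have "sum ?f ?C = sum ?f ?B"
    by (rule sum.reindex_bij_witness[of _ prod.swap prod.swap]) (auto dest: sym simp: W_sym)
  moreover have "sum ?f (edges \<Lambda>) = sum ?f ?A + sum ?f ?B + sum ?f ?C"
    unfolding e using fin by (subst sum.union_disjoint; (subst sum.union_disjoint)?) auto
  ultimately show ?thesis unfolding Ham_def by (simp add: algebra_simps)
qed

lemma Ham_singleton: "Ham E W V {x} \<eta> = (\<Sum>y\<in>{y. E x y}. W (\<eta> x) (\<eta> y)) + V (\<eta> x)"
proof -
  have 1: "{(u,y). u \<in> {x} \<and> y \<in> {x} \<and> E u y} = {}" using irrefl by auto
  have "(\<Sum>(u,y)\<in>{(u,y). u \<in> {x} \<and> y \<notin> {x} \<and> E u y}. W (\<eta> u) (\<eta> y)) = (\<Sum>y\<in>{y. E x y}. W (\<eta> x) (\<eta> y))"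
    by (rule sum.reindex_bij_witness[of _ "\<lambda>y. (x, y)" snd]) (auto simp: irrefl)
  then show ?thesis unfolding Ham_def 1 by simp
qed

text \<open>An edge counted for \<open>\<Lambda>\<close> but not for \<open>\<Delta>\<close> has
  both ends outside \<open>\<Delta>\<close>.\<close>

lemma Ham_diff_off:
  assumes "finite \<Lambda>" "\<Delta> \<subseteq> \<Lambda>" and eq: "\<And>x. x \<notin> \<Delta> \<Longrightarrow> \<eta> x = \<zeta> x"
  shows "Ham E W V \<Lambda> \<eta> - Ham E W V \<Delta> \<eta> = Ham E W V \<Lambda> \<zeta> - Ham E W V \<Delta> \<zeta>"
proof -
  have fD: "finite \<Delta>" using assms finite_subset by auto
  have sub: "edges \<Delta> \<subseteq> edges \<Lambda>" using assms(2) unfolding edges_def by auto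
  have d: "Ham E W V \<Lambda> \<eta> - Ham E W V \<Delta> \<eta> = (1/2) * (\<Sum>(x,y)\<in>edges \<Lambda> - edges \<Delta>. W (\<eta> x) (\<eta> y))
      + (\<Sum>x\<in>\<Lambda> - \<Delta>. V (\<eta> x))" for \<eta>
    unfolding Ham_edges[OF assms(1)] Ham_edges[OF fD]
    using assms sum_diff[OF finite_edges[OF assms(1)] sub, of "\<lambda>(x,y). W (\<eta> x) (\<eta> y)"]
      sum_diff[OF assms(1,2), of "\<lambda>x. V (\<eta> x)"] by (simp add: field_simps)
  have "(\<Sum>(x,y)\<in>edges \<Lambda> - edges \<Delta>. W (\<eta> x) (\<eta> y)) = (\<Sum>(x,y)\<in>edges \<Lambda> - edges \<Delta>. W (\<zeta> x) (\<zeta> y))"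
  proof (rule sum.cong[OF refl], clarify)
    fix x y assume "(x, y) \<in> edges \<Lambda>" "(x, y) \<notin> edges \<Delta>"
    then have "x \<notin> \<Delta>" "y \<notin> \<Delta>" by (auto simp: edges_def)
    then show "W (\<eta> x) (\<eta> y) = W (\<zeta> x) (\<zeta> y)" by (simp add: eq)
  qed
  moreover have "(\<Sum>x\<in>\<Lambda> - \<Delta>. V (\<eta> x)) = (\<Sum>x\<in>\<Lambda> - \<Delta>. V (\<zeta> x))"
    by (intro sum.cong) (auto simp: eq)
  ultimately show ?thesis unfolding d by simp
qed

text \<open>The self-interaction is split off because its growth has no upper bound; what remains is
  of order \<open>r\<close> in the spins, with constants that see the boundary values only through
  \<open>R\<close>.\<close>

lemma Ham_bound:
  assumes "finite \<Lambda>"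
  obtains c d where "0 \<le> c" "0 \<le> d"
    "\<And>\<eta>. (\<And>y. y \<in> bdry \<Lambda> \<Longrightarrow> \<bar>\<eta> y\<bar> \<le> R) \<Longrightarrow>
      \<bar>Ham E W V \<Lambda> \<eta> - (\<Sum>x\<in>\<Lambda>. V (\<eta> x))\<bar> \<le> c + d * (\<Sum>x\<in>\<Lambda>. \<bar>\<eta> x\<bar> powr r)"
proof -
  define N where "N = real (card (edges \<Lambda>))"
  have "\<bar>Ham E W V \<Lambda> \<eta> - (\<Sum>x\<in>\<Lambda>. V (\<eta> x))\<bar>
      \<le> N * (I\<^sub>W + J\<^sub>W * \<bar>R\<bar> powr r) + N * J\<^sub>W * (\<Sum>x\<in>\<Lambda>. \<bar>\<eta> x\<bar> powr r)"
    if R: "\<And>y. y \<in> bdry \<Lambda> \<Longrightarrow> \<bar>\<eta> y\<bar> \<le> R" for \<eta>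
  proof -
    define S where "S = (\<Sum>x\<in>\<Lambda>. \<bar>\<eta> x\<bar> powr r)"
    have S0: "0 \<le> S" unfolding S_def by (intro sum_nonneg) auto
    have z: "\<bar>\<eta> z\<bar> powr r \<le> \<bar>R\<bar> powr r + S" if "z \<in> \<Lambda> \<union> bdry \<Lambda>" for z
    proof (cases "z \<in> \<Lambda>")
      case True
      then have "\<bar>\<eta> z\<bar> powr r \<le> S"
        unfolding S_def using member_le_sum[of z \<Lambda> "\<lambda>x. \<bar>\<eta> x\<bar> powr r"] assms by simp
      then show ?thesis by (simp add: add_increasing)
    next
      case False
      then have "\<bar>\<eta> z\<bar> \<le> \<bar>R\<bar>" using R[of z] that by simp
      then have "\<bar>\<eta> z\<bar> powr r \<le> \<bar>R\<bar> powr r" using r_pos by (intro powr_mono2) auto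
      then show ?thesis using S0 by simp
    qed
    have "\<bar>W (\<eta> x) (\<eta> y)\<bar> \<le> I\<^sub>W + J\<^sub>W * (\<bar>R\<bar> powr r + S)" if "(x, y) \<in> edges \<Lambda>" for x y
    proof -
      have "\<bar>\<eta> x\<bar> powr r \<le> \<bar>R\<bar> powr r + S" "\<bar>\<eta> y\<bar> powr r \<le> \<bar>R\<bar> powr r + S"
        using that sym[of x y] by (auto intro!: z simp: edges_def bdry_def)
      then have "J\<^sub>W * (\<bar>\<eta> x\<bar> powr r + \<bar>\<eta> y\<bar> powr r) \<le> J\<^sub>W * (2 * (\<bar>R\<bar> powr r + S))"
        using JW by (intro mult_left_mono) auto
      then show ?thesis using W_bound[of "\<eta> x" "\<eta> y"] IW by (simp add: algebra_simps)
    qed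
    then have "(\<Sum>(x,y)\<in>edges \<Lambda>. \<bar>W (\<eta> x) (\<eta> y)\<bar>) \<le> N * (I\<^sub>W + J\<^sub>W * (\<bar>R\<bar> powr r + S))"
      unfolding N_def by (intro sum_bounded_above) auto
    moreover have "\<bar>\<Sum>(x,y)\<in>edges \<Lambda>. W (\<eta> x) (\<eta> y)\<bar> \<le> (\<Sum>(x,y)\<in>edges \<Lambda>. \<bar>W (\<eta> x) (\<eta> y)\<bar>)"
      by (rule order_trans[OF sum_abs]) (auto intro!: sum_mono)
    ultimately have "\<bar>1/2 * (\<Sum>(x,y)\<in>edges \<Lambda>. W (\<eta> x) (\<eta> y))\<bar> \<le> N * (I\<^sub>W + J\<^sub>W * (\<bar>R\<bar> powr r + S))"
      by (simp add: abs_mult)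
    then show ?thesis
      unfolding Ham_edges[OF assms] S_def[symmetric] by (simp add: algebra_simps)
  qed
  moreover have "0 \<le> N * (I\<^sub>W + J\<^sub>W * \<bar>R\<bar> powr r)" "0 \<le> N * J\<^sub>W"
    using IW JW by (auto simp: N_def)
  ultimately show thesis using that by blast
qed

section \<open>Boltzmann weights, partition functions and kernels as measures\<close>

interpretation lb: product_sigma_finite "\<lambda>_::'v. lborel :: real measure" ..

abbreviation leb :: "'v set \<Rightarrow> ('v \<Rightarrow> real) measure" where
  "leb \<Lambda> \<equiv> PiM \<Lambda> (\<lambda>_. lborel)"

definition boltz :: "'v set \<Rightarrow> ('v \<Rightarrow> real) \<Rightarrow> ('v \<Rightarrow> real) \<Rightarrow> ennreal" where
  "boltz \<Lambda> \<omega> \<xi> = ennreal (exp (- Ham E W V \<Lambda> (merge_cfg \<Lambda> \<omega> \<xi>)))"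

definition ZE :: "'v set \<Rightarrow> ('v \<Rightarrow> real) \<Rightarrow> ennreal" where
  "ZE \<Lambda> \<xi> = (\<integral>\<^sup>+\<omega>. boltz \<Lambda> \<omega> \<xi> \<partial>leb \<Lambda>)"

text \<open>Built from nonnegative integrals, hence meaningful before the partition function is
  known to be finite and positive; \<open>kernel_eq_measure_ker\<close> identifies its values with
  \<open>kernel\<close>.\<close>

definition ker :: "'v set \<Rightarrow> ('v \<Rightarrow> real) \<Rightarrow> ('v \<Rightarrow> real) measure" where
  "ker \<Lambda> \<xi> = distr (density (leb \<Lambda>) (\<lambda>\<omega>. boltz \<Lambda> \<omega> \<xi> / ZE \<Lambda> \<xi>)) borel
     (\<lambda>\<omega>. merge_cfg \<Lambda> \<omega> \<xi>)"

lemma coord_measurable: "(\<lambda>\<omega>. \<omega> x) \<in> borel_measurable (borel :: ('v \<Rightarrow> real) measure)"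
  by (rule measurable_product_coordinates)

lemma Ham_measurable [measurable]: "Ham E W V \<Lambda> \<in> borel_measurable borel"
proof -
  have [measurable]: "(\<lambda>\<eta>. W (\<eta> x) (\<eta> y)) \<in> borel_measurable borel" for x y :: 'v
  proof -
    have "(\<lambda>\<eta>::'v \<Rightarrow> real. (\<eta> x, \<eta> y)) \<in> borel \<rightarrow>\<^sub>M borel" by (intro borel_measurable_Pair coord_measurable)
    from measurable_compose[OF this W_measurable] show ?thesis by simp
  qed
  note [measurable] = coord_measurable
  show ?thesis unfolding Ham_def[abs_def] case_prod_beta by measurable
qed

lemma merge_cfg_measurable [measurable]:
  fixes \<Lambda> :: "'v set"
  shows   "(\<lambda>(\<omega>, \<xi>). merge_cfg \<Lambda> \<omega> \<xi>) \<in> leb \<Lambda> \<Otimes>\<^sub>M borel \<rightarrow>\<^sub>M borel"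
proof (rule measurable_coordinatewise_then_product)
  show "(\<lambda>x. (case x of (\<omega>, \<xi>) \<Rightarrow> merge_cfg \<Lambda> \<omega> \<xi>) i)
      \<in> borel_measurable (leb \<Lambda> \<Otimes>\<^sub>M borel)" for i
  proof (cases "i \<in> \<Lambda>")
    case True
    then have [measurable]: "(\<lambda>\<omega>. \<omega> i) \<in> borel_measurable (leb \<Lambda>)"
      using measurable_component_singleton[of i \<Lambda> "\<lambda>_. lborel :: real measure"] by simp
    show ?thesis using True by (simp add: merge_cfg_def case_prod_beta)
  next
    case False
    have "(\<lambda>x. snd x i :: real) \<in> borel_measurable (leb \<Lambda> \<Otimes>\<^sub>M borel)"
      using measurable_compose[OF measurable_snd coord_measurable[of i]] .
    then show ?thesis using False by (simp add: merge_cfg_def case_prod_beta)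
  qed
qed

lemma merge_cfg_measurable1 [measurable]:
  fixes \<Lambda> :: "'v set"
  shows   "(\<lambda>\<omega>. merge_cfg \<Lambda> \<omega> \<xi>) \<in> leb \<Lambda> \<rightarrow>\<^sub>M borel"
  using measurable_compose[OF measurable_Pair2'[of \<xi> borel] merge_cfg_measurable] by simp

lemma boltz_measurable [measurable]:
  "(\<lambda>(\<omega>, \<xi>). boltz \<Lambda> \<omega> \<xi>) \<in> borel_measurable (leb \<Lambda> \<Otimes>\<^sub>M borel)"
proof -
  have "(\<lambda>x. ennreal (exp (- Ham E W V \<Lambda> x))) \<in> borel_measurable borel" by measurable
  from measurable_compose[OF merge_cfg_measurable this] show ?thesis
    by (simp add: boltz_def case_prod_beta)
qed

lemma boltz_measurable1 [measurable]:
  "(\<lambda>\<omega>. boltz \<Lambda> \<omega> \<xi>) \<in> borel_measurable (leb \<Lambda>)"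
  unfolding boltz_def by measurable

lemma ZE_measurable [measurable]:
  assumes "finite \<Lambda>" shows "ZE \<Lambda> \<in> borel_measurable borel"
proof -
  interpret finite_product_sigma_finite "\<lambda>_. lborel :: real measure" \<Lambda> by standard fact
  have "(\<lambda>(\<xi>, \<omega>). boltz \<Lambda> \<omega> \<xi>) \<in> borel_measurable (borel \<Otimes>\<^sub>M leb \<Lambda>)"
    using measurable_compose[OF measurable_pair_swap' boltz_measurable] by (simp add: case_prod_beta)
  then show ?thesis unfolding ZE_def[abs_def] by (rule borel_measurable_nn_integral)
qed

text \<open>A product of one-site factors, so that its integral is a power of a one-dimensional
  integral. Positive \<open>d\<close> serves for domination, negative \<open>d\<close> for lower
  bounds on the partition function.\<close>

definition dom_density :: "'v set \<Rightarrow> real \<Rightarrow> real \<Rightarrow> ('v \<Rightarrow> real) \<Rightarrow> ennreal" where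
  "dom_density \<Lambda> d p \<omega> = (\<Prod>x\<in>\<Lambda>. ennreal (exp (d * \<bar>\<omega> x\<bar> powr p - V (\<omega> x))))"

lemma dom_density_measurable [measurable]: "dom_density \<Lambda> d p \<in> borel_measurable (leb \<Lambda>)"
  unfolding dom_density_def[abs_def]
proof (rule borel_measurable_prod_ennreal)
  fix x assume "x \<in> \<Lambda>"
  then have [measurable]: "(\<lambda>\<omega>. \<omega> x) \<in> borel_measurable (leb \<Lambda>)"
    using measurable_component_singleton[of x \<Lambda> "\<lambda>_. lborel :: real measure"] by simp
  show "(\<lambda>\<omega>. ennreal (exp (d * \<bar>\<omega> x\<bar> powr p - V (\<omega> x)))) \<in> borel_measurable (leb \<Lambda>)"
    by measurable
qed

lemma dom_density_exp:
  assumes "finite \<Lambda>"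
  shows "ennreal (exp c) * dom_density \<Lambda> d p \<omega> = ennreal (exp (c + (\<Sum>x\<in>\<Lambda>. d * \<bar>\<omega> x\<bar> powr p - V (\<omega> x))))"
  unfolding dom_density_def using assms
  by (simp add: prod_ennreal exp_sum exp_add ennreal_mult prod_nonneg)

lemma nn_integral_dom_density:
  assumes "finite \<Lambda>"
  shows "(\<integral>\<^sup>+\<omega>. ennreal c * dom_density \<Lambda> d p \<omega> \<partial>leb \<Lambda>)
    = ennreal c * (\<integral>\<^sup>+u. ennreal (exp (d * \<bar>u\<bar> powr p - V u)) \<partial>lborel) ^ card \<Lambda>"
proof -
  have "(\<integral>\<^sup>+\<omega>. dom_density \<Lambda> d p \<omega> \<partial>leb \<Lambda>) = (\<integral>\<^sup>+u. ennreal (exp (d * \<bar>u\<bar> powr p - V u)) \<partial>lborel) ^ card \<Lambda>"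
    unfolding dom_density_def by (subst lb.product_nn_integral_prod[OF assms]) auto
  then show ?thesis by (simp add: nn_integral_cmult)
qed

lemma dom_density_finite:
  assumes "finite \<Lambda>" "0 < p" "p < q"
  shows "(\<integral>\<^sup>+\<omega>. ennreal c * dom_density \<Lambda> d p \<omega> \<partial>leb \<Lambda>) < \<infinity>"
  unfolding nn_integral_dom_density[OF assms(1)]
  using nn_integral_single_site_finite[OF assms(2,3), of d]
  by (simp add: ennreal_mult_less_top power_less_top_ennreal)

text \<open>Both constants depend on the boundary values only through \<open>R\<close>; the
  equicontinuity of the kernels rests on this uniformity.\<close>

lemma boltz_bounds:
  assumes "finite \<Lambda>"
  shows boltz_upper: "\<exists>c d. 0 \<le> d \<and> (\<forall>\<omega> \<xi>. (\<forall>y\<in>bdry \<Lambda>. \<bar>\<xi> y\<bar> \<le> R) \<longrightarrow>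
      boltz \<Lambda> \<omega> \<xi> \<le> ennreal (exp c) * dom_density \<Lambda> d r \<omega>)"
    and boltz_lower: "\<exists>c d. 0 \<le> d \<and> (\<forall>\<omega> \<xi>. (\<forall>y\<in>bdry \<Lambda>. \<bar>\<xi> y\<bar> \<le> R) \<longrightarrow>
      ennreal (exp (- c)) * dom_density \<Lambda> (- d) r \<omega> \<le> boltz \<Lambda> \<omega> \<xi>)"
proof -
  obtain c d where cd: "0 \<le> c" "0 \<le> d" and
    H: "\<And>\<eta>. (\<And>y. y \<in> bdry \<Lambda> \<Longrightarrow> \<bar>\<eta> y\<bar> \<le> R) \<Longrightarrow>
      \<bar>Ham E W V \<Lambda> \<eta> - (\<Sum>x\<in>\<Lambda>. V (\<eta> x))\<bar> \<le> c + d * (\<Sum>x\<in>\<Lambda>. \<bar>\<eta> x\<bar> powr r)"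
    using Ham_bound[OF assms, of R] by blast
  have H': "\<bar>Ham E W V \<Lambda> (merge_cfg \<Lambda> \<omega> \<xi>) - (\<Sum>x\<in>\<Lambda>. V (\<omega> x))\<bar> \<le> c + d * (\<Sum>x\<in>\<Lambda>. \<bar>\<omega> x\<bar> powr r)"
    if "\<forall>y\<in>bdry \<Lambda>. \<bar>\<xi> y\<bar> \<le> R" for \<omega> \<xi>
    using H[of "merge_cfg \<Lambda> \<omega> \<xi>"] that by (simp add: merge_cfg_def bdry_def)
  have "boltz \<Lambda> \<omega> \<xi> \<le> ennreal (exp c) * dom_density \<Lambda> d r \<omega>"
    "ennreal (exp (- c)) * dom_density \<Lambda> (- d) r \<omega> \<le> boltz \<Lambda> \<omega> \<xi>"
    if "\<forall>y\<in>bdry \<Lambda>. \<bar>\<xi> y\<bar> \<le> R" for \<omega> \<xi>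
    unfolding dom_density_exp[OF assms] boltz_def using H'[OF that, of \<omega>]
    by (auto intro!: ennreal_leI simp: sum_subtractf sum_negf sum_distrib_left abs_le_iff)
  then show "\<exists>c d. 0 \<le> d \<and> (\<forall>\<omega> \<xi>. (\<forall>y\<in>bdry \<Lambda>. \<bar>\<xi> y\<bar> \<le> R) \<longrightarrow>
      boltz \<Lambda> \<omega> \<xi> \<le> ennreal (exp c) * dom_density \<Lambda> d r \<omega>)"
    "\<exists>c d. 0 \<le> d \<and> (\<forall>\<omega> \<xi>. (\<forall>y\<in>bdry \<Lambda>. \<bar>\<xi> y\<bar> \<le> R) \<longrightarrow>
      ennreal (exp (- c)) * dom_density \<Lambda> (- d) r \<omega> \<le> boltz \<Lambda> \<omega> \<xi>)"
    using cd(2) by blast+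
qed

lemma ZE_lower:
  assumes "finite \<Lambda>"
  obtains z :: real where "0 < z" "\<And>\<xi>. (\<And>y. y \<in> bdry \<Lambda> \<Longrightarrow> \<bar>\<xi> y\<bar> \<le> R) \<Longrightarrow> ennreal z \<le> ZE \<Lambda> \<xi>"
proof -
  obtain c d where d: "0 \<le> d" and
    B: "\<forall>\<omega> \<xi>. (\<forall>y\<in>bdry \<Lambda>. \<bar>\<xi> y\<bar> \<le> R) \<longrightarrow> ennreal (exp (- c)) * dom_density \<Lambda> (- d) r \<omega> \<le> boltz \<Lambda> \<omega> \<xi>"
    using boltz_lower[OF assms, of R] by blast
  obtain b where b: "0 < b"
    "ennreal (b * exp (- d)) \<le> (\<integral>\<^sup>+u. ennreal (exp (- d * \<bar>u\<bar> powr r - V u)) \<partial>lborel)"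
    using single_site_lower_bound d by metis
  define z where "z = exp (- c) * (b * exp (- d)) ^ card \<Lambda>"
  have "ennreal z \<le> ZE \<Lambda> \<xi>" if R: "\<And>y. y \<in> bdry \<Lambda> \<Longrightarrow> \<bar>\<xi> y\<bar> \<le> R" for \<xi>
  proof -
    have "ennreal z = ennreal (exp (- c)) * ennreal (b * exp (- d)) ^ card \<Lambda>"
      unfolding z_def ennreal_power[OF less_imp_le[OF mult_pos_pos[OF b(1) exp_gt_zero]]]
      using b by (intro ennreal_mult) auto
    also have "\<dots> \<le> ennreal (exp (- c)) * (\<integral>\<^sup>+u. ennreal (exp (- d * \<bar>u\<bar> powr r - V u)) \<partial>lborel) ^ card \<Lambda>"
      by (intro mult_left_mono power_mono b) auto
    also have "\<dots> \<le> ZE \<Lambda> \<xi>"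
      unfolding ZE_def nn_integral_dom_density[OF assms, symmetric] using B R
          by (intro nn_integral_mono) blast
    finally show ?thesis .
  qed
  moreover have "0 < z" unfolding z_def using b by auto
  ultimately show thesis using that by blast
qed

lemma boundary_bounded:
  fixes \<xi> :: "'v \<Rightarrow> real"
  assumes "finite \<Lambda>" obtains R where "\<And>y. y \<in> bdry \<Lambda> \<Longrightarrow> \<bar>\<xi> y\<bar> \<le> R"
  using member_le_sum[of _ "bdry \<Lambda>" "\<lambda>z. \<bar>\<xi> z\<bar>"] finite_bdry[OF assms] by fastforce

lemma ZE_pos: assumes "finite \<Lambda>" shows "0 < ZE \<Lambda> \<xi>"
proof -
  obtain R where R: "\<And>y. y \<in> bdry \<Lambda> \<Longrightarrow> \<bar>\<xi> y\<bar> \<le> R" using boundary_bounded[OF assms, of \<xi>] by blast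
  obtain z :: real where "0 < z" "\<And>\<xi>. (\<And>y. y \<in> bdry \<Lambda> \<Longrightarrow> \<bar>\<xi> y\<bar> \<le> R) \<Longrightarrow> ennreal z \<le> ZE \<Lambda> \<xi>"
    using ZE_lower[OF assms, of R] by blast
  then show ?thesis using R by (meson ennreal_less_zero_iff less_le_trans)
qed

lemma ZE_finite: assumes "finite \<Lambda>" shows "ZE \<Lambda> \<xi> < \<infinity>"
proof -
  obtain R where R: "\<And>y. y \<in> bdry \<Lambda> \<Longrightarrow> \<bar>\<xi> y\<bar> \<le> R" using boundary_bounded[OF assms, of \<xi>] by blast
  obtain c d where "0 \<le> d" and
    B: "\<forall>\<omega> \<xi>. (\<forall>y\<in>bdry \<Lambda>. \<bar>\<xi> y\<bar> \<le> R) \<longrightarrow> boltz \<Lambda> \<omega> \<xi> \<le> ennreal (exp c) * dom_density \<Lambda> d r \<omega>"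
    using boltz_upper[OF assms, of R] by blast
  have "ZE \<Lambda> \<xi> \<le> (\<integral>\<^sup>+\<omega>. ennreal (exp c) * dom_density \<Lambda> d r \<omega> \<partial>leb \<Lambda>)"
    unfolding ZE_def using B R by (intro nn_integral_mono) blast
  also have "\<dots> < \<infinity>" by (rule dom_density_finite[OF assms r_pos r_less_q])
  finally show ?thesis .
qed

lemma nn_integral_ker:
  assumes "finite \<Lambda>" and [measurable]: "f \<in> borel_measurable borel"
  shows "(\<integral>\<^sup>+\<eta>. f \<eta> \<partial>ker \<Lambda> \<xi>) = (\<integral>\<^sup>+\<omega>. f (merge_cfg \<Lambda> \<omega> \<xi>) * boltz \<Lambda> \<omega> \<xi> \<partial>leb \<Lambda>) / ZE \<Lambda> \<xi>"
proof -
  have "(\<integral>\<^sup>+\<eta>. f \<eta> \<partial>ker \<Lambda> \<xi>) = (\<integral>\<^sup>+\<omega>. f (merge_cfg \<Lambda> \<omega> \<xi>) \<partial>density (leb \<Lambda>) (\<lambda>\<omega>. boltz \<Lambda> \<omega> \<xi> / ZE \<Lambda> \<xi>))"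
    unfolding ker_def by (rule nn_integral_distr) measurable
  also have "\<dots> = (\<integral>\<^sup>+\<omega>. boltz \<Lambda> \<omega> \<xi> / ZE \<Lambda> \<xi> * f (merge_cfg \<Lambda> \<omega> \<xi>) \<partial>leb \<Lambda>)"
    by (rule nn_integral_density) measurable
  also have "\<dots> = (\<integral>\<^sup>+\<omega>. f (merge_cfg \<Lambda> \<omega> \<xi>) * boltz \<Lambda> \<omega> \<xi> / ZE \<Lambda> \<xi> \<partial>leb \<Lambda>)"
    by (simp add: ennreal_times_divide mult.commute)
  also have "\<dots> = (\<integral>\<^sup>+\<omega>. f (merge_cfg \<Lambda> \<omega> \<xi>) * boltz \<Lambda> \<omega> \<xi> \<partial>leb \<Lambda>) / ZE \<Lambda> \<xi>"
    by (rule nn_integral_divide) measurable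
  finally show ?thesis .
qed

lemma sets_ker [simp, measurable_cong]: "sets (ker \<Lambda> \<xi>) = sets borel"
  by (simp add: ker_def)

lemma space_ker [simp]: "space (ker \<Lambda> \<xi>) = UNIV"
  by (simp add: ker_def)

lemma prob_space_ker:
  assumes "finite \<Lambda>" shows "prob_space (ker \<Lambda> \<xi>)"
proof
  have "emeasure (ker \<Lambda> \<xi>) (space (ker \<Lambda> \<xi>)) = (\<integral>\<^sup>+\<eta>. 1 \<partial>ker \<Lambda> \<xi>)" by simp
  also have "\<dots> = ZE \<Lambda> \<xi> / ZE \<Lambda> \<xi>"
    by (subst nn_integral_ker[OF assms]) (simp_all add: ZE_def)
  also have "\<dots> = 1"
    using ZE_pos[OF assms, of \<xi>] ZE_finite[OF assms, of \<xi>] by (intro ennreal_divide_self) auto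
  finally show "emeasure (ker \<Lambda> \<xi>) (space (ker \<Lambda> \<xi>)) = 1" .
qed

lemma ker_measurable [measurable]:
  assumes "finite \<Lambda>" shows "ker \<Lambda> \<in> borel \<rightarrow>\<^sub>M subprob_algebra borel"
proof (rule measurable_subprob_algebra)
  interpret finite_product_sigma_finite "\<lambda>_. lborel :: real measure" \<Lambda> by standard fact
  show "subprob_space (ker \<Lambda> \<xi>)" for \<xi>
    by (rule prob_space_imp_subprob_space[OF prob_space_ker[OF assms]])
  fix A :: "('v \<Rightarrow> real) set" assume [measurable]: "A \<in> sets borel"
  note [measurable] = ZE_measurable[OF assms]
  have "(\<lambda>x. indicator A (case x of (\<omega>, \<xi>) \<Rightarrow> merge_cfg \<Lambda> \<omega> \<xi>) * (case x of (\<omega>, \<xi>) \<Rightarrow> boltz \<Lambda> \<omega> \<xi>))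
      \<in> borel_measurable (leb \<Lambda> \<Otimes>\<^sub>M borel)"
    by measurable
  from measurable_compose[OF measurable_pair_swap' this]
  have "(\<lambda>(\<xi>, \<omega>). indicator A (merge_cfg \<Lambda> \<omega> \<xi>) * boltz \<Lambda> \<omega> \<xi>)
      \<in> borel_measurable (borel \<Otimes>\<^sub>M leb \<Lambda>)"
    by (simp add: case_prod_beta)
  then have [measurable]: "(\<lambda>\<xi>. \<integral>\<^sup>+\<omega>. indicator A (merge_cfg \<Lambda> \<omega> \<xi>) * boltz \<Lambda> \<omega> \<xi> \<partial>leb \<Lambda>)
      \<in> borel_measurable borel"
    by (rule borel_measurable_nn_integral)
  have "emeasure (ker \<Lambda> \<xi>) A = (\<integral>\<^sup>+\<omega>. indicator A (merge_cfg \<Lambda> \<omega> \<xi>) * boltz \<Lambda> \<omega> \<xi> \<partial>leb \<Lambda>) / ZE \<Lambda> \<xi>" for \<xi>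
    using nn_integral_ker[OF assms, of "indicator A" \<xi>] by simp
  then show "(\<lambda>\<xi>. emeasure (ker \<Lambda> \<xi>) A) \<in> borel_measurable borel"
    by simp
qed simp

lemma kernel_eq_measure_ker:
  assumes fin: "finite \<Lambda>" and A[measurable]: "A \<in> sets borel"
  shows "kernel E W V \<Lambda> A \<xi> = measure (ker \<Lambda> \<xi>) A"
proof -
  have Z: "Zpart E W V \<Lambda> \<xi> = enn2real (ZE \<Lambda> \<xi>)"
    unfolding Zpart_def ZE_def boltz_def by (rule integral_eq_nn_integral) auto
  have I: "(\<integral>\<omega>. indicator A (merge_cfg \<Lambda> \<omega> \<xi>) * exp (- Ham E W V \<Lambda> (merge_cfg \<Lambda> \<omega> \<xi>)) \<partial>(leb \<Lambda>))
     = enn2real (\<integral>\<^sup>+\<omega>. indicator A (merge_cfg \<Lambda> \<omega> \<xi>) * boltz \<Lambda> \<omega> \<xi> \<partial>leb \<Lambda>)"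
    unfolding boltz_def
    by (subst integral_eq_nn_integral) (auto simp: ennreal_mult ennreal_indicator)
  have "emeasure (ker \<Lambda> \<xi>) A = (\<integral>\<^sup>+\<omega>. indicator A (merge_cfg \<Lambda> \<omega> \<xi>) * boltz \<Lambda> \<omega> \<xi> \<partial>leb \<Lambda>) / ZE \<Lambda> \<xi>"
    using nn_integral_ker[OF fin, of "indicator A" \<xi>] by simp
  moreover have "(\<integral>\<^sup>+\<omega>. indicator A (merge_cfg \<Lambda> \<omega> \<xi>) * boltz \<Lambda> \<omega> \<xi> \<partial>leb \<Lambda>) \<le> ZE \<Lambda> \<xi>"
    unfolding ZE_def by (intro nn_integral_mono) (auto split: split_indicator)
  then have "(\<integral>\<^sup>+\<omega>. indicator A (merge_cfg \<Lambda> \<omega> \<xi>) * boltz \<Lambda> \<omega> \<xi> \<partial>leb \<Lambda>) < \<infinity>"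
    using ZE_finite[OF fin, of \<xi>] by (rule le_less_trans)
  then obtain n where n: "0 \<le> n" "(\<integral>\<^sup>+\<omega>. indicator A (merge_cfg \<Lambda> \<omega> \<xi>) * boltz \<Lambda> \<omega> \<xi> \<partial>leb \<Lambda>) = ennreal n"
    by (auto simp: less_top_ennreal)
  obtain z where z: "0 < z" "ZE \<Lambda> \<xi> = ennreal z"
    using ZE_pos[OF fin, of \<xi>] ZE_finite[OF fin, of \<xi>] by (auto simp: less_top_ennreal)
  ultimately show ?thesis
    unfolding kernel_def Z I measure_def n z using n(1) z(1) by (simp add: divide_ennreal)
qed

lemma ker_cong:
  assumes "\<And>x. x \<notin> \<Lambda> \<Longrightarrow> \<xi> x = \<eta> x" shows "ker \<Lambda> \<xi> = ker \<Lambda> \<eta>"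
proof -
  have "merge_cfg \<Lambda> \<omega> \<xi> = merge_cfg \<Lambda> \<omega> \<eta>" for \<omega>
    using assms by (auto simp: merge_cfg_def)
  then show ?thesis unfolding ker_def ZE_def boltz_def by simp
qed

section \<open>The Gibbs property as invariance under the kernels\<close>

lemma dlr_measure_iff:
  assumes mu: "sets \<mu> = sets borel" "prob_space \<mu>" and fin: "finite \<Lambda>" and A: "A \<in> sets borel"
  shows "emeasure \<mu> A = (\<integral>\<^sup>+\<xi>. emeasure (ker \<Lambda> \<xi>) A \<partial>\<mu>) \<longleftrightarrow> measure \<mu> A = (\<integral>\<xi>. measure (ker \<Lambda> \<xi>) A \<partial>\<mu>)"
proof -
  interpret prob_space \<mu> by fact
  have m: "(\<lambda>\<xi>. measure (ker \<Lambda> \<xi>) A) \<in> borel_measurable \<mu>"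
  proof -
    have "(\<lambda>\<xi>. emeasure (ker \<Lambda> \<xi>) A) \<in> borel_measurable borel"
      by (rule measurable_compose[OF ker_measurable[OF fin] measurable_emeasure_subprob_algebra[OF A]])
    then have "(\<lambda>\<xi>. measure (ker \<Lambda> \<xi>) A) \<in> borel_measurable borel"
      unfolding measure_def by measurable
    then show ?thesis using mu(1) by (metis measurable_cong_sets)
  qed
  have em: "emeasure (ker \<Lambda> \<xi>) A = ennreal (measure (ker \<Lambda> \<xi>) A)" for \<xi>
    using prob_space_ker[OF fin] by (simp add: finite_measure.emeasure_eq_measure prob_space.finite_measure)
  have "integrable \<mu> (\<lambda>\<xi>. measure (ker \<Lambda> \<xi>) A)"
    by (rule integrable_const_bound[of _ 1]) (use m prob_space.prob_le_1[OF prob_space_ker[OF fin]] in auto)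
  then have "(\<integral>\<^sup>+\<xi>. emeasure (ker \<Lambda> \<xi>) A \<partial>\<mu>) = ennreal (\<integral>\<xi>. measure (ker \<Lambda> \<xi>) A \<partial>\<mu>)"
    unfolding em by (intro nn_integral_eq_integral) auto
  moreover have "0 \<le> (\<integral>\<xi>. measure (ker \<Lambda> \<xi>) A \<partial>\<mu>)" by (intro Bochner_Integration.integral_nonneg) auto
  ultimately show ?thesis by (simp add: emeasure_eq_measure)
qed

lemma Gibbs_iff:
  "\<mu> \<in> Gibbs E W V \<longleftrightarrow> sets \<mu> = sets borel \<and> prob_space \<mu> \<and>
     (\<forall>\<Lambda> A. finite \<Lambda> \<and> \<Lambda> \<noteq> {} \<and> A \<in> sets borel \<longrightarrow> emeasure \<mu> A = (\<integral>\<^sup>+\<xi>. emeasure (ker \<Lambda> \<xi>) A \<partial>\<mu>))"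
proof -
  have "measure \<mu> A = (\<integral>\<xi>. kernel E W V \<Lambda> A \<xi> \<partial>\<mu>) \<longleftrightarrow> emeasure \<mu> A = (\<integral>\<^sup>+\<xi>. emeasure (ker \<Lambda> \<xi>) A \<partial>\<mu>)"
    if "sets \<mu> = sets borel" "prob_space \<mu>" "finite \<Lambda>" "A \<in> sets borel" for \<Lambda> A
    unfolding kernel_eq_measure_ker[OF that(3,4)] dlr_measure_iff[OF that] ..
  then show ?thesis unfolding Gibbs_def by (auto; blast)
qed

text \<open>On events the Gibbs property says that \<open>\<mu>\<close> is a fixed point of the
  monadic bind with \<open>ker \<Lambda>\<close>; in this form it passes to all nonnegative
  measurable functions.\<close>

lemma nn_integral_Gibbs:
  assumes G: "\<mu> \<in> Gibbs E W V" and L: "finite \<Lambda>" "\<Lambda> \<noteq> {}" and f: "f \<in> borel_measurable borel"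
  shows "(\<integral>\<^sup>+\<omega>. f \<omega> \<partial>\<mu>) = (\<integral>\<^sup>+\<xi>. \<integral>\<^sup>+\<omega>. f \<omega> \<partial>ker \<Lambda> \<xi> \<partial>\<mu>)"
proof -
  have mu: "sets \<mu> = sets borel" "prob_space \<mu>"
    "\<And>A. A \<in> sets borel \<Longrightarrow> emeasure \<mu> A = (\<integral>\<^sup>+\<xi>. emeasure (ker \<Lambda> \<xi>) A \<partial>\<mu>)"
    using G L unfolding Gibbs_iff by blast+
  have km: "ker \<Lambda> \<in> \<mu> \<rightarrow>\<^sub>M subprob_algebra borel"
    using ker_measurable[OF L(1)] mu(1) by (metis measurable_cong_sets)
  have ne: "space \<mu> \<noteq> {}" using prob_space.not_empty[OF mu(2)] .
  have "\<mu> = \<mu> \<bind> ker \<Lambda>"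
  proof (rule measure_eqI)
    show "sets \<mu> = sets (\<mu> \<bind> ker \<Lambda>)" using mu(1) ne by (subst sets_bind[of _ _ borel]) auto
    show "emeasure \<mu> A = emeasure (\<mu> \<bind> ker \<Lambda>) A" if "A \<in> sets \<mu>" for A
      using that mu(1,3) by (subst emeasure_bind[OF ne km]) auto
  qed
  then have "(\<integral>\<^sup>+\<omega>. f \<omega> \<partial>\<mu>) = (\<integral>\<^sup>+\<omega>. f \<omega> \<partial>(\<mu> \<bind> ker \<Lambda>))" by simp
  then show ?thesis using nn_integral_bind[OF f km] by simp
qed

text \<open>The difference of the energies in \<open>\<Lambda>\<close> and in \<open>\<Delta> \<subseteq> \<Lambda>\<close> does not involve the spins in
  \<open>\<Delta>\<close>, so integrating these spins first produces exactly the partition function of \<open>\<Delta>\<close>.\<close>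

lemma ker_consistent:
  assumes fin: "finite \<Lambda>" and sub: "\<Delta> \<subseteq> \<Lambda>" and f[measurable]: "f \<in> borel_measurable borel"
  shows "(\<integral>\<^sup>+\<eta>. \<integral>\<^sup>+\<omega>. f \<omega> \<partial>ker \<Delta> \<eta> \<partial>ker \<Lambda> \<xi>) = (\<integral>\<^sup>+\<omega>. f \<omega> \<partial>ker \<Lambda> \<xi>)"
proof -
  define \<Gamma> where "\<Gamma> = \<Lambda> - \<Delta>"
  have L: "\<Lambda> = \<Gamma> \<union> \<Delta>" and disj: "\<Gamma> \<inter> \<Delta> = {}" using sub by (auto simp: \<Gamma>_def)
  have fD: "finite \<Delta>" and fG: "finite \<Gamma>" using fin L by auto
  let ?g = "\<lambda>\<eta>. \<integral>\<^sup>+\<omega>. f \<omega> \<partial>ker \<Delta> \<eta>"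
  have g[measurable]: "?g \<in> borel_measurable borel"
    using measurable_compose[OF ker_measurable[OF fD] nn_integral_measurable_subprob_algebra[OF f]] .
  let ?m = "\<lambda>y. merge_cfg \<Gamma> y \<xi>"
  have mm: "merge_cfg \<Lambda> (merge \<Gamma> \<Delta> (y, x)) \<xi> = merge_cfg \<Delta> x (?m y)" for x y
    using disj by (auto simp: merge_cfg_def merge_def L fun_eq_iff)
  define R where "R y = ennreal (exp (- (Ham E W V \<Lambda> (?m y) - Ham E W V \<Delta> (?m y))))" for y
  have bz: "boltz \<Lambda> (merge \<Gamma> \<Delta> (y, x)) \<xi> = R y * boltz \<Delta> x (?m y)" for x y
  proof -
    have "Ham E W V \<Lambda> (merge_cfg \<Delta> x (?m y)) - Ham E W V \<Delta> (merge_cfg \<Delta> x (?m y))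
        = Ham E W V \<Lambda> (?m y) - Ham E W V \<Delta> (?m y)"
      by (rule Ham_diff_off[OF fin sub]) (simp add: merge_cfg_def)
    then have "Ham E W V \<Lambda> (merge_cfg \<Delta> x (?m y))
        = (Ham E W V \<Lambda> (?m y) - Ham E W V \<Delta> (?m y)) + Ham E W V \<Delta> (merge_cfg \<Delta> x (?m y))"
      by simp
    then have "exp (- Ham E W V \<Lambda> (merge_cfg \<Delta> x (?m y)))
        = exp (- (Ham E W V \<Lambda> (?m y) - Ham E W V \<Delta> (?m y))) * exp (- Ham E W V \<Delta> (merge_cfg \<Delta> x (?m y)))"
      by (simp flip: exp_add)
    then show ?thesis
      unfolding boltz_def mm R_def by (simp only: ennreal_mult[OF exp_ge_zero exp_ge_zero])
  qed
  have inner: "(\<integral>\<^sup>+x. h (merge_cfg \<Lambda> (merge \<Gamma> \<Delta> (y, x)) \<xi>) * boltz \<Lambda> (merge \<Gamma> \<Delta> (y, x)) \<xi> \<partial>leb \<Delta>)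
      = R y * (\<integral>\<^sup>+x. h (merge_cfg \<Delta> x (?m y)) * boltz \<Delta> x (?m y) \<partial>leb \<Delta>)"
    if [measurable]: "h \<in> borel_measurable borel" for h y
  proof -
    have "(\<integral>\<^sup>+x. h (merge_cfg \<Lambda> (merge \<Gamma> \<Delta> (y, x)) \<xi>) * boltz \<Lambda> (merge \<Gamma> \<Delta> (y, x)) \<xi> \<partial>leb \<Delta>)
       = (\<integral>\<^sup>+x. R y * (h (merge_cfg \<Delta> x (?m y)) * boltz \<Delta> x (?m y)) \<partial>leb \<Delta>)"
      unfolding mm bz by (simp add: mult_ac)
    then show ?thesis by (simp add: nn_integral_cmult)
  qed
  have eq: "(\<integral>\<^sup>+x. ?g (merge_cfg \<Delta> x (?m y)) * boltz \<Delta> x (?m y) \<partial>leb \<Delta>)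
     = (\<integral>\<^sup>+x. f (merge_cfg \<Delta> x (?m y)) * boltz \<Delta> x (?m y) \<partial>leb \<Delta>)" for y
  proof -
    have "?g (merge_cfg \<Delta> x (?m y)) = ?g (?m y)" for x
      by (subst ker_cong[of \<Delta> _ "?m y"]) (auto simp: merge_cfg_def)
    then have "(\<integral>\<^sup>+x. ?g (merge_cfg \<Delta> x (?m y)) * boltz \<Delta> x (?m y) \<partial>leb \<Delta>) = ?g (?m y) * ZE \<Delta> (?m y)"
      unfolding ZE_def by (simp add: nn_integral_cmult)
    also have "\<dots> = (\<integral>\<^sup>+x. f (merge_cfg \<Delta> x (?m y)) * boltz \<Delta> x (?m y) \<partial>leb \<Delta>)"
      using ZE_pos[OF fD, of "?m y"] ZE_finite[OF fD, of "?m y"]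
      unfolding nn_integral_ker[OF fD f] by (simp add: ennreal_divide_times ennreal_mult_divide_eq)
    finally show ?thesis .
  qed
  have fold: "(\<integral>\<^sup>+\<omega>. h (merge_cfg \<Lambda> \<omega> \<xi>) * boltz \<Lambda> \<omega> \<xi> \<partial>leb \<Lambda>)
     = (\<integral>\<^sup>+y. R y * (\<integral>\<^sup>+x. h (merge_cfg \<Delta> x (?m y)) * boltz \<Delta> x (?m y) \<partial>leb \<Delta>) \<partial>leb \<Gamma>)"
    if [measurable]: "h \<in> borel_measurable borel" for h
  proof -
    have "(\<lambda>\<omega>. h (merge_cfg \<Lambda> \<omega> \<xi>) * boltz \<Lambda> \<omega> \<xi>) \<in> borel_measurable (leb \<Lambda>)"
      by measurable
    then have "(\<integral>\<^sup>+\<omega>. h (merge_cfg \<Lambda> \<omega> \<xi>) * boltz \<Lambda> \<omega> \<xi> \<partial>leb (\<Gamma> \<union> \<Delta>))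
       = (\<integral>\<^sup>+y. \<integral>\<^sup>+x. h (merge_cfg \<Lambda> (merge \<Gamma> \<Delta> (y, x)) \<xi>) * boltz \<Lambda> (merge \<Gamma> \<Delta> (y, x)) \<xi> \<partial>leb \<Delta> \<partial>leb \<Gamma>)"
      by (intro lb.product_nn_integral_fold[OF disj fG fD]) (simp flip: L)
    then show ?thesis unfolding inner[OF that] L[symmetric] .
  qed
  show ?thesis
    unfolding nn_integral_ker[OF fin g] nn_integral_ker[OF fin f] fold[OF g] fold[OF f] eq ..
qed

subsection \<open>Weights and balls\<close>

abbreviation "wt \<equiv> wgt E o\<^sub>0"
text \<open>The added 1 absorbs the constant terms of the site estimates, also for a graph with a
  single vertex, where \<open>mth\<close> vanishes.\<close>

abbreviation "M\<^sub>\<theta> x \<equiv> 1 + mth E \<theta> x"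

definition ballV :: "nat \<Rightarrow> 'v set" where
  "ballV n = {x. gdist E o\<^sub>0 x \<le> n}"

lemma relpowp_gdist: "(E ^^ gdist E o\<^sub>0 x) o\<^sub>0 x"
  unfolding gdist_def by (rule LeastI_ex) (rule rtranclp_imp_relpowp[OF connected])

lemma gdist_le: "(E ^^ k) o\<^sub>0 x \<Longrightarrow> gdist E o\<^sub>0 x \<le> k"
  unfolding gdist_def by (rule Least_le)

lemma gdist_step:
  assumes "E x y" shows "gdist E o\<^sub>0 y \<le> Suc (gdist E o\<^sub>0 x)"
  by (rule gdist_le) (use relpowp_gdist[of x] assms in auto)

lemma root_in_ballV: "o\<^sub>0 \<in> ballV n"
  using gdist_le[of 0 o\<^sub>0] by (simp add: ballV_def)

lemma ballV_mono: "m \<le> n \<Longrightarrow> ballV m \<subseteq> ballV n"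
  by (auto simp: ballV_def)

lemma in_ballV: "x \<in> ballV (gdist E o\<^sub>0 x)"
  by (simp add: ballV_def)

lemma finite_ballV: "finite (ballV n)"
proof (induction n)
  case 0
  have "ballV 0 \<subseteq> {o\<^sub>0}"
  proof
    fix x assume "x \<in> ballV 0"
    then show "x \<in> {o\<^sub>0}" using relpowp_gdist[of x] by (simp add: ballV_def)
  qed
  then show ?case using finite_subset by blast
next
  case (Suc n)
  have "ballV (Suc n) \<subseteq> ballV n \<union> (\<Union>x\<in>ballV n. {y. E x y})"
  proof
    fix y assume y: "y \<in> ballV (Suc n)"
    show "y \<in> ballV n \<union> (\<Union>x\<in>ballV n. {y. E x y})"
    proof (cases "gdist E o\<^sub>0 y \<le> n")
      case True then show ?thesis by (simp add: ballV_def)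
    next
      case False
      with y have "gdist E o\<^sub>0 y = Suc n" by (simp add: ballV_def)
      then have "(E ^^ Suc n) o\<^sub>0 y" using relpowp_gdist[of y] by simp
      then obtain z where "(E ^^ n) o\<^sub>0 z" "E z y" by auto
      then show ?thesis using gdist_le[of n z] by (auto simp: ballV_def)
    qed
  qed
  then show ?case
    by (rule finite_subset) (use Suc loc_fin in auto)
qed

lemma finite_subset_ballV:
  assumes "finite A" obtains n where "A \<subseteq> ballV n"
proof -
  have "A \<subseteq> ballV (\<Sum>x\<in>A. gdist E o\<^sub>0 x)"
    using assms member_le_sum[of _ A "gdist E o\<^sub>0"] by (auto simp: ballV_def)
  then show thesis using that by blast
qed

lemma bdry_ballV: "bdry (ballV n) \<subseteq> ballV (Suc n) - ballV n"
  using gdist_step by (auto simp: bdry_def ballV_def) (meson Suc_le_mono order_trans)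

section \<open>Weights, degrees and their summability\<close>

lemma wt_pos: "0 < wt \<alpha> x"
  by (simp add: wgt_def)

lemma wt_step:
  assumes "0 \<le> \<alpha>" "E x y" shows "wt \<alpha> x \<le> exp \<alpha> * wt \<alpha> y"
proof -
  have "real (gdist E o\<^sub>0 y) \<le> 1 + real (gdist E o\<^sub>0 x)" using gdist_step[OF assms(2)] by linarith
  then have "\<alpha> * real (gdist E o\<^sub>0 y) \<le> \<alpha> * (1 + real (gdist E o\<^sub>0 x))"
    using assms(1) by (rule mult_left_mono)
  then show ?thesis unfolding wgt_def by (simp add: algebra_simps flip: exp_add)
qed

lemma alpha_low_nonneg: "0 \<le> alpha_low E o\<^sub>0 \<theta>"
  unfolding alpha_low_def by (rule cInf_greatest) (use Theta_some in auto)

lemma deg_ge_1: "E x y \<Longrightarrow> 1 \<le> deg E x"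
proof -
  assume "E x y"
  then have "{y. E x y} \<noteq> {}" by auto
  then have "0 < card {y. E x y}" using loc_fin[of x] by (simp add: card_gt_0_iff)
  then show ?thesis unfolding deg_def by simp
qed

lemma mth_nonneg: "0 \<le> mth E \<theta> x"
  unfolding mth_def by (intro sum_nonneg) auto

text \<open>Neighbours have degree at least 1; dropping it leaves \<open>deg E x\<close> summands
  \<open>deg E x powr \<theta>\<close>. This fixes \<open>1 + \<theta>\<close> as the power of the
  degree that the estimates can afford.\<close>

lemma deg_powr_le_mth: "deg E x powr (1 + \<theta>) \<le> mth E \<theta> x"
proof (cases "\<exists>y. E x y")
  case True
  then have n: "1 \<le> deg E x" using deg_ge_1 by auto
  have "deg E x powr (1 + \<theta>) = deg E x * deg E x powr \<theta>"
    using n by (simp add: powr_add)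
  also have "\<dots> = (\<Sum>y\<in>{y. E x y}. deg E x powr \<theta>)"
    by (simp add: deg_def)
  also have "\<dots> \<le> mth E \<theta> x"
    unfolding mth_def
  proof (rule sum_mono)
    fix y assume "y \<in> {y. E x y}"
    then have "1 \<le> deg E y" using deg_ge_1 sym by blast
    then show "deg E x powr \<theta> \<le> (deg E x * deg E y) powr \<theta>"
      using n theta_pos by (intro powr_mono2) (auto simp: mult_le_cancel_left1)
  qed
  finally show ?thesis .
next
  case False
  then show ?thesis using mth_nonneg by (simp add: deg_def)
qed

lemma sum_deg_powr_le_mth: "(\<Sum>y\<in>{y. E x y}. deg E y powr \<theta>) \<le> mth E \<theta> x"
  unfolding mth_def
proof (rule sum_mono)
  fix y assume "y \<in> {y. E x y}"
  then have "1 \<le> deg E y" "1 \<le> deg E x" using deg_ge_1 sym by blast+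
  then show "deg E y powr \<theta> \<le> (deg E x * deg E y) powr \<theta>"
    using theta_pos by (intro powr_mono2) (auto simp: mult_le_cancel_right1)
qed

text \<open>The hypothesis controls only the sum of \<open>mth\<close> against the weights. If every
  vertex has a neighbour then \<open>mth\<close> is at least 1 and the bare weights are controlled
  too; otherwise connectedness leaves a single vertex.\<close>

lemma weights_summable:
  assumes "alpha_low E o\<^sub>0 \<theta> < \<alpha>" "\<alpha> \<le> \<alpha>up"
  shows "(\<lambda>x. M\<^sub>\<theta> x * wt \<alpha> x) summable_on UNIV"
proof -
  have T: "(\<lambda>x. mth E \<theta> x * wt \<alpha> x) summable_on UNIV"
    using Theta_range[OF assms] by (simp add: Theta_finite_def)
  show ?thesis
  proof (cases "\<forall>x. \<exists>y. E x y")
    case True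
    have "1 \<le> mth E \<theta> x" for x
    proof -
      have "1 \<le> deg E x" using True deg_ge_1 by blast
      then have "1 \<le> deg E x powr (1 + \<theta>)" using theta_pos by (intro ge_one_powr_ge_zero) auto
      then show ?thesis using deg_powr_le_mth[of x] by simp
    qed
    then have le: "norm (M\<^sub>\<theta> x * wt \<alpha> x) \<le> norm (2 * (mth E \<theta> x * wt \<alpha> x))" for x
      using mult_right_mono[of "M\<^sub>\<theta> x" "2 * mth E \<theta> x" "wt \<alpha> x"] wt_pos[of \<alpha> x] mth_nonneg[of x]
      by (simp add: abs_mult)
    have "(\<lambda>x. norm (2 * (mth E \<theta> x * wt \<alpha> x))) summable_on UNIV"
      using summable_on_cmult_right[OF T, of 2] by (rule summable_on_iff_abs_summable_on_real[THEN iffD1])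
    then show ?thesis
      by (rule summable_on_iff_abs_summable_on_real[THEN iffD2, OF Infinite_Sum.abs_summable_on_comparison_test]) (rule le)
  next
    case False
    then obtain x where x: "\<And>y. \<not> E x y" by auto
    have "y = x" for y using connected[of x y] x by (auto elim: converse_rtranclpE)
    then have "(UNIV :: 'v set) = {x}" by auto
    then have "finite (UNIV :: 'v set)" by (metis finite.emptyI finite.insertI)
    then show ?thesis by (rule summable_on_finite)
  qed
qed

lemma weighted_sums_bounded:
  assumes "alpha_low E o\<^sub>0 \<theta> < \<alpha>" "\<alpha> \<le> \<alpha>up"
  obtains D where "0 \<le> D" "\<And>A. finite A \<Longrightarrow> (\<Sum>x\<in>A. M\<^sub>\<theta> x * wt \<alpha> x) \<le> D"
proof -
  have nn: "0 \<le> M\<^sub>\<theta> x * wt \<alpha> x" for x using wt_pos[of \<alpha> x] mth_nonneg[of x] by simp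
  have "(\<Sum>x\<in>A. M\<^sub>\<theta> x * wt \<alpha> x) \<le> (\<Sum>\<^sub>\<infinity>x. M\<^sub>\<theta> x * wt \<alpha> x)" if "finite A" for A
    using finite_sum_le_infsum[OF weights_summable[OF assms] that] nn by auto
  moreover have "0 \<le> (\<Sum>\<^sub>\<infinity>x. M\<^sub>\<theta> x * wt \<alpha> x)" by (rule infsum_nonneg) (rule nn)
  ultimately show thesis using that by blast
qed

subsection \<open>Equicontinuity of the kernels\<close>

lemma ker_equicontinuous:
  fixes A :: "nat \<Rightarrow> ('v \<Rightarrow> real) set"
  assumes fin: "finite \<Lambda>" and A: "\<And>n. A n \<in> cyl \<Lambda>" "decseq A" "(\<Inter>n. A n) = {}"
  obtains b :: "nat \<Rightarrow> real" where "b \<longlonglongrightarrow> 0"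
    "\<And>n \<xi>. (\<And>y. y \<in> bdry \<Lambda> \<Longrightarrow> \<bar>\<xi> y\<bar> \<le> R) \<Longrightarrow> measure (ker \<Lambda> \<xi>) (A n) \<le> b n"
proof -
  have As[measurable]: "A n \<in> sets borel" for n using A(1) by (rule cyl_sets)
  obtain c d where "0 \<le> d" and
    B: "\<forall>\<omega> \<xi>. (\<forall>y\<in>bdry \<Lambda>. \<bar>\<xi> y\<bar> \<le> R) \<longrightarrow> boltz \<Lambda> \<omega> \<xi> \<le> ennreal (exp c) * dom_density \<Lambda> d r \<omega>"
    using boltz_upper[OF fin, of R] by blast
  obtain z :: real where z: "0 < z" and zle: "\<And>\<xi>. (\<And>y. y \<in> bdry \<Lambda> \<Longrightarrow> \<bar>\<xi> y\<bar> \<le> R) \<Longrightarrow> ennreal z \<le> ZE \<Lambda> \<xi>"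
    using ZE_lower[OF fin, of R] by blast
  \<comment> \<open>The events lie in \<open>cyl \<Lambda>\<close>, so any filling outside
    \<open>\<Lambda>\<close> may replace the boundary values; filling with zeros makes the
    dominating integral independent of \<open>\<xi>\<close>.\<close>
  let ?m = "\<lambda>\<omega>. merge_cfg \<Lambda> \<omega> (\<lambda>_. 0 :: real)"
  define D where "D \<omega> = ennreal (exp c) * dom_density \<Lambda> d r \<omega>" for \<omega>
  have [measurable]: "D \<in> borel_measurable (leb \<Lambda>)" unfolding D_def[abs_def] by measurable
  have Dfin: "(\<integral>\<^sup>+\<omega>. D \<omega> \<partial>leb \<Lambda>) < \<infinity>"
    unfolding D_def by (rule dom_density_finite[OF fin r_pos r_less_q])
  define B' where "B' n = (\<integral>\<^sup>+\<omega>. indicator (A n) (?m \<omega>) * D \<omega> \<partial>leb \<Lambda>)" for n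
  have "(\<lambda>n. B' n) \<longlonglongrightarrow> (\<integral>\<^sup>+\<omega>. 0 \<partial>leb \<Lambda>)"
    unfolding B'_def
  proof (rule nn_integral_dominated_convergence[where w=D])
    show "(\<lambda>\<omega>. indicator (A n) (?m \<omega>) * D \<omega>) \<in> borel_measurable (leb \<Lambda>)" for n
      by measurable
    show "(\<integral>\<^sup>+\<omega>. D \<omega> \<partial>leb \<Lambda>) < \<infinity>"
      by (rule Dfin)
    show "AE \<omega> in leb \<Lambda>. indicator (A n) (?m \<omega>) * D \<omega> \<le> D \<omega>" for n
      by (auto split: split_indicator)
    show "AE \<omega> in leb \<Lambda>. (\<lambda>n. indicator (A n) (?m \<omega>) * D \<omega>) \<longlonglongrightarrow> 0"
    proof (rule AE_I2)
      fix \<omega>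
      obtain N where N: "?m \<omega> \<notin> A N" using A(3) by blast
      then have "?m \<omega> \<notin> A n" if "N \<le> n" for n using A(2) that by (auto simp: decseq_def)
      then have "\<forall>\<^sub>F n in sequentially. indicator (A n) (?m \<omega>) * D \<omega> = 0"
        by (auto simp: eventually_sequentially intro!: exI[of _ N])
      then show "(\<lambda>n. indicator (A n) (?m \<omega>) * D \<omega>) \<longlonglongrightarrow> 0"
        by (rule tendsto_eventually)
    qed
  qed measurable
  then have B0: "B' \<longlonglongrightarrow> 0" by simp
  have Bfin: "B' n < \<infinity>" for n
  proof -
    have "B' n \<le> (\<integral>\<^sup>+\<omega>. D \<omega> \<partial>leb \<Lambda>)"
      unfolding B'_def by (intro nn_integral_mono) (auto split: split_indicator)
    also have "\<dots> < \<infinity>" by (rule Dfin)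
    finally show ?thesis .
  qed
  define b where "b n = enn2real (B' n) / z" for n
  have lim: "(\<lambda>n. enn2real (B' n)) \<longlonglongrightarrow> 0"
    by (rule tendsto_enn2real) (use B0 in auto)
  have "b \<longlonglongrightarrow> 0 / z"
    unfolding b_def[abs_def] by (intro tendsto_divide tendsto_const lim) (use z in auto)
  moreover have "measure (ker \<Lambda> \<xi>) (A n) \<le> b n" if R: "\<And>y. y \<in> bdry \<Lambda> \<Longrightarrow> \<bar>\<xi> y\<bar> \<le> R" for n \<xi>
  proof -
    have le: "boltz \<Lambda> \<omega> \<xi> \<le> D \<omega>" for \<omega> unfolding D_def using B R by blast
    have ind: "indicator (A n) (merge_cfg \<Lambda> \<omega> \<xi>) = (indicator (A n) (?m \<omega>) :: ennreal)" for \<omega>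
      using cylD[OF A(1)[of n], of "merge_cfg \<Lambda> \<omega> \<xi>" "?m \<omega>"]
          by (auto simp: merge_cfg_def split: split_indicator)
    have "emeasure (ker \<Lambda> \<xi>) (A n) = (\<integral>\<^sup>+\<eta>. indicator (A n) \<eta> \<partial>ker \<Lambda> \<xi>)" by simp
    also have "\<dots> = (\<integral>\<^sup>+\<omega>. indicator (A n) (?m \<omega>) * boltz \<Lambda> \<omega> \<xi> \<partial>leb \<Lambda>) / ZE \<Lambda> \<xi>"
      by (subst nn_integral_ker[OF fin]) (auto simp: ind)
    also have "\<dots> \<le> B' n / ennreal z"
    proof -
      have "(\<integral>\<^sup>+\<omega>. indicator (A n) (?m \<omega>) * boltz \<Lambda> \<omega> \<xi> \<partial>leb \<Lambda>) \<le> B' n"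
        unfolding B'_def by (intro nn_integral_mono mult_left_mono le) auto
      moreover have "inverse (ZE \<Lambda> \<xi>) \<le> inverse (ennreal z)"
        by (intro ennreal_inverse_antimono zle R)
      ultimately show ?thesis unfolding divide_ennreal_def by (rule mult_mono) auto
    qed
    also have "\<dots> = ennreal (enn2real (B' n)) / ennreal z"
      using Bfin[of n] by simp
    also have "\<dots> = ennreal (b n)"
      unfolding b_def using z by (simp add: divide_ennreal)
    finally have "emeasure (ker \<Lambda> \<xi>) (A n) \<le> ennreal (b n)" .
    moreover have "0 \<le> b n" unfolding b_def using z by auto
    ultimately show ?thesis by (simp add: measure_def enn2real_leI)
  qed
  ultimately show thesis using that[of b] by simp
qed

subsection \<open>A priori moment estimates\<close>

definition site_density :: "'v \<Rightarrow> ('v \<Rightarrow> real) \<Rightarrow> real \<Rightarrow> ennreal" where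
  "site_density x \<xi> u = ennreal (exp (- ((\<Sum>y\<in>{y. E x y}. W u (\<xi> y)) + V u)))"

lemma site_density_measurable [measurable]: "site_density x \<xi> \<in> borel_measurable borel"
proof -
  have [measurable]: "(\<lambda>u. W u c) \<in> borel_measurable borel" for c
  proof -
    have "(\<lambda>u::real. (u, c)) \<in> borel \<rightarrow>\<^sub>M borel" by (intro borel_measurable_Pair) auto
    from measurable_compose[OF this W_measurable] show ?thesis by simp
  qed
  show ?thesis unfolding site_density_def[abs_def] by measurable
qed

lemma nn_integral_ker_singleton:
  assumes g[measurable]: "g \<in> borel_measurable borel"
  shows "(\<integral>\<^sup>+\<eta>. g (\<eta> x) \<partial>ker {x} \<xi>)
     = (\<integral>\<^sup>+u. g u * site_density x \<xi> u \<partial>lborel) / (\<integral>\<^sup>+u. site_density x \<xi> u \<partial>lborel)"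
proof -
  have b: "boltz {x} \<omega> \<xi> = site_density x \<xi> (\<omega> x)" for \<omega>
  proof -
    have "(\<Sum>y\<in>{y. E x y}. W (merge_cfg {x} \<omega> \<xi> x) (merge_cfg {x} \<omega> \<xi> y)) = (\<Sum>y\<in>{y. E x y}. W (\<omega> x) (\<xi> y))"
      using irrefl by (intro sum.cong) (auto simp: merge_cfg_def)
    then show ?thesis
      unfolding boltz_def site_density_def Ham_singleton by (simp add: merge_cfg_def)
  qed
  have [measurable]: "(\<lambda>\<eta>::'v \<Rightarrow> real. g (\<eta> x)) \<in> borel_measurable borel"
    using measurable_compose[OF coord_measurable g] .
  have "(\<integral>\<^sup>+\<eta>. g (\<eta> x) \<partial>ker {x} \<xi>)
      = (\<integral>\<^sup>+\<omega>. g (merge_cfg {x} \<omega> \<xi> x) * boltz {x} \<omega> \<xi> \<partial>leb {x}) / ZE {x} \<xi>"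
    by (rule nn_integral_ker) auto
  also have "(\<integral>\<^sup>+\<omega>. g (merge_cfg {x} \<omega> \<xi> x) * boltz {x} \<omega> \<xi> \<partial>leb {x})
      = (\<integral>\<^sup>+\<omega>. g (\<omega> x) * site_density x \<xi> (\<omega> x) \<partial>leb {x})"
    unfolding b by (simp add: merge_cfg_def)
  also have "\<dots> = (\<integral>\<^sup>+u. g u * site_density x \<xi> u \<partial>lborel)"
    by (rule lb.product_nn_integral_singleton[where f="\<lambda>u. g u * site_density x \<xi> u"]) measurable
  also have "ZE {x} \<xi> = (\<integral>\<^sup>+u. site_density x \<xi> u \<partial>lborel)"
    unfolding ZE_def b by (rule lb.product_nn_integral_singleton[where f="site_density x \<xi>"]) measurable
  finally show ?thesis .
qed

lemma interaction_bound:
  "\<bar>\<Sum>y\<in>{y. E x y}. W u (\<xi> y)\<bar> \<le> deg E x * (I\<^sub>W + J\<^sub>W * \<bar>u\<bar> powr r) / 2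
     + J\<^sub>W * (\<Sum>y\<in>{y. E x y}. \<bar>\<xi> y\<bar> powr r) / 2"
proof -
  have "\<bar>\<Sum>y\<in>{y. E x y}. W u (\<xi> y)\<bar> \<le> (\<Sum>y\<in>{y. E x y}. (I\<^sub>W + J\<^sub>W * (\<bar>u\<bar> powr r + \<bar>\<xi> y\<bar> powr r)) / 2)"
    by (rule order_trans[OF sum_abs]) (intro sum_mono W_bound)
  also have "\<dots> = (\<Sum>y\<in>{y. E x y}. (I\<^sub>W + J\<^sub>W * \<bar>u\<bar> powr r) / 2 + J\<^sub>W / 2 * \<bar>\<xi> y\<bar> powr r)"
    by (intro sum.cong) (auto simp: field_simps)
  also have "\<dots> = deg E x * (I\<^sub>W + J\<^sub>W * \<bar>u\<bar> powr r) / 2 + J\<^sub>W * (\<Sum>y\<in>{y. E x y}. \<bar>\<xi> y\<bar> powr r) / 2"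
    unfolding sum.distrib sum_distrib_left[symmetric] by (simp add: deg_def)
  finally show ?thesis .
qed

lemma deg_powr_mono:
  assumes "0 \<le> s" "s \<le> t" shows "deg E x powr s \<le> 1 + deg E x powr t"
proof (cases "\<exists>y. E x y")
  case True
  then have "1 \<le> deg E x" using deg_ge_1 by auto
  then have "deg E x powr s \<le> deg E x powr t" using assms by (intro powr_mono) auto
  then show ?thesis by simp
next
  case False
  then show ?thesis by (simp add: deg_def)
qed

text \<open>The exponent \<open>q/(q - r)\<close> produced by absorbing the interaction into the self-interaction
  is at most \<open>1 + \<theta>\<close> exactly because \<open>q \<ge> r + r/\<theta>\<close>.\<close>

lemma single_site_exp_moment:
  assumes "0 < p" "p < q" "0 < l"
  obtains C where "0 \<le> C"
    "\<And>x \<xi>. (\<integral>\<^sup>+\<eta>. ennreal (exp (l * \<bar>\<eta> x\<bar> powr p)) \<partial>ker {x} \<xi>)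
       \<le> ennreal (exp (C * M\<^sub>\<theta> x + J\<^sub>W * (\<Sum>y\<in>{y. E x y}. \<bar>\<xi> y\<bar> powr r)))"
proof -
  \<comment> \<open>Three equal shares of the growth of \<open>V\<close>: one absorbs
    \<open>l * |u|^p\<close>, one the spin's own part of the interaction, and one keeps the integral
    finite.\<close>
  define a where "a = a\<^sub>V / 3"
  have a: "0 < a" using aV by (simp add: a_def)
  define s where "s = q / (q - r)"
  have s: "0 \<le> s" "s \<le> 1 + \<theta>"
  proof -
    show "0 \<le> s" using r_less_q r_pos by (simp add: s_def)
    have "r / \<theta> \<le> q - r" using q_gt by simp
    then have "r \<le> (q - r) * \<theta>" using theta_pos by (simp add: pos_divide_le_eq)
    then show "s \<le> 1 + \<theta>" unfolding s_def using r_less_q by (simp add: pos_divide_le_eq algebra_simps)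
  qed
  define C1 where "C1 = l powr (q / (q - p)) * a powr (- (p / (q - p)))"
  define C3 where "C3 = (J\<^sub>W / 2) powr s * a powr (- (r / (q - r)))"
  define G where "G = (\<integral>\<^sup>+u. ennreal (exp (- (a * \<bar>u\<bar> powr q))) \<partial>lborel)"
  define g where "g = enn2real G"
  have G: "G = ennreal g" "0 \<le> g"
    using nn_integral_exp_neg_powr_finite[OF a, of q] r_less_q r_pos by (auto simp: G_def g_def)
  obtain b where b: "0 < b"
    "\<And>d. 0 \<le> d \<Longrightarrow> ennreal (b * exp (- d)) \<le> (\<integral>\<^sup>+u. ennreal (exp (- d * \<bar>u\<bar> powr r - V u)) \<partial>lborel)"
    using single_site_lower_bound by blast
  \<comment> \<open>Collects the coefficients of all terms of the exponent that do not involve the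
    neighbours' spins; \<open>g + 1\<close> in place of \<open>g\<close> keeps the argument of the
    logarithm positive.\<close>
  define C4 where "C4 = I\<^sub>W + J\<^sub>W / 2 + C1 + C3 + c\<^sub>V + \<bar>ln ((g + 1) / b)\<bar>"
  have C13: "0 \<le> C1" "0 \<le> C3" by (auto simp: C1_def C3_def)
  have C4: "0 \<le> C4" unfolding C4_def using C13 IW JW cV by auto
  have main: "(\<integral>\<^sup>+\<eta>. ennreal (exp (l * \<bar>\<eta> x\<bar> powr p)) \<partial>ker {x} \<xi>)
       \<le> ennreal (exp ((2 * C4) * M\<^sub>\<theta> x + J\<^sub>W * (\<Sum>y\<in>{y. E x y}. \<bar>\<xi> y\<bar> powr r)))" for x \<xi>
  proof -
    define n where "n = deg E x"
    have n: "0 \<le> n" by (simp add: n_def deg_def)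
    define Y where "Y = (\<Sum>y\<in>{y. E x y}. \<bar>\<xi> y\<bar> powr r)"
    have Y: "0 \<le> Y" unfolding Y_def by (intro sum_nonneg) auto
    define L where "L = n * I\<^sub>W / 2 + C1 + C3 * n powr s + c\<^sub>V"
    note ib = interaction_bound[where x=x and \<xi>=\<xi>, folded n_def Y_def]
    have up: "l * \<bar>u\<bar> powr p - ((\<Sum>y\<in>{y. E x y}. W u (\<xi> y)) + V u) \<le> J\<^sub>W * Y / 2 + L - a * \<bar>u\<bar> powr q" for u
    proof -
      have 1: "l * \<bar>u\<bar> powr p \<le> a * \<bar>u\<bar> powr q + C1"
        unfolding C1_def using young_powr[of "\<bar>u\<bar>" l a p q] assms a by simp
      have "n * J\<^sub>W / 2 * \<bar>u\<bar> powr r \<le> a * \<bar>u\<bar> powr q + (n * J\<^sub>W / 2) powr s * a powr (- (r / (q - r)))"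
        unfolding s_def using young_powr[of "\<bar>u\<bar>" "n * J\<^sub>W / 2" a r q] a n JW r_pos r_less_q by simp
      also have "(n * J\<^sub>W / 2) powr s = n powr s * (J\<^sub>W / 2) powr s"
        using n JW powr_mult[of n "J\<^sub>W / 2" s] by simp
      finally have 2: "n * J\<^sub>W / 2 * \<bar>u\<bar> powr r \<le> a * \<bar>u\<bar> powr q + C3 * n powr s"
        unfolding C3_def by (simp add: mult_ac)
      have 3: "3 * a * \<bar>u\<bar> powr q - c\<^sub>V \<le> V u" using V_bound[of u] by (simp add: a_def)
      have 4: "n * (I\<^sub>W + J\<^sub>W * \<bar>u\<bar> powr r) / 2 = n * I\<^sub>W / 2 + n * J\<^sub>W / 2 * \<bar>u\<bar> powr r"
        by (simp add: field_simps)
      show ?thesis using 1 2 3 ib[of u] unfolding L_def 4 abs_le_iff by linarith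
    qed
    have num: "(\<integral>\<^sup>+u. ennreal (exp (l * \<bar>u\<bar> powr p)) * site_density x \<xi> u \<partial>lborel)
        \<le> ennreal (exp (J\<^sub>W * Y / 2 + L) * (g + 1))"
    proof -
      have "ennreal (exp (l * \<bar>u\<bar> powr p)) * site_density x \<xi> u
          \<le> ennreal (exp (J\<^sub>W * Y / 2 + L)) * ennreal (exp (- (a * \<bar>u\<bar> powr q)))" for u
        unfolding site_density_def ennreal_mult[OF exp_ge_zero exp_ge_zero, symmetric] exp_add[symmetric]
        by (intro ennreal_leI) (use up[of u] in auto)
      then have "(\<integral>\<^sup>+u. ennreal (exp (l * \<bar>u\<bar> powr p)) * site_density x \<xi> u \<partial>lborel)
          \<le> (\<integral>\<^sup>+u. ennreal (exp (J\<^sub>W * Y / 2 + L)) * ennreal (exp (- (a * \<bar>u\<bar> powr q))) \<partial>lborel)"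
        by (rule nn_integral_mono)
      also have "\<dots> = ennreal (exp (J\<^sub>W * Y / 2 + L)) * ennreal g"
        unfolding G(1)[symmetric] G_def by (rule nn_integral_cmult) measurable
      also have "\<dots> \<le> ennreal (exp (J\<^sub>W * Y / 2 + L)) * ennreal (g + 1)"
        by (intro mult_left_mono ennreal_leI) auto
      also have "\<dots> = ennreal (exp (J\<^sub>W * Y / 2 + L) * (g + 1))"
        using G(2) by (simp add: ennreal_mult)
      finally show ?thesis .
    qed
    \<comment> \<open>The neighbours' sum \<open>Y\<close> costs \<open>J\<^sub>W * Y / 2\<close>
      here and as much in the numerator. The quotient therefore carries the coefficient
      \<open>J\<^sub>W\<close> whatever \<open>l\<close> is; only the additive constant feels
      \<open>l\<close>.\<close>
    have den: "ennreal (exp (- (J\<^sub>W * Y / 2) - n * I\<^sub>W / 2) * (b * exp (- (n * J\<^sub>W / 2))))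
        \<le> (\<integral>\<^sup>+u. site_density x \<xi> u \<partial>lborel)"
    proof -
      have "ennreal (exp (- (J\<^sub>W * Y / 2) - n * I\<^sub>W / 2) * (b * exp (- (n * J\<^sub>W / 2))))
         = ennreal (exp (- (J\<^sub>W * Y / 2) - n * I\<^sub>W / 2)) * ennreal (b * exp (- (n * J\<^sub>W / 2)))"
        using b by (intro ennreal_mult) auto
      also have "\<dots> \<le> ennreal (exp (- (J\<^sub>W * Y / 2) - n * I\<^sub>W / 2)) *
          (\<integral>\<^sup>+u. ennreal (exp (- (n * J\<^sub>W / 2) * \<bar>u\<bar> powr r - V u)) \<partial>lborel)"
        using n JW by (intro mult_left_mono b) auto
      also have "\<dots> = (\<integral>\<^sup>+u. ennreal (exp (- (J\<^sub>W * Y / 2) - n * I\<^sub>W / 2)) *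
          ennreal (exp (- (n * J\<^sub>W / 2) * \<bar>u\<bar> powr r - V u)) \<partial>lborel)"
        by (rule nn_integral_cmult[symmetric]) measurable
      also have "\<dots> \<le> (\<integral>\<^sup>+u. site_density x \<xi> u \<partial>lborel)"
      proof (rule nn_integral_mono)
        fix u
        have 4: "n * (I\<^sub>W + J\<^sub>W * \<bar>u\<bar> powr r) / 2 = n * I\<^sub>W / 2 + n * J\<^sub>W / 2 * \<bar>u\<bar> powr r"
          by (simp add: field_simps)
        have "- (J\<^sub>W * Y / 2) - n * I\<^sub>W / 2 + (- (n * J\<^sub>W / 2) * \<bar>u\<bar> powr r - V u)
            \<le> - ((\<Sum>y\<in>{y. E x y}. W u (\<xi> y)) + V u)"
          using ib[of u] unfolding 4 abs_le_iff by linarith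
        then show "ennreal (exp (- (J\<^sub>W * Y / 2) - n * I\<^sub>W / 2)) *
          ennreal (exp (- (n * J\<^sub>W / 2) * \<bar>u\<bar> powr r - V u)) \<le> site_density x \<xi> u"
          unfolding site_density_def ennreal_mult[OF exp_ge_zero exp_ge_zero, symmetric] exp_add[symmetric]
          by (intro ennreal_leI) simp
      qed
      finally show ?thesis .
    qed
    have "(\<integral>\<^sup>+\<eta>. ennreal (exp (l * \<bar>\<eta> x\<bar> powr p)) \<partial>ker {x} \<xi>)
       = (\<integral>\<^sup>+u. ennreal (exp (l * \<bar>u\<bar> powr p)) * site_density x \<xi> u \<partial>lborel) / (\<integral>\<^sup>+u. site_density x \<xi> u
           \<partial>lborel)"
      by (rule nn_integral_ker_singleton) measurable
    also have "\<dots> \<le> ennreal (exp (J\<^sub>W * Y / 2 + L) * (g + 1)) / ennreal (exp (- (J\<^sub>W * Y / 2) - n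
        * I\<^sub>W / 2) * (b * exp (- (n * J\<^sub>W / 2))))"
      unfolding divide_ennreal_def by (rule mult_mono[OF num ennreal_inverse_antimono[OF den]]) auto
    also have "\<dots> = ennreal (exp (J\<^sub>W * Y / 2 + L) * (g + 1) / (exp (- (J\<^sub>W * Y / 2) - n * I\<^sub>W / 2) * (b
        * exp (- (n * J\<^sub>W / 2)))))"
      using b G(2) by (intro divide_ennreal) auto
    also have "\<dots> \<le> ennreal (exp ((2 * C4) * M\<^sub>\<theta> x + J\<^sub>W * Y))"
    proof (rule ennreal_leI)
      have "exp (J\<^sub>W * Y / 2 + L) * (g + 1) / (exp (- (J\<^sub>W * Y / 2) - n * I\<^sub>W / 2) * (b * exp (- (n
          * J\<^sub>W / 2))))
         = exp (J\<^sub>W * Y / 2 + L) / exp (- (J\<^sub>W * Y / 2) - n * I\<^sub>W / 2) / exp (- (n * J\<^sub>W / 2)) * ((g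
             + 1) / b)"
        by simp
      also have "\<dots> = exp (J\<^sub>W * Y + L + n * I\<^sub>W / 2 + n * J\<^sub>W / 2) * ((g + 1) / b)"
      proof -
        have "J\<^sub>W * Y / 2 + L - (- (J\<^sub>W * Y / 2) - n * I\<^sub>W / 2) - (- (n * J\<^sub>W / 2))
            = J\<^sub>W * Y + L + n * I\<^sub>W / 2 + n * J\<^sub>W / 2" by simp
        then show ?thesis by (simp only: exp_diff[symmetric])
      qed
      also have "\<dots> \<le> exp (J\<^sub>W * Y + L + n * I\<^sub>W / 2 + n * J\<^sub>W / 2) * exp \<bar>ln ((g + 1) / b)\<bar>"
      proof (intro mult_left_mono)
        have "(g + 1) / b = exp (ln ((g + 1) / b))" using b G by (simp add: exp_ln)
        also have "\<dots> \<le> exp \<bar>ln ((g + 1) / b)\<bar>" by simp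
        finally show "(g + 1) / b \<le> exp \<bar>ln ((g + 1) / b)\<bar>" .
      qed auto
      also have "\<dots> = exp (J\<^sub>W * Y + L + n * I\<^sub>W / 2 + n * J\<^sub>W / 2 + \<bar>ln ((g + 1) / b)\<bar>)"
        by (simp only: exp_add)
      also have "\<dots> \<le> exp ((2 * C4) * M\<^sub>\<theta> x + J\<^sub>W * Y)"
      proof -
        have t: "n powr (1 + \<theta>) \<le> mth E \<theta> x" unfolding n_def by (rule deg_powr_le_mth)
        have ns: "n powr s \<le> M\<^sub>\<theta> x" using deg_powr_mono[OF s, of x] t unfolding n_def by linarith
        have n1: "n \<le> M\<^sub>\<theta> x"
          using deg_powr_mono[of 1 "1 + \<theta>" x] t theta_pos n unfolding n_def by simp
        have M1: "1 \<le> M\<^sub>\<theta> x" using mth_nonneg[of x] by simp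
        have "L + n * I\<^sub>W / 2 + n * J\<^sub>W / 2 + \<bar>ln ((g + 1) / b)\<bar>
           = (I\<^sub>W + J\<^sub>W / 2) * n + C3 * n powr s + (C1 + c\<^sub>V + \<bar>ln ((g + 1) / b)\<bar>) * 1"
          unfolding L_def by (simp add: algebra_simps)
        also have "\<dots> \<le> (I\<^sub>W + J\<^sub>W / 2) * M\<^sub>\<theta> x + C3 * M\<^sub>\<theta> x + (C1 + c\<^sub>V + \<bar>ln ((g + 1) / b)\<bar>) * M\<^sub>\<theta> x"
          using IW JW C13 cV n1 ns M1 by (intro add_mono mult_left_mono) auto
        also have "\<dots> = C4 * M\<^sub>\<theta> x" unfolding C4_def by (simp add: algebra_simps)
        also have "\<dots> \<le> 2 * C4 * M\<^sub>\<theta> x" using C4 M1 by simp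
        finally show ?thesis by simp
      qed
      finally show "exp (J\<^sub>W * Y / 2 + L) * (g + 1) / (exp (- (J\<^sub>W * Y / 2) - n * I\<^sub>W / 2) * (b
          * exp (- (n * J\<^sub>W / 2))))
        \<le> exp ((2 * C4) * M\<^sub>\<theta> x + J\<^sub>W * Y)" .
    qed
    finally show ?thesis unfolding Y_def .
  qed
  show thesis by (rule that[of "2 * C4"]) (use C4 main in auto)
qed

text \<open>The neighbours' contribution is weighted by \<open>1/n(y)\<close>; the Young remainder is
  \<open>n(y)\<close> to the power \<open>r/(p - r) \<le> \<theta>\<close>, which is where \<open>p \<ge> r + r/\<theta>\<close> enters.\<close>

lemma single_site_moment:
  assumes p: "r + r / \<theta> \<le> p" "p < q" and l: "0 < l"
  obtains C where "0 \<le> C"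
    "\<And>x \<xi>. (\<integral>\<^sup>+\<eta>. ennreal (l * \<bar>\<eta> x\<bar> powr p) \<partial>ker {x} \<xi>)
       \<le> ennreal (C * M\<^sub>\<theta> x + J\<^sub>W * (\<Sum>y\<in>{y. E x y}. \<bar>\<xi> y\<bar> powr p / deg E y))"
proof -
  have rp: "r < p" using p(1) r_pos theta_pos by (smt (verit) divide_pos_pos)
  have p0: "0 < p" using rp r_pos by simp
  have s: "r / (p - r) \<le> \<theta>"
  proof -
    have "r / \<theta> \<le> p - r" using p(1) by simp
    then have "r \<le> (p - r) * \<theta>" using theta_pos by (simp add: pos_divide_le_eq)
    then show ?thesis using rp by (simp add: pos_divide_le_eq mult.commute)
  qed
  obtain C where C: "0 \<le> C" and exp_bd:
    "\<And>x \<xi>. (\<integral>\<^sup>+\<eta>. ennreal (exp (l * \<bar>\<eta> x\<bar> powr p)) \<partial>ker {x} \<xi>)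
       \<le> ennreal (exp (C * M\<^sub>\<theta> x + J\<^sub>W * (\<Sum>y\<in>{y. E x y}. \<bar>\<xi> y\<bar> powr r)))"
    using single_site_exp_moment[OF p0 p(2) l] by blast
  have "(\<integral>\<^sup>+\<eta>. ennreal (l * \<bar>\<eta> x\<bar> powr p) \<partial>ker {x} \<xi>)
       \<le> ennreal ((C + J\<^sub>W) * M\<^sub>\<theta> x + J\<^sub>W * (\<Sum>y\<in>{y. E x y}. \<bar>\<xi> y\<bar> powr p / deg E y))" for x \<xi>
  proof -
    interpret K: prob_space "ker {x} \<xi>" by (rule prob_space_ker) simp
    define Y where "Y = (\<Sum>y\<in>{y. E x y}. \<bar>\<xi> y\<bar> powr r)"
    have Y: "0 \<le> Y" unfolding Y_def by (intro sum_nonneg) auto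
    define k where "k = C * M\<^sub>\<theta> x + J\<^sub>W * Y"
    have k: "0 \<le> k" unfolding k_def using C Y JW mth_nonneg[of x] by auto
    \<comment> \<open>Jensen's inequality by the tangent to \<open>exp\<close> at \<open>k\<close>:
      if the mean of \<open>exp t\<close> is at most \<open>exp k\<close>, the mean of
      \<open>t\<close> is at most \<open>k\<close>. The 1 stays on the left to be cancelled after
      integration, avoiding subtraction in \<open>ennreal\<close>.\<close>
    have le: "t + 1 \<le> k + exp (- k) * exp t" for t :: real
      using exp_ge_add_one_self[of "t - k"] by (simp add: exp_diff exp_minus field_simps)
    have "ennreal (l * \<bar>\<eta> x\<bar> powr p) + 1
        \<le> ennreal k + ennreal (exp (- k)) * ennreal (exp (l * \<bar>\<eta> x\<bar> powr p))" for \<eta> :: "'v \<Rightarrow> real"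
    proof -
      have "ennreal (l * \<bar>\<eta> x\<bar> powr p) + 1 = ennreal (l * \<bar>\<eta> x\<bar> powr p + 1)"
        using l by (simp add: ennreal_plus)
      also have "\<dots> \<le> ennreal (k + exp (- k) * exp (l * \<bar>\<eta> x\<bar> powr p))"
        by (rule ennreal_leI[OF le])
      also have "\<dots> = ennreal k + ennreal (exp (- k)) * ennreal (exp (l * \<bar>\<eta> x\<bar> powr p))"
        using k by (simp add: ennreal_plus ennreal_mult)
      finally show ?thesis .
    qed
    then have "(\<integral>\<^sup>+\<eta>. ennreal (l * \<bar>\<eta> x\<bar> powr p) + 1 \<partial>ker {x} \<xi>)
        \<le> (\<integral>\<^sup>+\<eta>. ennreal k + ennreal (exp (- k)) * ennreal (exp (l * \<bar>\<eta> x\<bar> powr p)) \<partial>ker {x} \<xi>)"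
      by (rule nn_integral_mono)
    also have "\<dots> = ennreal k + ennreal (exp (- k)) * (\<integral>\<^sup>+\<eta>. ennreal (exp (l * \<bar>\<eta> x\<bar> powr p)) \<partial>ker {x} \<xi>)"
      by (subst nn_integral_add) (auto simp: nn_integral_cmult K.emeasure_space_1[simplified])
    also have "\<dots> \<le> ennreal k + ennreal (exp (- k)) * ennreal (exp k)"
      unfolding k_def Y_def by (intro add_left_mono mult_left_mono exp_bd) auto
    also have "\<dots> = ennreal k + 1"
      by (simp add: exp_minus flip: ennreal_mult)
    also have "(\<integral>\<^sup>+\<eta>. ennreal (l * \<bar>\<eta> x\<bar> powr p) + 1 \<partial>ker {x} \<xi>)
        = (\<integral>\<^sup>+\<eta>. ennreal (l * \<bar>\<eta> x\<bar> powr p) \<partial>ker {x} \<xi>) + 1"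
      by (subst nn_integral_add) (auto simp: K.emeasure_space_1[simplified])
    finally have "(\<integral>\<^sup>+\<eta>. ennreal (l * \<bar>\<eta> x\<bar> powr p) \<partial>ker {x} \<xi>) \<le> ennreal k"
      by (simp add: ennreal_add_left_cancel_le add.commute)
    also have "\<dots> \<le> ennreal ((C + J\<^sub>W) * M\<^sub>\<theta> x + J\<^sub>W * (\<Sum>y\<in>{y. E x y}. \<bar>\<xi> y\<bar> powr p / deg E y))"
    proof (rule ennreal_leI)
      have "Y \<le> (\<Sum>y\<in>{y. E x y}. \<bar>\<xi> y\<bar> powr p / deg E y + deg E y powr \<theta>)"
        unfolding Y_def
      proof (rule sum_mono)
        fix y assume "y \<in> {y. E x y}"
        then have d: "1 \<le> deg E y" using deg_ge_1 sym by blast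
        have "\<bar>\<xi> y\<bar> powr r \<le> 1 / deg E y * \<bar>\<xi> y\<bar> powr p + (1 / deg E y) powr (- (r / (p - r)))"
          using young_powr[of "\<bar>\<xi> y\<bar>" 1 "1 / deg E y" r p] d r_pos rp by simp
        also have "(1 / deg E y) powr (- (r / (p - r))) = deg E y powr (r / (p - r))"
          using d by (simp add: powr_minus powr_divide)
        also have "\<dots> \<le> deg E y powr \<theta>" using d s by (intro powr_mono) auto
        finally show "\<bar>\<xi> y\<bar> powr r \<le> \<bar>\<xi> y\<bar> powr p / deg E y + deg E y powr \<theta>" by simp
      qed
      also have "\<dots> \<le> (\<Sum>y\<in>{y. E x y}. \<bar>\<xi> y\<bar> powr p / deg E y) + M\<^sub>\<theta> x"
        using sum_deg_powr_le_mth[of x] by (simp add: sum.distrib)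
      finally have "J\<^sub>W * Y \<le> J\<^sub>W * ((\<Sum>y\<in>{y. E x y}. \<bar>\<xi> y\<bar> powr p / deg E y) + M\<^sub>\<theta> x)"
        using JW by (intro mult_left_mono) auto
      then show "k \<le> (C + J\<^sub>W) * M\<^sub>\<theta> x + J\<^sub>W * (\<Sum>y\<in>{y. E x y}. \<bar>\<xi> y\<bar> powr p / deg E y)"
        unfolding k_def by (simp add: algebra_simps)
    qed
    finally show ?thesis .
  qed
  moreover have "0 \<le> C + J\<^sub>W" using C JW by simp
  ultimately show thesis using that by blast
qed

abbreviation (input) good :: "real \<Rightarrow> real \<Rightarrow> bool" where
  "good p \<alpha> \<equiv> adm E o\<^sub>0 \<theta> r q \<alpha>up p \<alpha>"

lemma good_p_pos: "good p \<alpha> \<Longrightarrow> r < p \<and> 0 < p \<and> p < q"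
  unfolding adm_def using r_pos theta_pos by (smt (verit) divide_pos_pos)

lemma good_alpha_nonneg: "good p \<alpha> \<Longrightarrow> 0 \<le> \<alpha>"
  using alpha_low_nonneg by (auto simp: adm_def)

section \<open>Moments under finite-volume kernels\<close>

lemma powr_coord_measurable [measurable]:
  "(\<lambda>\<eta>::'v \<Rightarrow> real. \<bar>\<eta> x\<bar> powr p) \<in> borel_measurable borel"
proof -
  have "(\<lambda>u::real. \<bar>u\<bar> powr p) \<in> borel_measurable borel" by measurable
  from measurable_compose[OF coord_measurable this] show ?thesis .
qed

lemma nn_integral_ker_outside:
  assumes "finite \<Lambda>" "x \<notin> \<Lambda>"
  shows "(\<integral>\<^sup>+\<eta>. ennreal (\<bar>\<eta> x\<bar> powr p) \<partial>ker \<Lambda> \<xi>) = ennreal (\<bar>\<xi> x\<bar> powr p)"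
proof -
  interpret K: prob_space "ker \<Lambda> \<xi>" by (rule prob_space_ker) fact
  have "(\<integral>\<^sup>+\<eta>. ennreal (\<bar>\<eta> x\<bar> powr p) \<partial>ker \<Lambda> \<xi>) = (\<integral>\<^sup>+\<eta>. ennreal (\<bar>\<xi> x\<bar> powr p) \<partial>ker \<Lambda> \<xi>)"
    using assms by (subst (1 2) nn_integral_ker) (auto simp: merge_cfg_def)
  then show ?thesis by (simp add: K.emeasure_space_1[simplified])
qed

text \<open>Absorbing a term into the left side of a moment inequality requires that side to be
  finite beforehand. The bound is crude and not uniform in \<open>\<Lambda>\<close> or
  \<open>\<xi>\<close>: the power is majorised by the exponential of a sum of powers, integrable
  since \<open>p < q\<close>.\<close>

lemma nn_integral_ker_inside_finite:
  assumes fin: "finite \<Lambda>" and y: "y \<in> \<Lambda>" and p: "r < p" "p < q"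
  shows "(\<integral>\<^sup>+\<eta>. ennreal (\<bar>\<eta> y\<bar> powr p) \<partial>ker \<Lambda> \<xi>) < \<infinity>"
proof -
  obtain R where R: "\<And>y. y \<in> bdry \<Lambda> \<Longrightarrow> \<bar>\<xi> y\<bar> \<le> R" using boundary_bounded[OF fin, of \<xi>] by blast
  obtain c d where d: "0 \<le> d" and
    B: "\<forall>\<omega> \<xi>. (\<forall>y\<in>bdry \<Lambda>. \<bar>\<xi> y\<bar> \<le> R) \<longrightarrow> boltz \<Lambda> \<omega> \<xi> \<le> ennreal (exp c) * dom_density \<Lambda> d r \<omega>"
    using boltz_upper[OF fin, of R] by blast
  define N where "N = real (card \<Lambda>)"
  have le: "ennreal (\<bar>\<omega> y\<bar> powr p) * boltz \<Lambda> \<omega> \<xi>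
      \<le> ennreal (exp (c + d * N)) * dom_density \<Lambda> (d + 1) p \<omega>" for \<omega>
  proof -
    have b: "boltz \<Lambda> \<omega> \<xi> \<le> ennreal (exp c) * dom_density \<Lambda> d r \<omega>" using B R by blast
    have "\<bar>\<omega> y\<bar> powr p \<le> (\<Sum>x\<in>\<Lambda>. \<bar>\<omega> x\<bar> powr p)"
      using member_le_sum[of y \<Lambda> "\<lambda>x. \<bar>\<omega> x\<bar> powr p"] fin y by simp
    also have "\<dots> \<le> exp (\<Sum>x\<in>\<Lambda>. \<bar>\<omega> x\<bar> powr p)"
      using exp_ge_add_one_self[of "\<Sum>x\<in>\<Lambda>. \<bar>\<omega> x\<bar> powr p"] by linarith
    finally have 1: "\<bar>\<omega> y\<bar> powr p \<le> exp (\<Sum>x\<in>\<Lambda>. \<bar>\<omega> x\<bar> powr p)" .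
    have 2: "(\<Sum>x\<in>\<Lambda>. d * \<bar>\<omega> x\<bar> powr r - V (\<omega> x)) \<le> (\<Sum>x\<in>\<Lambda>. d + (d * \<bar>\<omega> x\<bar> powr p - V (\<omega> x)))"
    proof (rule sum_mono)
      fix x
      have "\<bar>\<omega> x\<bar> powr r \<le> 1 + \<bar>\<omega> x\<bar> powr p"
      proof (cases "\<bar>\<omega> x\<bar> \<le> 1")
        case True then have "\<bar>\<omega> x\<bar> powr r \<le> 1" using r_pos by (intro powr_le1) auto
        then show ?thesis by (simp add: add_increasing2)
      next
        case False then have "\<bar>\<omega> x\<bar> powr r \<le> \<bar>\<omega> x\<bar> powr p" using p by (intro powr_mono) auto
        then show ?thesis by simp
      qed
      from mult_left_mono[OF this d] show "d * \<bar>\<omega> x\<bar> powr r - V (\<omega> x) \<le> d + (d * \<bar>\<omega> x\<bar> powr p - V (\<omega> x))"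
        by (simp add: algebra_simps)
    qed
    have "ennreal (\<bar>\<omega> y\<bar> powr p) * boltz \<Lambda> \<omega> \<xi>
        \<le> ennreal (exp (\<Sum>x\<in>\<Lambda>. \<bar>\<omega> x\<bar> powr p)) * ennreal (exp (c + (\<Sum>x\<in>\<Lambda>. d * \<bar>\<omega> x\<bar> powr r - V (\<omega> x))))"
      using b 1 unfolding dom_density_exp[OF fin] by (intro mult_mono ennreal_leI) auto
    also have "\<dots> = ennreal (exp ((\<Sum>x\<in>\<Lambda>. \<bar>\<omega> x\<bar> powr p) + (c + (\<Sum>x\<in>\<Lambda>. d * \<bar>\<omega> x\<bar> powr r - V (\<omega> x)))))"
      unfolding exp_add[of "\<Sum>x\<in>\<Lambda>. \<bar>\<omega> x\<bar> powr p"] by (rule ennreal_mult[symmetric]) auto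
    also have "\<dots> \<le> ennreal (exp (c + d * N + (\<Sum>x\<in>\<Lambda>. (d + 1) * \<bar>\<omega> x\<bar> powr p - V (\<omega> x))))"
      using 2 by (intro ennreal_leI) (simp add: N_def sum.distrib sum_subtractf algebra_simps)
    also have "\<dots> = ennreal (exp (c + d * N)) * dom_density \<Lambda> (d + 1) p \<omega>"
      unfolding dom_density_exp[OF fin] ..
    finally show ?thesis .
  qed
  have "(\<integral>\<^sup>+\<omega>. ennreal (\<bar>\<omega> y\<bar> powr p) * boltz \<Lambda> \<omega> \<xi> \<partial>leb \<Lambda>)
      \<le> (\<integral>\<^sup>+\<omega>. ennreal (exp (c + d * N)) * dom_density \<Lambda> (d + 1) p \<omega> \<partial>leb \<Lambda>)"
    by (rule nn_integral_mono) (rule le)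
  also have "\<dots> < \<infinity>"
    using p r_pos by (intro dom_density_finite[OF fin]) auto
  finally have "(\<integral>\<^sup>+\<omega>. ennreal (\<bar>\<omega> y\<bar> powr p) * boltz \<Lambda> \<omega> \<xi> \<partial>leb \<Lambda>) / ZE \<Lambda> \<xi> < \<infinity>"
    using ZE_pos[OF fin, of \<xi>] by (auto simp: ennreal_divide_eq_top_iff less_top[symmetric])
  moreover have "(\<integral>\<^sup>+\<eta>. ennreal (\<bar>\<eta> y\<bar> powr p) \<partial>ker \<Lambda> \<xi>)
     = (\<integral>\<^sup>+\<omega>. ennreal (\<bar>\<omega> y\<bar> powr p) * boltz \<Lambda> \<omega> \<xi> \<partial>leb \<Lambda>) / ZE \<Lambda> \<xi>"
    using y by (subst nn_integral_ker[OF fin]) (auto simp: merge_cfg_def)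
  ultimately show ?thesis by simp
qed

text \<open>Double counting: after exchanging the sums, a vertex \<open>y\<close> is met by at most
  \<open>deg E y\<close> neighbours, each of weight at most \<open>exp \<alpha>\<close> times that
  of \<open>y\<close>, so the division by the degree is compensated. The boundary appears because
  neighbours may lie outside \<open>\<Lambda>\<close>.\<close>

lemma edge_sum_le:
  assumes fin: "finite \<Lambda>" and \<alpha>: "0 \<le> \<alpha>" and g: "\<And>y. 0 \<le> g y"
  shows "(\<Sum>x\<in>\<Lambda>. wt \<alpha> x * (\<Sum>y\<in>{y. E x y}. g y / deg E y))
     \<le> exp \<alpha> * ((\<Sum>y\<in>\<Lambda>. g y * wt \<alpha> y) + (\<Sum>y\<in>bdry \<Lambda>. g y * wt \<alpha> y))"
proof -
  let ?U = "\<Lambda> \<union> bdry \<Lambda>"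
  have fU: "finite ?U" using fin finite_bdry by simp
  have deg0: "0 \<le> deg E y" for y by (simp add: deg_def)
  have "(\<Sum>x\<in>\<Lambda>. wt \<alpha> x * (\<Sum>y\<in>{y. E x y}. g y / deg E y))
      = (\<Sum>x\<in>\<Lambda>. \<Sum>y\<in>?U. if E x y then wt \<alpha> x * (g y / deg E y) else 0)"
  proof (rule sum.cong[OF refl])
    fix x assume "x \<in> \<Lambda>"
    then have N: "{y. E x y} = {y \<in> ?U. E x y}" by (auto simp: bdry_def)
    show "wt \<alpha> x * (\<Sum>y\<in>{y. E x y}. g y / deg E y) = (\<Sum>y\<in>?U. if E x y then wt \<alpha> x * (g y / deg E y) else 0)"
      unfolding N sum_distrib_left by (rule sum.inter_filter[OF fU])
  qed
  also have "\<dots> = (\<Sum>y\<in>?U. \<Sum>x\<in>\<Lambda>. if E x y then wt \<alpha> x * (g y / deg E y) else 0)"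
    by (rule sum.swap)
  also have "\<dots> \<le> (\<Sum>y\<in>?U. exp \<alpha> * (g y * wt \<alpha> y))"
  proof (rule sum_mono)
    fix y
    have "(\<Sum>x\<in>\<Lambda>. if E x y then wt \<alpha> x * (g y / deg E y) else 0)
        = (\<Sum>x\<in>{x\<in>\<Lambda>. E x y}. wt \<alpha> x * (g y / deg E y))"
      by (rule sum.inter_filter[OF fin, symmetric])
    also have "\<dots> \<le> (\<Sum>x\<in>{x. E y x}. wt \<alpha> x * (g y / deg E y))"
    proof (rule sum_mono2[OF loc_fin])
      show "{x \<in> \<Lambda>. E x y} \<subseteq> {x. E y x}" using sym by auto
      show "0 \<le> wt \<alpha> x * (g y / deg E y)" for x
        using g[of y] deg0[of y] wt_pos[of \<alpha> x] by simp
    qed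
    also have "\<dots> \<le> (\<Sum>x\<in>{x. E y x}. exp \<alpha> * wt \<alpha> y * (g y / deg E y))"
      using wt_step[OF \<alpha>] sym g[of y] deg0[of y] by (intro sum_mono mult_right_mono) auto
    also have "\<dots> = deg E y * (exp \<alpha> * wt \<alpha> y * (g y / deg E y))"
      by (simp add: deg_def)
    also have "\<dots> \<le> exp \<alpha> * (g y * wt \<alpha> y)"
      using g[of y] wt_pos[of \<alpha> y] by (cases "deg E y = 0") (auto intro!: mult_nonneg_nonneg)
    finally show "(\<Sum>x\<in>\<Lambda>. if E x y then wt \<alpha> x * (g y / deg E y) else 0) \<le> exp \<alpha> * (g y * wt \<alpha> y)" .
  qed
  also have "\<dots> = exp \<alpha> * ((\<Sum>y\<in>\<Lambda>. g y * wt \<alpha> y) + (\<Sum>y\<in>bdry \<Lambda>. g y * wt \<alpha> y))"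
    using fin finite_bdry[OF fin]
        by (subst sum_distrib_left[symmetric], subst sum.union_disjoint) (auto simp: bdry_def)
  finally show ?thesis .
qed

text \<open>Summing the single-site bound over \<open>\<Lambda>\<close> against the weights and choosing the constant
  \<open>l\<close> large makes the neighbour term at most half of the left-hand side, so it can be absorbed.\<close>

lemma ker_moment:
  assumes good: "good p \<alpha>"
  obtains K where "0 \<le> K"
    "\<And>\<Lambda> \<xi>. finite \<Lambda> \<Longrightarrow> (\<integral>\<^sup>+\<eta>. ennreal (\<Sum>x\<in>\<Lambda>. \<bar>\<eta> x\<bar> powr p * wt \<alpha> x) \<partial>ker \<Lambda> \<xi>)
       \<le> ennreal (K + (\<Sum>y\<in>bdry \<Lambda>. \<bar>\<xi> y\<bar> powr p * wt \<alpha> y))"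
proof -
  have p: "r + r / \<theta> \<le> p" "p < q" "r < p" and \<alpha>: "alpha_low E o\<^sub>0 \<theta> < \<alpha>" "\<alpha> \<le> \<alpha>up" "0 \<le> \<alpha>"
    using good good_p_pos[OF good] good_alpha_nonneg[OF good] by (auto simp: adm_def)
  define l where "l = 2 * J\<^sub>W * exp \<alpha>"
  have l: "0 < l" using JW by (simp add: l_def)
  obtain C where C: "0 \<le> C" and site:
    "\<And>x \<xi>. (\<integral>\<^sup>+\<eta>. ennreal (l * \<bar>\<eta> x\<bar> powr p) \<partial>ker {x} \<xi>)
       \<le> ennreal (C * M\<^sub>\<theta> x + J\<^sub>W * (\<Sum>y\<in>{y. E x y}. \<bar>\<xi> y\<bar> powr p / deg E y))"
    using single_site_moment[OF p(1,2) l] by blast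
  obtain D where D: "0 \<le> D" "\<And>A. finite A \<Longrightarrow> (\<Sum>x\<in>A. M\<^sub>\<theta> x * wt \<alpha> x) \<le> D"
    using weighted_sums_bounded[OF \<alpha>(1,2)] by blast
  define K where "K = C * D / (J\<^sub>W * exp \<alpha>)"
  have K: "0 \<le> K" using C D JW by (simp add: K_def)
  have "(\<integral>\<^sup>+\<eta>. ennreal (\<Sum>x\<in>\<Lambda>. \<bar>\<eta> x\<bar> powr p * wt \<alpha> x) \<partial>ker \<Lambda> \<xi>)
       \<le> ennreal (K + (\<Sum>y\<in>bdry \<Lambda>. \<bar>\<xi> y\<bar> powr p * wt \<alpha> y))" if fin: "finite \<Lambda>" for \<Lambda> \<xi>
  proof -
    define G where "G y = (\<integral>\<^sup>+\<eta>. ennreal (\<bar>\<eta> y\<bar> powr p) \<partial>ker \<Lambda> \<xi>)" for y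
    define g where "g y = enn2real (G y)" for y
    have Gfin: "G y < \<infinity>" for y
      unfolding G_def using nn_integral_ker_inside_finite[OF fin _ p(3,2)] nn_integral_ker_outside[OF fin]
      by (cases "y \<in> \<Lambda>") auto
    have Gg: "G y = ennreal (g y)" and g0: "0 \<le> g y" for y
      using Gfin[of y] by (auto simp: g_def)
    have gout: "g y = \<bar>\<xi> y\<bar> powr p" if "y \<notin> \<Lambda>" for y
      unfolding g_def G_def nn_integral_ker_outside[OF fin that] by simp
    have site': "l * g x \<le> C * M\<^sub>\<theta> x + J\<^sub>W * (\<Sum>y\<in>{y. E x y}. g y / deg E y)" if x: "x \<in> \<Lambda>" for x
    proof -
      have deg0: "0 \<le> deg E y" for y by (simp add: deg_def)
      have CM: "0 \<le> C * M\<^sub>\<theta> x" using C mth_nonneg[of x] by simp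
      interpret K: prob_space "ker \<Lambda> \<xi>" by (rule prob_space_ker) fact
      have "ennreal (l * g x) = ennreal l * G x"
        using l g0[of x] unfolding Gg by (simp add: ennreal_mult)
      also have "\<dots> = (\<integral>\<^sup>+\<eta>. ennreal (l * \<bar>\<eta> x\<bar> powr p) \<partial>ker \<Lambda> \<xi>)"
        unfolding G_def using l by (simp add: ennreal_mult nn_integral_cmult)
      \<comment> \<open>Resampling the spin at \<open>x\<close> leaves
        \<open>ker \<Lambda> \<xi>\<close> invariant, so the site estimate can be averaged under
        this measure.\<close>
      also have "\<dots> = (\<integral>\<^sup>+\<zeta>. \<integral>\<^sup>+\<eta>. ennreal (l * \<bar>\<eta> x\<bar> powr p) \<partial>ker {x} \<zeta> \<partial>ker \<Lambda> \<xi>)"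
        using x by (intro ker_consistent[OF fin, symmetric]) auto
      also have "\<dots> \<le> (\<integral>\<^sup>+\<zeta>. ennreal (C * M\<^sub>\<theta> x + J\<^sub>W * (\<Sum>y\<in>{y. E x y}. \<bar>\<zeta> y\<bar> powr p / deg E y)) \<partial>ker \<Lambda> \<xi>)"
        by (rule nn_integral_mono) (rule site)
      also have "\<dots> = (\<integral>\<^sup>+\<zeta>. ennreal (C * M\<^sub>\<theta> x) + (\<Sum>y\<in>{y. E x y}. ennreal (J\<^sub>W / deg E y)
          * ennreal (\<bar>\<zeta> y\<bar> powr p)) \<partial>ker \<Lambda> \<xi>)"
      proof (rule nn_integral_cong)
        fix \<zeta> :: "'v \<Rightarrow> real"
        have "J\<^sub>W * (\<Sum>y\<in>{y. E x y}. \<bar>\<zeta> y\<bar> powr p / deg E y) = (\<Sum>y\<in>{y. E x y}. J\<^sub>W / deg E y * \<bar>\<zeta> y\<bar> powr p)"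
          by (simp add: sum_distrib_left)
        moreover have "0 \<le> J\<^sub>W / deg E y * \<bar>\<zeta> y\<bar> powr p" for y using JW deg0 by simp
        ultimately show "ennreal (C * M\<^sub>\<theta> x + J\<^sub>W * (\<Sum>y\<in>{y. E x y}. \<bar>\<zeta> y\<bar> powr p / deg E y))
            = ennreal (C * M\<^sub>\<theta> x) + (\<Sum>y\<in>{y. E x y}. ennreal (J\<^sub>W / deg E y) * ennreal (\<bar>\<zeta> y\<bar> powr p))"
          using CM JW deg0 by (simp add: ennreal_plus sum_nonneg flip: ennreal_mult sum_ennreal)
      qed
      also have "\<dots> = ennreal (C * M\<^sub>\<theta> x) + (\<Sum>y\<in>{y. E x y}. ennreal (J\<^sub>W / deg E y) * G y)"
        unfolding G_def
        by (subst nn_integral_add, simp, simp)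
          (simp add: nn_integral_sum nn_integral_cmult K.emeasure_space_1[simplified])
      also have "\<dots> = ennreal (C * M\<^sub>\<theta> x + J\<^sub>W * (\<Sum>y\<in>{y. E x y}. g y / deg E y))"
      proof -
        have "0 \<le> J\<^sub>W / deg E y * g y" for y using JW deg0 g0 by simp
        then show ?thesis
          unfolding Gg using CM JW deg0 g0
          by (simp add: ennreal_plus sum_nonneg sum_distrib_left flip: ennreal_mult sum_ennreal)
      qed
      finally have "ennreal (l * g x) \<le> ennreal (C * M\<^sub>\<theta> x + J\<^sub>W * (\<Sum>y\<in>{y. E x y}. g y / deg E y))" .
      moreover have "0 \<le> C * M\<^sub>\<theta> x + J\<^sub>W * (\<Sum>y\<in>{y. E x y}. g y / deg E y)"
        by (rule add_nonneg_nonneg[OF CM], rule mult_nonneg_nonneg) (use JW g0 deg0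
            in \<open>auto intro!: sum_nonneg\<close>)
      ultimately show ?thesis by (simp add: ennreal_le_iff)
    qed
    define S where "S = (\<Sum>x\<in>\<Lambda>. g x * wt \<alpha> x)"
    define T where "T = (\<Sum>y\<in>bdry \<Lambda>. g y * wt \<alpha> y)"
    have "l * S = (\<Sum>x\<in>\<Lambda>. (l * g x) * wt \<alpha> x)"
      unfolding S_def by (simp add: sum_distrib_left mult_ac)
    also have "\<dots> \<le> (\<Sum>x\<in>\<Lambda>. (C * M\<^sub>\<theta> x + J\<^sub>W * (\<Sum>y\<in>{y. E x y}. g y / deg E y)) * wt \<alpha> x)"
      using wt_pos by (intro sum_mono mult_right_mono site' less_imp_le)
    also have "\<dots> = C * (\<Sum>x\<in>\<Lambda>. M\<^sub>\<theta> x * wt \<alpha> x) + J\<^sub>W * (\<Sum>x\<in>\<Lambda>. wt \<alpha> x * (\<Sum>y\<in>{y. E x y}. g y / deg E y))"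
      unfolding sum_distrib_left[of C] sum_distrib_left[of "J\<^sub>W" _ \<Lambda>] sum.distrib[symmetric]
      by (intro sum.cong) (auto simp: algebra_simps)
    also have "\<dots> \<le> C * D + J\<^sub>W * (exp \<alpha> * (S + T))"
      unfolding S_def T_def using C JW
      by (intro add_mono mult_left_mono D(2) fin edge_sum_le \<alpha>(3) g0) auto
    finally have "J\<^sub>W * exp \<alpha> * S \<le> C * D + J\<^sub>W * exp \<alpha> * T"
      unfolding l_def by (simp add: algebra_simps)
    then have "S \<le> (C * D + J\<^sub>W * exp \<alpha> * T) / (J\<^sub>W * exp \<alpha>)"
      using JW by (simp add: pos_le_divide_eq mult.commute)
    also have "\<dots> = K + T" unfolding K_def using JW by (simp add: add_divide_distrib)
    finally have ST: "S \<le> K + T" .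
    have "T = (\<Sum>y\<in>bdry \<Lambda>. \<bar>\<xi> y\<bar> powr p * wt \<alpha> y)"
      unfolding T_def by (intro sum.cong) (auto simp: gout bdry_def)
    moreover have "(\<integral>\<^sup>+\<eta>. ennreal (\<Sum>x\<in>\<Lambda>. \<bar>\<eta> x\<bar> powr p * wt \<alpha> x) \<partial>ker \<Lambda> \<xi>) = ennreal S"
    proof -
      have "(\<integral>\<^sup>+\<eta>. ennreal (\<Sum>x\<in>\<Lambda>. \<bar>\<eta> x\<bar> powr p * wt \<alpha> x) \<partial>ker \<Lambda> \<xi>)
          = (\<integral>\<^sup>+\<eta>. (\<Sum>x\<in>\<Lambda>. ennreal (\<bar>\<eta> x\<bar> powr p) * ennreal (wt \<alpha> x)) \<partial>ker \<Lambda> \<xi>)"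
        using wt_pos by (intro nn_integral_cong) (simp add: less_imp_le flip: ennreal_mult)
      also have "\<dots> = (\<Sum>x\<in>\<Lambda>. G x * ennreal (wt \<alpha> x))"
        unfolding G_def by (simp add: nn_integral_sum nn_integral_multc)
      also have "\<dots> = ennreal S"
        unfolding S_def Gg using g0 wt_pos by (simp add: less_imp_le flip: ennreal_mult)
      finally show ?thesis .
    qed
    ultimately show ?thesis using ST by (simp add: ennreal_leI)
  qed
  then show thesis using that[OF K] by blast
qed

section \<open>Norms through sums over balls\<close>

definition psum :: "real \<Rightarrow> real \<Rightarrow> nat \<Rightarrow> ('v \<Rightarrow> real) \<Rightarrow> real" where
  "psum p \<alpha> n \<omega> = (\<Sum>x\<in>ballV n. \<bar>\<omega> x\<bar> powr p * wt \<alpha> x)"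

lemma psum_term_nonneg: "0 \<le> \<bar>\<omega> x\<bar> powr p * wt \<alpha> x"
  using wt_pos[of \<alpha> x] by simp

lemma psum_nonneg: "0 \<le> psum p \<alpha> n \<omega>"
  unfolding psum_def by (intro sum_nonneg psum_term_nonneg)

lemma finite_sum_le_psum:
  "A \<subseteq> ballV n \<Longrightarrow> (\<Sum>x\<in>A. \<bar>\<omega> x\<bar> powr p * wt \<alpha> x) \<le> psum p \<alpha> n \<omega>"
  unfolding psum_def by (intro sum_mono2 finite_ballV psum_term_nonneg)

lemma psum_mono: "m \<le> n \<Longrightarrow> psum p \<alpha> m \<omega> \<le> psum p \<alpha> n \<omega>"
  unfolding psum_def[of _ _ m] by (rule finite_sum_le_psum[OF ballV_mono])

lemma psum_measurable [measurable]: "psum p \<alpha> n \<in> borel_measurable borel"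
  unfolding psum_def[abs_def] by measurable

text \<open>Every finite set lies in a ball, so finiteness of a norm is boundedness of an increasing
  sequence of cylinder functions.\<close>

lemma in_Lp_iff: "in_Lp E o\<^sub>0 p \<alpha> \<omega> \<longleftrightarrow> (\<exists>C. \<forall>n. psum p \<alpha> n \<omega> \<le> C)"
proof
  assume "in_Lp E o\<^sub>0 p \<alpha> \<omega>"
  then have "psum p \<alpha> n \<omega> \<le> (\<Sum>\<^sub>\<infinity>x. \<bar>\<omega> x\<bar> powr p * wt \<alpha> x)" for n
    unfolding in_Lp_def psum_def by (intro finite_sum_le_infsum finite_ballV psum_term_nonneg) auto
  then show "\<exists>C. \<forall>n. psum p \<alpha> n \<omega> \<le> C" by blast
next
  assume "\<exists>C. \<forall>n. psum p \<alpha> n \<omega> \<le> C"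
  then obtain C where C: "\<And>n. psum p \<alpha> n \<omega> \<le> C" by blast
  have "(\<Sum>x\<in>F. \<bar>\<omega> x\<bar> powr p * wt \<alpha> x) \<le> C" if F: "finite F" for F
  proof -
    obtain n where "F \<subseteq> ballV n" using finite_subset_ballV[OF F] by blast
    then show ?thesis using finite_sum_le_psum C order_trans by blast
  qed
  then show "in_Lp E o\<^sub>0 p \<alpha> \<omega>"
    unfolding in_Lp_def by (intro nonneg_bdd_above_summable_on psum_term_nonneg bdd_aboveI2) auto
qed

lemma infsum_le_psum_bound:
  assumes "\<And>n. psum p \<alpha> n \<omega> \<le> C"
  shows "(\<Sum>\<^sub>\<infinity>x. \<bar>\<omega> x\<bar> powr p * wt \<alpha> x) \<le> C"
proof (rule infsum_le_finite_sums)
  show "(\<lambda>x. \<bar>\<omega> x\<bar> powr p * wt \<alpha> x) summable_on UNIV"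
    unfolding in_Lp_def[symmetric] in_Lp_iff using assms by blast
  fix F :: "'v set" assume F: "finite F"
  obtain n where "F \<subseteq> ballV n" using finite_subset_ballV[OF F] by blast
  then show "(\<Sum>x\<in>F. \<bar>\<omega> x\<bar> powr p * wt \<alpha> x) \<le> C" using finite_sum_le_psum assms order_trans by blast
qed

text \<open>The outer boundary of a ball lies in the next sphere, so the boundary sum is at most an
  increment of a bounded increasing sequence.\<close>

lemma psum_bdry_tendsto_0:
  assumes "in_Lp E o\<^sub>0 p \<alpha> \<omega>"
  shows "(\<lambda>n. \<Sum>y\<in>bdry (ballV n). \<bar>\<omega> y\<bar> powr p * wt \<alpha> y) \<longlonglongrightarrow> 0"
proof -
  obtain C where C: "\<And>n. psum p \<alpha> n \<omega> \<le> C" using assms unfolding in_Lp_iff by blast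
  have "incseq (\<lambda>n. psum p \<alpha> n \<omega>)" by (intro incseq_SucI psum_mono) simp
  then obtain L where L: "(\<lambda>n. psum p \<alpha> n \<omega>) \<longlonglongrightarrow> L" using incseq_convergent[of "\<lambda>n. psum p \<alpha> n \<omega>" C] C
      by blast
  have d: "(\<lambda>n. psum p \<alpha> (Suc n) \<omega> - psum p \<alpha> n \<omega>) \<longlonglongrightarrow> 0"
    using tendsto_diff[OF LIMSEQ_Suc[OF L] L] by simp
  have "(\<Sum>y\<in>bdry (ballV n). \<bar>\<omega> y\<bar> powr p * wt \<alpha> y) \<le> psum p \<alpha> (Suc n) \<omega> - psum p \<alpha> n \<omega>" for n
  proof -
    have "(\<Sum>y\<in>bdry (ballV n). \<bar>\<omega> y\<bar> powr p * wt \<alpha> y) \<le> (\<Sum>y\<in>ballV (Suc n) - ballV n. \<bar>\<omega> y\<bar> powr p * wt \<alpha> y)"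
      by (intro sum_mono2 psum_term_nonneg bdry_ballV) (simp add: finite_ballV)
    also have "\<dots> = psum p \<alpha> (Suc n) \<omega> - psum p \<alpha> n \<omega>"
      unfolding psum_def by (intro sum_diff finite_ballV ballV_mono) simp
    finally show ?thesis .
  qed
  moreover have "0 \<le> (\<Sum>y\<in>bdry (ballV n). \<bar>\<omega> y\<bar> powr p * wt \<alpha> y)" for n
    by (intro sum_nonneg psum_term_nonneg)
  ultimately show ?thesis
    by (intro tendsto_sandwich[OF always_eventually always_eventually tendsto_const d]) simp_all
qed

text \<open>One constant per pair of exponents, fixed by choice, so that moment bounds, tight sets
  and limit measures all refer to the same number, independent of the measure, the volume and the
  boundary values.\<close>

definition Kmom :: "real \<Rightarrow> real \<Rightarrow> real" where
  "Kmom p \<alpha> = (SOME K. 0 \<le> K \<and> (\<forall>\<Lambda> \<xi>. finite \<Lambda> \<longrightarrow>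
     (\<integral>\<^sup>+\<eta>. ennreal (\<Sum>x\<in>\<Lambda>. \<bar>\<eta> x\<bar> powr p * wt \<alpha> x) \<partial>ker \<Lambda> \<xi>)
       \<le> ennreal (K + (\<Sum>y\<in>bdry \<Lambda>. \<bar>\<xi> y\<bar> powr p * wt \<alpha> y))))"

lemma Kmom:
  assumes "good p \<alpha>"
  shows "0 \<le> Kmom p \<alpha>"
    and "finite \<Lambda> \<Longrightarrow> (\<integral>\<^sup>+\<eta>. ennreal (\<Sum>x\<in>\<Lambda>. \<bar>\<eta> x\<bar> powr p * wt \<alpha> x) \<partial>ker \<Lambda> \<xi>)
       \<le> ennreal (Kmom p \<alpha> + (\<Sum>y\<in>bdry \<Lambda>. \<bar>\<xi> y\<bar> powr p * wt \<alpha> y))"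
proof -
  obtain K where "0 \<le> K"
    "\<And>\<Lambda> \<xi>. finite \<Lambda> \<Longrightarrow> (\<integral>\<^sup>+\<eta>. ennreal (\<Sum>x\<in>\<Lambda>. \<bar>\<eta> x\<bar> powr p * wt \<alpha> x) \<partial>ker \<Lambda> \<xi>)
       \<le> ennreal (K + (\<Sum>y\<in>bdry \<Lambda>. \<bar>\<xi> y\<bar> powr p * wt \<alpha> y))"
    using ker_moment[OF assms] by blast
  then have "\<exists>K. 0 \<le> K \<and> (\<forall>\<Lambda> \<xi>. finite \<Lambda> \<longrightarrow>
     (\<integral>\<^sup>+\<eta>. ennreal (\<Sum>x\<in>\<Lambda>. \<bar>\<eta> x\<bar> powr p * wt \<alpha> x) \<partial>ker \<Lambda> \<xi>)
       \<le> ennreal (K + (\<Sum>y\<in>bdry \<Lambda>. \<bar>\<xi> y\<bar> powr p * wt \<alpha> y)))" by blast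
  from someI_ex[OF this, folded Kmom_def]
  show "0 \<le> Kmom p \<alpha>" "finite \<Lambda> \<Longrightarrow> (\<integral>\<^sup>+\<eta>. ennreal (\<Sum>x\<in>\<Lambda>. \<bar>\<eta> x\<bar> powr p * wt \<alpha> x) \<partial>ker \<Lambda> \<xi>)
       \<le> ennreal (Kmom p \<alpha> + (\<Sum>y\<in>bdry \<Lambda>. \<bar>\<xi> y\<bar> powr p * wt \<alpha> y))" by blast+
qed

lemma ker_ball_moment:
  assumes "good p \<alpha>" "m \<le> n"
  shows "(\<integral>\<^sup>+\<eta>. ennreal (psum p \<alpha> m \<eta>) \<partial>ker (ballV n) \<xi>)
    \<le> ennreal (Kmom p \<alpha> + (\<Sum>y\<in>bdry (ballV n). \<bar>\<xi> y\<bar> powr p * wt \<alpha> y))"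
proof -
  have "(\<integral>\<^sup>+\<eta>. ennreal (psum p \<alpha> m \<eta>) \<partial>ker (ballV n) \<xi>) \<le> (\<integral>\<^sup>+\<eta>. ennreal (psum p \<alpha> n \<eta>) \<partial>ker (ballV n) \<xi>)"
    by (intro nn_integral_mono ennreal_leI psum_mono assms)
  also have "\<dots> \<le> ennreal (Kmom p \<alpha> + (\<Sum>y\<in>bdry (ballV n). \<bar>\<xi> y\<bar> powr p * wt \<alpha> y))"
    unfolding psum_def by (rule Kmom(2)[OF assms(1) finite_ballV])
  finally show ?thesis .
qed

text \<open>A tempered Gibbs measure is only known to be supported on finite-norm configurations; its
  moments are bounded by truncating, applying the Gibbs property in balls, and noting that the
  boundary term vanishes pointwise as the balls grow.\<close>

lemma Gibbs_moment:
  assumes good: "good p \<alpha>" and G: "\<mu> \<in> Gibbs E W V" and ae: "AE \<omega> in \<mu>. in_Lp E o\<^sub>0 p \<alpha> \<omega>"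
  shows "(\<integral>\<^sup>+\<omega>. ennreal (psum p \<alpha> m \<omega>) \<partial>\<mu>) \<le> ennreal (Kmom p \<alpha>)"
proof -
  have mu: "sets \<mu> = sets borel" "prob_space \<mu>" using G by (auto simp: Gibbs_iff)
  interpret prob_space \<mu> by fact
  note [measurable_cong] = mu(1)
  let ?t = "\<lambda>n \<xi>. \<Sum>y\<in>bdry (ballV n). \<bar>\<xi> y\<bar> powr p * wt \<alpha> y"
  have trunc: "(\<integral>\<^sup>+\<omega>. min (ennreal N) (ennreal (psum p \<alpha> m \<omega>)) \<partial>\<mu>) \<le> ennreal (Kmom p \<alpha>)" for N
  proof -
    let ?F = "\<lambda>\<omega>. min (ennreal N) (ennreal (psum p \<alpha> m \<omega>))"
    let ?u = "\<lambda>n \<xi>. min (ennreal N) (ennreal (Kmom p \<alpha> + ?t n \<xi>))"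
    have le: "(\<integral>\<^sup>+\<omega>. ?F \<omega> \<partial>\<mu>) \<le> (\<integral>\<^sup>+\<xi>. ?u n \<xi> \<partial>\<mu>)" if "m \<le> n" for n
    proof -
      have "(\<integral>\<^sup>+\<omega>. ?F \<omega> \<partial>\<mu>) = (\<integral>\<^sup>+\<xi>. \<integral>\<^sup>+\<omega>. ?F \<omega> \<partial>ker (ballV n) \<xi> \<partial>\<mu>)"
        by (rule nn_integral_Gibbs[OF G finite_ballV]) (use root_in_ballV in auto)
      also have "\<dots> \<le> (\<integral>\<^sup>+\<xi>. ?u n \<xi> \<partial>\<mu>)"
      proof (rule nn_integral_mono, rule min.boundedI)
        fix \<xi> :: "'v \<Rightarrow> real"
        interpret K: prob_space "ker (ballV n) \<xi>" by (rule prob_space_ker[OF finite_ballV])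
        have "(\<integral>\<^sup>+\<omega>. ?F \<omega> \<partial>ker (ballV n) \<xi>) \<le> (\<integral>\<^sup>+\<omega>. ennreal N \<partial>ker (ballV n) \<xi>)"
          by (rule nn_integral_mono) simp
        then show "(\<integral>\<^sup>+\<omega>. ?F \<omega> \<partial>ker (ballV n) \<xi>) \<le> ennreal N"
          by (simp add: K.emeasure_space_1[simplified])
        have "(\<integral>\<^sup>+\<omega>. ?F \<omega> \<partial>ker (ballV n) \<xi>) \<le> (\<integral>\<^sup>+\<omega>. ennreal (psum p \<alpha> m \<omega>) \<partial>ker (ballV n) \<xi>)"
          by (rule nn_integral_mono) simp
        also have "\<dots> \<le> ennreal (Kmom p \<alpha> + ?t n \<xi>)" by (rule ker_ball_moment[OF good that])
        finally show "(\<integral>\<^sup>+\<omega>. ?F \<omega> \<partial>ker (ballV n) \<xi>) \<le> ennreal (Kmom p \<alpha> + ?t n \<xi>)" .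
      qed
      finally show ?thesis .
    qed
    \<comment> \<open>The truncation level is the integrable majorant here; the boundary sums
      themselves are only known to vanish pointwise.\<close>
    have "(\<lambda>n. \<integral>\<^sup>+\<xi>. ?u n \<xi> \<partial>\<mu>) \<longlonglongrightarrow> (\<integral>\<^sup>+\<xi>. min (ennreal N) (ennreal (Kmom p \<alpha>)) \<partial>\<mu>)"
    proof (rule nn_integral_dominated_convergence[where w="\<lambda>_. ennreal N"])
      show "(\<integral>\<^sup>+\<xi>. ennreal N \<partial>\<mu>) < \<infinity>" by (simp add: emeasure_space_1)
      show "AE \<xi> in \<mu>. (\<lambda>n. ?u n \<xi>) \<longlonglongrightarrow> min (ennreal N) (ennreal (Kmom p \<alpha>))"
        using ae
      proof eventually_elim
        case (elim \<xi>)
        have "(\<lambda>n. Kmom p \<alpha> + ?t n \<xi>) \<longlonglongrightarrow> Kmom p \<alpha> + 0"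
          by (intro tendsto_add tendsto_const psum_bdry_tendsto_0 elim)
        then show ?case by (intro tendsto_min tendsto_const tendsto_ennrealI) simp
      qed
    qed auto
    then have "(\<integral>\<^sup>+\<omega>. ?F \<omega> \<partial>\<mu>) \<le> (\<integral>\<^sup>+\<xi>. min (ennreal N) (ennreal (Kmom p \<alpha>)) \<partial>\<mu>)"
      by (rule tendsto_lowerbound) (use le in \<open>auto simp: eventually_sequentially\<close>)
    also have "\<dots> \<le> (\<integral>\<^sup>+\<xi>. ennreal (Kmom p \<alpha>) \<partial>\<mu>)" by (rule nn_integral_mono) simp
    finally show ?thesis by (simp add: emeasure_space_1)
  qed
  show ?thesis
    by (rule nn_integral_le_of_truncations) (use trunc in auto)
qed

subsection \<open>The space of tempered configurations\<close>

abbreviation "\<Omega>\<^sub>t \<equiv> Omega_t E o\<^sub>0 \<theta> r q \<alpha>up"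
abbreviation "alow \<equiv> alpha_low E o\<^sub>0 \<theta>"

text \<open>Together with \<open>\<alpha>k\<close>, a countable cofinal family of admissible
  exponents: it starts at \<open>r + r / \<theta>\<close> and \<open>\<alpha>up\<close>, the powers
  rise to \<open>q\<close>, and the decay rates fall to \<open>alow\<close>. Measurability of the
  tempered configurations and tightness both need countably many conditions.\<close>

definition pk :: "nat \<Rightarrow> real" where
  "pk k = q - (q - (r + r / \<theta>)) / (real k + 1)"

definition \<alpha>k :: "nat \<Rightarrow> real" where
  "\<alpha>k k = alow + (\<alpha>up - alow) / (real k + 1)"

lemma good_k: "good (pk k) (\<alpha>k k)"
proof -
  have "(q - (r + r / \<theta>)) / (real k + 1) \<le> q - (r + r / \<theta>)" "0 < (q - (r + r / \<theta>)) / (real k + 1)"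
    using q_gt by (auto simp: divide_le_eq mult_le_cancel_left1)
  moreover have "(\<alpha>up - alow) / (real k + 1) \<le> \<alpha>up - alow" "0 < (\<alpha>up - alow) / (real k + 1)"
    using alpha_up by (auto simp: divide_le_eq mult_le_cancel_left1)
  ultimately show ?thesis unfolding adm_def pk_def \<alpha>k_def by linarith
qed

lemma good_dominated:
  assumes "good p \<alpha>" obtains k where "p \<le> pk k" "\<alpha>k k \<le> \<alpha>"
proof -
  have *: "\<forall>\<^sub>F k in sequentially. c / (real k + 1) < d" if "0 < d" for c d :: real
  proof -
    have "(\<lambda>k. c / (real k + 1)) \<longlonglongrightarrow> 0"
      using LIMSEQ_Suc[OF lim_const_over_n[of c]] by (simp add: add.commute)
    then show ?thesis using that by (rule order_tendstoD)
  qed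
  have "0 < q - p" "0 < \<alpha> - alow" using assms by (auto simp: adm_def)
  from eventually_conj[OF *[OF this(1), of "q - (r + r / \<theta>)"] *[OF this(2), of "\<alpha>up - alow"]]
  obtain k where "(q - (r + r / \<theta>)) / (real k + 1) < q - p" "(\<alpha>up - alow) / (real k + 1) < \<alpha> - alow"
    by (auto simp: eventually_sequentially)
  then show thesis using that[of k] unfolding pk_def \<alpha>k_def by simp
qed

lemma wt_antimono: "\<alpha> \<le> \<beta> \<Longrightarrow> wt \<beta> x \<le> wt \<alpha> x"
  unfolding wgt_def by (simp add: mult_right_mono)

text \<open>Because the total weight is finite, a higher power with a heavier weight dominates up to
  an additive constant, uniformly in the configuration and the ball.\<close>

lemma psum_dominated:
  assumes "good p \<alpha>"
  obtains k D where "0 \<le> D" "\<And>n \<omega>. psum p \<alpha> n \<omega> \<le> D + psum (pk k) (\<alpha>k k) n \<omega>"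
proof -
  obtain k where k: "p \<le> pk k" "\<alpha>k k \<le> \<alpha>" using good_dominated[OF assms] .
  have ak: "alow < \<alpha>k k" "\<alpha>k k \<le> \<alpha>up" using good_k[of k] by (auto simp: adm_def)
  obtain D where D: "0 \<le> D" "\<And>A. finite A \<Longrightarrow> (\<Sum>x\<in>A. M\<^sub>\<theta> x * wt (\<alpha>k k) x) \<le> D"
    using weighted_sums_bounded[OF ak] by blast
  have "psum p \<alpha> n \<omega> \<le> D + psum (pk k) (\<alpha>k k) n \<omega>" for n \<omega>
  proof -
    have "psum p \<alpha> n \<omega> \<le> (\<Sum>x\<in>ballV n. M\<^sub>\<theta> x * wt (\<alpha>k k) x + \<bar>\<omega> x\<bar> powr pk k * wt (\<alpha>k k) x)"
      unfolding psum_def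
    proof (rule sum_mono)
      fix x
      have "\<bar>\<omega> x\<bar> powr p \<le> 1 + \<bar>\<omega> x\<bar> powr pk k"
      proof (cases "\<bar>\<omega> x\<bar> \<le> 1")
        case True then have "\<bar>\<omega> x\<bar> powr p \<le> 1" using good_p_pos[OF assms] by (intro powr_le1) auto
        then show ?thesis by (simp add: add_increasing2)
      next
        case False then have "\<bar>\<omega> x\<bar> powr p \<le> \<bar>\<omega> x\<bar> powr pk k" using k by (intro powr_mono) auto
        then show ?thesis by simp
      qed
      then have "\<bar>\<omega> x\<bar> powr p * wt \<alpha> x \<le> (M\<^sub>\<theta> x + \<bar>\<omega> x\<bar> powr pk k) * wt (\<alpha>k k) x"
        using wt_antimono[OF k(2), of x] wt_pos[of \<alpha> x] mth_nonneg[of x] by (intro mult_mono) auto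
      then show "\<bar>\<omega> x\<bar> powr p * wt \<alpha> x \<le> M\<^sub>\<theta> x * wt (\<alpha>k k) x + \<bar>\<omega> x\<bar> powr pk k * wt (\<alpha>k k) x"
        by (simp add: algebra_simps)
    qed
    also have "\<dots> \<le> D + psum (pk k) (\<alpha>k k) n \<omega>"
      using D(2)[OF finite_ballV[of n]] by (simp add: psum_def sum.distrib)
    finally show ?thesis .
  qed
  then show thesis using that[OF D(1)] by blast
qed

lemma Omega_t_iff: "\<omega> \<in> \<Omega>\<^sub>t \<longleftrightarrow> (\<forall>k. in_Lp E o\<^sub>0 (pk k) (\<alpha>k k) \<omega>)"
proof
  assume "\<omega> \<in> \<Omega>\<^sub>t" then show "\<forall>k. in_Lp E o\<^sub>0 (pk k) (\<alpha>k k) \<omega>"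
    using good_k by (auto simp: Omega_t_def)
next
  assume *: "\<forall>k. in_Lp E o\<^sub>0 (pk k) (\<alpha>k k) \<omega>"
  have "in_Lp E o\<^sub>0 p \<alpha> \<omega>" if g: "good p \<alpha>" for p \<alpha>
  proof -
    obtain k D where "0 \<le> D" and D: "\<And>n \<omega>. psum p \<alpha> n \<omega> \<le> D + psum (pk k) (\<alpha>k k) n \<omega>"
      using psum_dominated[OF g] by metis
    obtain C where C: "\<forall>n. psum (pk k) (\<alpha>k k) n \<omega> \<le> C"
      using *[rule_format, of k] unfolding in_Lp_iff ..
    have "psum p \<alpha> n \<omega> \<le> D + C" for n using D[of n \<omega>] C[rule_format, of n] by linarith
    then show ?thesis unfolding in_Lp_iff by blast
  qed
  then show "\<omega> \<in> \<Omega>\<^sub>t" by (auto simp: Omega_t_def)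
qed

lemma in_Lp_measurable [measurable]: "{\<omega>. in_Lp E o\<^sub>0 p \<alpha> \<omega>} \<in> sets borel"
proof -
  have "{\<omega>. in_Lp E o\<^sub>0 p \<alpha> \<omega>} = (\<Union>C::nat. \<Inter>n. {\<omega> \<in> space borel. psum p \<alpha> n \<omega> \<le> real C})"
  proof (intro set_eqI iffI)
    fix \<omega> assume "\<omega> \<in> {\<omega>. in_Lp E o\<^sub>0 p \<alpha> \<omega>}"
    then obtain C where C: "\<And>n. psum p \<alpha> n \<omega> \<le> C" unfolding in_Lp_iff by blast
    obtain N :: nat where "C \<le> real N" using real_arch_simple by blast
    then have "psum p \<alpha> n \<omega> \<le> real N" for n using C[of n] by simp
    then show "\<omega> \<in> (\<Union>C::nat. \<Inter>n. {\<omega> \<in> space borel. psum p \<alpha> n \<omega> \<le> real C})" by auto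
  qed (auto simp: in_Lp_iff)
  also have "\<dots> \<in> sets borel" by measurable
  finally show ?thesis .
qed

lemma Omega_t_measurable [measurable]: "\<Omega>\<^sub>t \<in> sets borel"
proof -
  have "\<Omega>\<^sub>t = (\<Inter>k. {\<omega>. in_Lp E o\<^sub>0 (pk k) (\<alpha>k k) \<omega>})" by (auto simp: Omega_t_iff)
  also have "\<dots> \<in> sets borel" by (intro sets.countable_INT) auto
  finally show ?thesis .
qed

text \<open>Monotone convergence bounds the mean of the supremum of the ball sums, which is
  therefore finite almost everywhere.\<close>

lemma AE_in_Lp_of_moments:
  assumes mu: "sets \<mu> = sets borel" and C: "\<And>m. (\<integral>\<^sup>+\<omega>. ennreal (psum p \<alpha> m \<omega>) \<partial>\<mu>) \<le> ennreal C"
  shows "AE \<omega> in \<mu>. in_Lp E o\<^sub>0 p \<alpha> \<omega>"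
proof -
  note [measurable_cong] = mu
  have "(\<integral>\<^sup>+\<omega>. (SUP m. ennreal (psum p \<alpha> m \<omega>)) \<partial>\<mu>) = (SUP m. \<integral>\<^sup>+\<omega>. ennreal (psum p \<alpha> m \<omega>) \<partial>\<mu>)"
    by (rule nn_integral_monotone_convergence_SUP) (auto intro!: incseq_SucI le_funI ennreal_leI psum_mono)
  also have "\<dots> \<le> ennreal C" by (intro SUP_least C)
  finally have "(\<integral>\<^sup>+\<omega>. (SUP m. ennreal (psum p \<alpha> m \<omega>)) \<partial>\<mu>) \<noteq> \<infinity>" by (auto simp: top_unique)
  then have "AE \<omega> in \<mu>. (SUP m. ennreal (psum p \<alpha> m \<omega>)) \<noteq> \<infinity>"
    by (intro nn_integral_PInf_AE) measurable
  then show ?thesis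
  proof eventually_elim
    case (elim \<omega>)
    then obtain c where c: "0 \<le> c" "(SUP m. ennreal (psum p \<alpha> m \<omega>)) = ennreal c"
      by (cases "SUP m. ennreal (psum p \<alpha> m \<omega>)") auto
    have "psum p \<alpha> m \<omega> \<le> c" for m
      using SUP_upper[of m UNIV "\<lambda>m. ennreal (psum p \<alpha> m \<omega>)"] c by (simp add: ennreal_le_iff)
    then show ?case unfolding in_Lp_iff by blast
  qed
qed

subsection \<open>Cluster points of approximate Gibbs measures\<close>

text \<open>The energy reads \<open>\<xi>\<close> only on the outer boundary of
  \<open>\<Lambda>\<close>, and the event only on \<open>J\<close>.\<close>

lemma ker_local:
  assumes fin: "finite \<Lambda>" and A: "A \<in> cyl J"
    and eq: "\<And>y. y \<in> J \<union> bdry \<Lambda> \<Longrightarrow> \<xi> y = \<eta> y"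
  shows "emeasure (ker \<Lambda> \<xi>) A = emeasure (ker \<Lambda> \<eta>) A"
proof -
  have As: "A \<in> sets borel" using A by (rule cyl_sets)
  have b: "boltz \<Lambda> \<omega> \<xi> = boltz \<Lambda> \<omega> \<eta>" for \<omega>
  proof -
    have "(\<Sum>(x,y)\<in>edges \<Lambda>. W (merge_cfg \<Lambda> \<omega> \<xi> x) (merge_cfg \<Lambda> \<omega> \<xi> y))
        = (\<Sum>(x,y)\<in>edges \<Lambda>. W (merge_cfg \<Lambda> \<omega> \<eta> x) (merge_cfg \<Lambda> \<omega> \<eta> y))"
    proof (rule sum.cong[OF refl], clarify)
      fix x y assume "(x, y) \<in> edges \<Lambda>"
      then have e: "E x y" "x \<in> \<Lambda> \<or> y \<in> \<Lambda>" by (auto simp: edges_def)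
      have "merge_cfg \<Lambda> \<omega> \<xi> x = merge_cfg \<Lambda> \<omega> \<eta> x"
        using e sym[OF e(1)] by (auto simp: merge_cfg_def bdry_def intro!: eq)
      moreover have "merge_cfg \<Lambda> \<omega> \<xi> y = merge_cfg \<Lambda> \<omega> \<eta> y"
        using e by (auto simp: merge_cfg_def bdry_def intro!: eq)
      ultimately show "W (merge_cfg \<Lambda> \<omega> \<xi> x) (merge_cfg \<Lambda> \<omega> \<xi> y)
          = W (merge_cfg \<Lambda> \<omega> \<eta> x) (merge_cfg \<Lambda> \<omega> \<eta> y)"
        by simp
    qed
    moreover have "(\<Sum>x\<in>\<Lambda>. V (merge_cfg \<Lambda> \<omega> \<xi> x)) = (\<Sum>x\<in>\<Lambda>. V (merge_cfg \<Lambda> \<omega> \<eta> x))"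
      by (intro sum.cong) (auto simp: merge_cfg_def)
    ultimately show ?thesis unfolding boltz_def Ham_edges[OF fin] by simp
  qed
  have i: "indicator A (merge_cfg \<Lambda> \<omega> \<xi>) = (indicator A (merge_cfg \<Lambda> \<omega> \<eta>) :: ennreal)" for \<omega>
    using cylD[OF A, of "merge_cfg \<Lambda> \<omega> \<xi>" "merge_cfg \<Lambda> \<omega> \<eta>"] eq
    by (auto simp: merge_cfg_def split: split_indicator)
  have e: "emeasure (ker \<Lambda> \<zeta>) A
      = (\<integral>\<^sup>+\<omega>. indicator A (merge_cfg \<Lambda> \<omega> \<zeta>) * boltz \<Lambda> \<omega> \<zeta> \<partial>leb \<Lambda>) / ZE \<Lambda> \<zeta>" for \<zeta>
    using nn_integral_ker[OF fin, of "indicator A" \<zeta>] As by simp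
  show ?thesis unfolding e ZE_def b i ..
qed

lemma fcyl_meas_ker:
  assumes fin: "finite \<Lambda>" and A: "A \<in> fcyl"
  shows "fcyl_meas (\<lambda>\<xi>. measure (ker \<Lambda> \<xi>) A)"
proof -
  obtain J where J: "finite J" "A \<in> cyl J" using A by (auto simp: fcyl_def)
  show ?thesis
  proof (rule fcyl_measI[of _ "J \<union> bdry \<Lambda>"])
    have "(\<lambda>\<xi>. emeasure (ker \<Lambda> \<xi>) A) \<in> borel_measurable borel"
      by (rule measurable_compose[OF ker_measurable[OF fin] measurable_emeasure_subprob_algebra])
        (rule cyl_sets[OF J(2)])
    then show "(\<lambda>\<xi>. measure (ker \<Lambda> \<xi>) A) \<in> borel_measurable borel"
      unfolding measure_def by measurable
    show "finite (J \<union> bdry \<Lambda>)" using J finite_bdry[OF fin] by simp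
    show "measure (ker \<Lambda> \<xi>) A = measure (ker \<Lambda> \<eta>) A"
      if "\<And>y. y \<in> J \<union> bdry \<Lambda> \<Longrightarrow> \<xi> y = \<eta> y" for \<xi> \<eta>
      unfolding measure_def using ker_local[OF fin J(2) that] by simp
  qed
qed

lemma fcyl_meas_trunc_psum: "fcyl_meas (\<lambda>\<omega>. min c (psum p \<alpha> m \<omega>))"
  by (rule fcyl_measI[OF _ finite_ballV[of m]]) (auto simp: psum_def)

text \<open>\<open>\<mu>\<close> and its image under the kernel are probability measures agreeing on
  a generating family stable under intersection, hence equal.\<close>

lemma dlr_from_fcyl:
  assumes mu: "sets \<mu> = sets borel" "prob_space \<mu>" and fin: "finite \<Lambda>"
    and dlr: "\<And>A. A \<in> fcyl \<Longrightarrow> emeasure \<mu> A = (\<integral>\<^sup>+\<xi>. emeasure (ker \<Lambda> \<xi>) A \<partial>\<mu>)"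
    and A: "A \<in> sets borel"
  shows "emeasure \<mu> A = (\<integral>\<^sup>+\<xi>. emeasure (ker \<Lambda> \<xi>) A \<partial>\<mu>)"
proof -
  have km: "ker \<Lambda> \<in> \<mu> \<rightarrow>\<^sub>M subprob_algebra borel"
    using ker_measurable[OF fin] mu(1) by (metis measurable_cong_sets)
  have ne: "space \<mu> \<noteq> {}" using prob_space.not_empty[OF mu(2)] .
  have eb: "emeasure (\<mu> \<bind> ker \<Lambda>) A = (\<integral>\<^sup>+\<xi>. emeasure (ker \<Lambda> \<xi>) A \<partial>\<mu>)" if "A \<in> sets borel" for A
    using that by (rule emeasure_bind[OF ne km])
  have sb: "sets (\<mu> \<bind> ker \<Lambda>) = sets borel" using ne by (subst sets_bind[of _ _ borel]) auto
  have sp: "space (\<mu> \<bind> ker \<Lambda>) = UNIV" using sets_eq_imp_space_eq[OF sb] by simp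
  have "\<mu> = \<mu> \<bind> ker \<Lambda>"
  proof (rule measure_eqI_fcyl[OF mu sb])
    have "emeasure (\<mu> \<bind> ker \<Lambda>) UNIV = (\<integral>\<^sup>+\<xi>. 1 \<partial>\<mu>)"
      using prob_space.emeasure_space_1[OF prob_space_ker[OF fin]] by (subst eb) auto
    then show "prob_space (\<mu> \<bind> ker \<Lambda>)"
      using prob_space.emeasure_space_1[OF mu(2)] by (intro prob_spaceI) (simp add: sp)
    show "emeasure \<mu> A = emeasure (\<mu> \<bind> ker \<Lambda>) A" if "A \<in> fcyl" for A
      using dlr[OF that] eb[OF fcyl_sets[OF that]] by simp
  qed
  then show ?thesis using eb[OF A] by simp
qed

text \<open>The boundary configurations are split at \<open>psum = c\<close>: below it the kernel is
  at most \<open>b\<close>, above it Markov's inequality yields \<open>K / c\<close>.\<close>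

lemma cylinder_mass_bound:
  assumes M: "sets M = sets borel" "prob_space M" and fin: "finite \<Lambda>"
    and dlr: "emeasure M A = (\<integral>\<^sup>+\<xi>. emeasure (ker \<Lambda> \<xi>) A \<partial>M)"
    and mom: "(\<integral>\<^sup>+\<omega>. ennreal (psum p \<alpha> m \<omega>) \<partial>M) \<le> ennreal K" and K: "0 \<le> K"
    and c: "0 < c" and b: "\<And>\<xi>. psum p \<alpha> m \<xi> < c \<Longrightarrow> measure (ker \<Lambda> \<xi>) A \<le> b" and b0: "0 \<le> b"
  shows "measure M A \<le> K / c + b"
proof -
  interpret prob_space M by fact
  note [measurable_cong] = M(1)
  have sp: "space M = UNIV" using sets_eq_imp_space_eq[OF M(1)] by simp
  have "emeasure (ker \<Lambda> \<xi>) A \<le> ennreal (1 / c) * ennreal (psum p \<alpha> m \<xi>) + ennreal b" for \<xi>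
  proof (cases "psum p \<alpha> m \<xi> < c")
    case True
    have "emeasure (ker \<Lambda> \<xi>) A = ennreal (measure (ker \<Lambda> \<xi>) A)"
      using prob_space_ker[OF fin]
          by (simp add: finite_measure.emeasure_eq_measure prob_space.finite_measure)
    also have "\<dots> \<le> ennreal b" by (rule ennreal_leI[OF b[OF True]])
    finally show ?thesis by (simp add: add_increasing)
  next
    case False
    have "emeasure (ker \<Lambda> \<xi>) A \<le> 1"
      using prob_space.emeasure_le_1[OF prob_space_ker[OF fin]] .
    also have "1 \<le> ennreal (1 / c) * ennreal (psum p \<alpha> m \<xi>)"
      using False c psum_nonneg[of p \<alpha> m \<xi>] by (simp flip: ennreal_mult)
    finally show ?thesis by (simp add: add_increasing2)
  qed
  then have "emeasure M A \<le> (\<integral>\<^sup>+\<xi>. ennreal (1 / c) * ennreal (psum p \<alpha> m \<xi>) + ennreal b \<partial>M)"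
    unfolding dlr by (rule nn_integral_mono)
  also have "\<dots> = ennreal (1 / c) * (\<integral>\<^sup>+\<xi>. ennreal (psum p \<alpha> m \<xi>) \<partial>M) + ennreal b"
    by (subst nn_integral_add) (auto simp: nn_integral_cmult emeasure_space_1)
  also have "\<dots> \<le> ennreal (1 / c) * ennreal K + ennreal b"
    by (intro add_right_mono mult_left_mono mom) auto
  also have "\<dots> = ennreal (K / c + b)"
    using c K b0 by (simp add: ennreal_plus flip: ennreal_mult)
  finally show ?thesis using c K b0 by (simp add: emeasure_eq_measure ennreal_le_iff del: ennreal_plus)
qed

text \<open>The Gibbs equation and the moment bounds are asked only eventually along the filter. So
  the statement covers kernels of growing balls, which satisfy the equation for a given
  \<open>\<Lambda>\<close> only from some radius on, as well as filters of Gibbs measures.\<close>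

theorem cluster_point_Gibbs:
  fixes M :: "'i \<Rightarrow> ('v \<Rightarrow> real) measure" and \<phi> :: "('v \<Rightarrow> real) set \<Rightarrow> real"
  assumes F: "F \<noteq> bot"
    and M: "\<forall>\<^sub>F i in F. sets (M i) = sets borel \<and> prob_space (M i)"
    and conv: "\<And>A. A \<in> fcyl \<Longrightarrow> ((\<lambda>i. measure (M i) A) \<longlongrightarrow> \<phi> A) F"
    and dlr: "\<And>\<Lambda> A. finite \<Lambda> \<Longrightarrow> \<Lambda> \<noteq> {} \<Longrightarrow> A \<in> fcyl \<Longrightarrow>
      \<forall>\<^sub>F i in F. emeasure (M i) A = (\<integral>\<^sup>+\<xi>. emeasure (ker \<Lambda> \<xi>) A \<partial>M i)"
    and mom: "\<And>p \<alpha> m. good p \<alpha> \<Longrightarrow> \<forall>\<^sub>F i in F. (\<integral>\<^sup>+\<omega>. ennreal (psum p \<alpha> m \<omega>) \<partial>M i) \<le> ennreal (Kmom p \<alpha>)"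
  obtains \<mu> where "\<mu> \<in> Gibbs E W V" "emeasure \<mu> \<Omega>\<^sub>t = 1" "\<And>A. A \<in> fcyl \<Longrightarrow> measure \<mu> A = \<phi> A"
proof -
  have \<phi>_le: "\<phi> A \<le> u" if "A \<in> fcyl" "\<forall>\<^sub>F i in F. measure (M i) A \<le> u" for A u
    using tendsto_upperbound[OF conv[OF that(1)] that(2) F] .
  have cont: "(\<lambda>n. \<phi> (A n)) \<longlonglongrightarrow> 0"
    if J: "finite J" and A: "\<And>n. A n \<in> cyl J" "decseq A" "(\<Inter>n. A n) = {}" for J and A :: "nat \<Rightarrow> _"
  proof -
    \<comment> \<open>\<open>J\<close> may be empty, while the Gibbs property concerns non-void
      volumes; the root is added for this reason.\<close>
    define \<Lambda> where "\<Lambda> = insert o\<^sub>0 J"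
    have L: "finite \<Lambda>" "\<Lambda> \<noteq> {}" using J by (auto simp: \<Lambda>_def)
    have AL: "A n \<in> cyl \<Lambda>" for n using A(1) cyl_mono[of J \<Lambda>] by (auto simp: \<Lambda>_def)
    have Af: "A n \<in> fcyl" for n using fcylI[OF J A(1)] .
    define p where "p = pk 0" define \<alpha> where "\<alpha> = \<alpha>k 0"
    have g: "good p \<alpha>" unfolding p_def \<alpha>_def by (rule good_k)
    have p0: "0 < p" using good_p_pos[OF g] by simp
    have K0: "0 \<le> Kmom p \<alpha>" by (rule Kmom(1)[OF g])
    obtain m where m: "bdry \<Lambda> \<subseteq> ballV m" using finite_subset_ballV[OF finite_bdry[OF L(1)]] by blast
    show ?thesis
    proof (rule LIMSEQ_I)
      fix e :: real assume e: "0 < e"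
      \<comment> \<open>Makes the Markov contribution less than \<open>e / 2\<close>; the added 1
        keeps \<open>c\<close> positive when \<open>Kmom p \<alpha>\<close> vanishes.\<close>
      define c where "c = 2 * (Kmom p \<alpha> + 1) / e"
      have c: "0 < c" using e K0 by (simp add: c_def)
      have Kc: "Kmom p \<alpha> / c < e / 2"
        using e K0 by (simp add: c_def field_simps)
      \<comment> \<open>\<open>psum < c\<close> bounds each spin on the outer boundary by the
        corresponding summand, and the sum bounds them all at once.\<close>
      define R where "R = (\<Sum>y\<in>bdry \<Lambda>. (c / wt \<alpha> y) powr (1 / p))"
      have R: "\<bar>\<xi> y\<bar> \<le> R" if "psum p \<alpha> m \<xi> < c" "y \<in> bdry \<Lambda>" for \<xi> y
      proof -
        have "\<bar>\<xi> y\<bar> powr p * wt \<alpha> y \<le> psum p \<alpha> m \<xi>"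
          using finite_sum_le_psum[of "{y}" m \<xi> p \<alpha>] m that(2) by auto
        then have "\<bar>\<xi> y\<bar> powr p \<le> c / wt \<alpha> y"
          using that(1) wt_pos[of \<alpha> y] by (simp add: pos_le_divide_eq)
        then have "(\<bar>\<xi> y\<bar> powr p) powr (1 / p) \<le> (c / wt \<alpha> y) powr (1 / p)"
          using p0 by (intro powr_mono2) auto
        then have "\<bar>\<xi> y\<bar> \<le> (c / wt \<alpha> y) powr (1 / p)" using p0 by (simp add: powr_powr)
        also have "\<dots> \<le> R" unfolding R_def
          using that(2) finite_bdry[OF L(1)]
              by (intro member_le_sum[of _ _ "\<lambda>y. (c / wt \<alpha> y) powr (1 / p)"]) auto
        finally show ?thesis .
      qed
      have R0: "0 \<le> R" unfolding R_def by (intro sum_nonneg) auto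
      obtain b :: "nat \<Rightarrow> real" where b: "b \<longlonglongrightarrow> 0" "\<And>n \<xi>. (\<And>y. y \<in> bdry \<Lambda> \<Longrightarrow> \<bar>\<xi> y\<bar> \<le> R)
          \<Longrightarrow> measure (ker \<Lambda> \<xi>) (A n) \<le> b n"
        using ker_equicontinuous[OF L(1) AL A(2,3), of R] by blast
      have b0: "0 \<le> b n" for n
        using order_trans[OF measure_nonneg b(2)[of "\<lambda>_. 0" n]] R0 by simp
      have le: "\<phi> (A n) \<le> Kmom p \<alpha> / c + b n" for n
      proof (rule \<phi>_le[OF Af])
        show "\<forall>\<^sub>F i in F. measure (M i) (A n) \<le> Kmom p \<alpha> / c + b n"
          using M dlr[OF L Af[of n]] mom[OF g, of m]
        proof eventually_elim
          case (elim i)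
          show ?case
            by (rule cylinder_mass_bound[OF _ _ L(1) elim(2,3) K0 c _ b0]) (use elim(1) b(2) R in auto)
        qed
      qed
      have nn: "0 \<le> \<phi> (A n)" for n
        by (rule tendsto_lowerbound[OF conv[OF Af] _ F]) (simp add: always_eventually)
      obtain n0 where n0: "\<And>n. n0 \<le> n \<Longrightarrow> norm (b n - 0) < e / 2"
        using LIMSEQ_D[OF b(1), of "e / 2"] e by auto
      show "\<exists>no. \<forall>n\<ge>no. norm (\<phi> (A n) - 0) < e"
      proof (intro exI[of _ n0] allI impI)
        fix n assume "n0 \<le> n"
        then show "norm (\<phi> (A n) - 0) < e" using n0[of n] le[of n] nn[of n] Kc unfolding real_norm_def
            by linarith
      qed
    qed
  qed
  have nonneg: "0 \<le> \<phi> A" if "A \<in> fcyl" for A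
    by (rule tendsto_lowerbound[OF conv[OF that] _ F]) (simp add: always_eventually)
  have one: "\<phi> UNIV = 1"
  proof (rule tendsto_unique[OF F conv[OF UNIV_fcyl]])
    show "((\<lambda>i. measure (M i) UNIV) \<longlongrightarrow> 1) F"
      by (rule tendsto_eventually) (use M
          in eventually_elim, metis prob_space.prob_space sets_eq_imp_space_eq space_borel)
  qed
  have add: "\<phi> (A \<union> B) = \<phi> A + \<phi> B" if A: "A \<in> fcyl" and B: "B \<in> fcyl" and dis: "A \<inter> B = {}" for A B
  proof (rule tendsto_unique[OF F])
    have U: "A \<union> B \<in> fcyl" using A B by (metis fcyl_common cyl_Un fcylI)
    show "((\<lambda>i. measure (M i) (A \<union> B)) \<longlongrightarrow> \<phi> (A \<union> B)) F" by (rule conv[OF U])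
    have "((\<lambda>i. measure (M i) A + measure (M i) B) \<longlongrightarrow> \<phi> A + \<phi> B) F"
      by (intro tendsto_add conv A B)
    then show "((\<lambda>i. measure (M i) (A \<union> B)) \<longlongrightarrow> \<phi> A + \<phi> B) F"
    proof (rule Lim_transform_eventually)
      show "\<forall>\<^sub>F i in F. measure (M i) A + measure (M i) B = measure (M i) (A \<union> B)"
        using M
      proof eventually_elim
        case (elim i)
        then interpret prob_space "M i" by simp
        show ?case using elim fcyl_sets[OF A] fcyl_sets[OF B] dis
          by (simp add: finite_measure_Union)
      qed
    qed
  qed
  have "\<exists>\<mu>. sets \<mu> = sets borel \<and> prob_space \<mu> \<and> (\<forall>A\<in>fcyl. measure \<mu> A = \<phi> A)"
    by (rule cylinder_extension[of \<phi>, OF nonneg one add cont]) auto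
  then obtain \<mu> where mu: "sets \<mu> = sets borel" "prob_space \<mu>" "\<And>A. A \<in> fcyl \<Longrightarrow> measure \<mu> A = \<phi> A"
    by auto
  have conv': "((\<lambda>i. measure (M i) A) \<longlongrightarrow> measure \<mu> A) F" if "A \<in> fcyl" for A
    using conv[OF that] mu(3)[OF that] by simp
  note lim = tendsto_integral_fcyl[OF M mu(1,2) conv']
  have "\<mu> \<in> Gibbs E W V"
    unfolding Gibbs_iff
  proof (intro conjI allI impI mu(1,2))
    fix \<Lambda> :: "'v set" and A :: "('v \<Rightarrow> real) set"
    assume "finite \<Lambda> \<and> \<Lambda> \<noteq> {} \<and> A \<in> sets borel"
    then have L: "finite \<Lambda>" "\<Lambda> \<noteq> {}" and A: "A \<in> sets borel" by auto
    have "emeasure \<mu> B = (\<integral>\<^sup>+\<xi>. emeasure (ker \<Lambda> \<xi>) B \<partial>\<mu>)" if B: "B \<in> fcyl" for B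
      unfolding dlr_measure_iff[OF mu(1,2) L(1) fcyl_sets[OF B]]
    proof (rule tendsto_unique[OF F conv'[OF B]])
      have "((\<lambda>i. \<integral>\<xi>. measure (ker \<Lambda> \<xi>) B \<partial>M i) \<longlongrightarrow> (\<integral>\<xi>. measure (ker \<Lambda> \<xi>) B \<partial>\<mu>)) F"
        by (rule lim[OF _ fcyl_meas_ker[OF L(1) B], of 1])
          (use prob_space.prob_le_1[OF prob_space_ker[OF L(1)]] in auto)
      then show "((\<lambda>i. measure (M i) B) \<longlongrightarrow> (\<integral>\<xi>. measure (ker \<Lambda> \<xi>) B \<partial>\<mu>)) F"
      proof (rule Lim_transform_eventually)
        show "\<forall>\<^sub>F i in F. (\<integral>\<xi>. measure (ker \<Lambda> \<xi>) B \<partial>M i) = measure (M i) B"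
          using M dlr[OF L B]
          by eventually_elim (use dlr_measure_iff[OF _ _ L(1) fcyl_sets[OF B]] in auto)
      qed
    qed
    from dlr_from_fcyl[OF mu(1,2) L(1) this A]
    show "emeasure \<mu> A = (\<integral>\<^sup>+\<xi>. emeasure (ker \<Lambda> \<xi>) A \<partial>\<mu>)" .
  qed
  moreover have "emeasure \<mu> \<Omega>\<^sub>t = 1"
  proof -
    interpret prob_space \<mu> by (rule mu(2))
    \<comment> \<open>Truncated ball sums are bounded cylinder functions, so their integrals pass to
      the limit; removing the truncation afterwards keeps the same constant.\<close>
    have moments: "(\<integral>\<^sup>+\<omega>. ennreal (psum p \<alpha> m \<omega>) \<partial>\<mu>) \<le> ennreal (Kmom p \<alpha>)" if g: "good p \<alpha>" for p \<alpha> m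
    proof (rule nn_integral_le_of_truncations)
      show "psum p \<alpha> m \<in> borel_measurable \<mu>" using psum_measurable mu(1) by (metis measurable_cong_sets)
      fix N :: nat
      let ?g = "\<lambda>\<omega>. min (real N) (psum p \<alpha> m \<omega>)"
      have g0: "0 \<le> ?g \<omega>" "\<bar>?g \<omega>\<bar> \<le> real N" for \<omega> using psum_nonneg[of p \<alpha> m \<omega>] by auto
      have gi: "(\<integral>\<^sup>+\<omega>. min (ennreal (real N)) (ennreal (psum p \<alpha> m \<omega>)) \<partial>L) = ennreal (\<integral>\<omega>. ?g \<omega> \<partial>L)"
        if L: "sets L = sets borel" "prob_space L" for L
      proof -
        interpret L: prob_space L by fact
        have "?g \<in> borel_measurable L"
          using fcyl_meas_trunc_psum[of "real N" p \<alpha> m] L(1) unfolding fcyl_meas_def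
              by (metis measurable_cong_sets)
        then have "integrable L ?g"
          by (intro L.integrable_const_bound[of _ "real N"]) (use g0 in auto)
        then have "(\<integral>\<^sup>+\<omega>. ennreal (?g \<omega>) \<partial>L) = ennreal (\<integral>\<omega>. ?g \<omega> \<partial>L)"
          by (rule nn_integral_eq_integral) (use g0 in auto)
        moreover have "min (ennreal (real N)) (ennreal (psum p \<alpha> m \<omega>)) = ennreal (?g \<omega>)" for \<omega>
          using psum_nonneg[of p \<alpha> m \<omega>] by (simp add: min_def ennreal_le_iff)
        ultimately show ?thesis by simp
      qed
      have "(\<integral>\<omega>. ?g \<omega> \<partial>\<mu>) \<le> Kmom p \<alpha>"
      proof (rule tendsto_upperbound[OF lim[OF _ fcyl_meas_trunc_psum g0(2)] _ F])
        show "\<forall>\<^sub>F i in F. (\<integral>\<omega>. ?g \<omega> \<partial>M i) \<le> Kmom p \<alpha>"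
          using M mom[OF g, of m]
        proof eventually_elim
          case (elim i)
          have "ennreal (\<integral>\<omega>. ?g \<omega> \<partial>M i) \<le> (\<integral>\<^sup>+\<omega>. ennreal (psum p \<alpha> m \<omega>) \<partial>M i)"
            using elim(1) by (subst gi[symmetric]) (auto intro!: nn_integral_mono)
          also note elim(2)
          finally show ?case using Kmom(1)[OF g] by (simp add: ennreal_le_iff)
        qed
      qed
      then show "(\<integral>\<^sup>+\<omega>. min (ennreal (real N)) (ennreal (psum p \<alpha> m \<omega>)) \<partial>\<mu>) \<le> ennreal (Kmom p \<alpha>)"
        unfolding gi[OF mu(1,2)] by (rule ennreal_leI)
    qed
    have "AE \<omega> in \<mu>. \<forall>k. in_Lp E o\<^sub>0 (pk k) (\<alpha>k k) \<omega>"
      unfolding AE_all_countable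
      by (intro allI AE_in_Lp_of_moments[OF mu(1) moments[OF good_k]])
    then have "AE \<omega> in \<mu>. \<omega> \<in> \<Omega>\<^sub>t" by (simp add: Omega_t_iff)
    then show ?thesis
      using Omega_t_measurable mu(1) by (subst emeasure_eq_1_AE) auto
  qed
  ultimately show thesis using that mu(3) by blast
qed

subsection \<open>Convergence in the projective limit topology\<close>

abbreviation "\<T>\<^sub>t \<equiv> Omega_t_top E o\<^sub>0 \<theta> r q \<alpha>up"

lemma topspace_Omega_t [simp]: "topspace \<T>\<^sub>t = \<Omega>\<^sub>t"
  unfolding Omega_t_top_def topology_generated_by_topspace by auto

text \<open>A substitute for convergence in \<open>\<T>\<^sub>t\<close> that can be obtained from
  bounds alone, by extracting a pointwise limit; \<open>nice_conv_eventually_open\<close> shows that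
  it implies convergence in that topology.\<close>

definition nice_conv :: "(nat \<Rightarrow> 'v \<Rightarrow> real) \<Rightarrow> ('v \<Rightarrow> real) \<Rightarrow> bool" where
  "nice_conv \<omega>s \<omega> \<longleftrightarrow> (\<forall>x. (\<lambda>n. \<omega>s n x) \<longlonglongrightarrow> \<omega> x) \<and>
     (\<forall>p \<alpha>. good p \<alpha> \<longrightarrow> (\<exists>C. \<forall>n m. psum p \<alpha> m (\<omega>s n) \<le> C))"

lemma psum_tendsto:
  assumes "0 < p" "\<And>x. (\<lambda>n. \<omega>s n x) \<longlonglongrightarrow> \<omega> x"
  shows "(\<lambda>n. psum p \<alpha> m (\<omega>s n)) \<longlonglongrightarrow> psum p \<alpha> m \<omega>"
  unfolding psum_def
  by (intro tendsto_sum tendsto_mult tendsto_const tendsto_powr' tendsto_rabs assms) (use assms(1) in auto)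

lemma nice_conv_limit:
  assumes nc: "nice_conv \<omega>s \<omega>" and g: "good p \<alpha>"
  obtains C where "\<And>n m. psum p \<alpha> m (\<omega>s n) \<le> C" "\<And>m. psum p \<alpha> m \<omega> \<le> C"
proof -
  obtain C where C: "\<And>n m. psum p \<alpha> m (\<omega>s n) \<le> C" using nc g unfolding nice_conv_def by blast
  have "psum p \<alpha> m \<omega> \<le> C" for m
  proof (rule tendsto_upperbound)
    show "(\<lambda>n. psum p \<alpha> m (\<omega>s n)) \<longlonglongrightarrow> psum p \<alpha> m \<omega>"
      using nc good_p_pos[OF g] by (intro psum_tendsto) (auto simp: nice_conv_def)
  qed (use C in auto)
  then show thesis using that C by blast
qed

lemma nice_conv_Omega_t:
  assumes "nice_conv \<omega>s \<omega>" shows "\<omega> \<in> \<Omega>\<^sub>t" "\<omega>s n \<in> \<Omega>\<^sub>t"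
proof -
  have "in_Lp E o\<^sub>0 p \<alpha> \<omega> \<and> in_Lp E o\<^sub>0 p \<alpha> (\<omega>s n)" if g: "good p \<alpha>" for p \<alpha>
    using nice_conv_limit[OF assms g] unfolding in_Lp_iff by metis
  then show "\<omega> \<in> \<Omega>\<^sub>t" "\<omega>s n \<in> \<Omega>\<^sub>t" by (auto simp: Omega_t_def)
qed

text \<open>The balls generating the topology have arbitrary tempered centres; translation reduces
  them to convergence of norms.\<close>

lemma nice_conv_diff:
  assumes nc: "nice_conv \<omega>s \<omega>" and \<zeta>: "\<zeta> \<in> \<Omega>\<^sub>t"
  shows "nice_conv (\<lambda>n. \<omega>s n - \<zeta>) (\<omega> - \<zeta>)"
  unfolding nice_conv_def
proof (intro conjI allI impI)
  show "(\<lambda>n. (\<omega>s n - \<zeta>) x) \<longlonglongrightarrow> (\<omega> - \<zeta>) x" for x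
    using nc by (auto simp: nice_conv_def intro!: tendsto_diff)
  fix p \<alpha> assume g: "good p \<alpha>"
  obtain C where C: "\<And>n m. psum p \<alpha> m (\<omega>s n) \<le> C" using nc g unfolding nice_conv_def by blast
  have "in_Lp E o\<^sub>0 p \<alpha> \<zeta>" using \<zeta> g by (auto simp: Omega_t_def)
  then obtain D where D: "\<forall>m. psum p \<alpha> m \<zeta> \<le> D" unfolding in_Lp_iff ..
  have p: "0 < p" using good_p_pos[OF g] by simp
  have "psum p \<alpha> m (\<omega>s n - \<zeta>) \<le> 2 powr p * (C + D)" for n m
  proof -
    have "psum p \<alpha> m (\<omega>s n - \<zeta>) \<le> (\<Sum>x\<in>ballV m. 2 powr p * (\<bar>\<omega>s n x\<bar> powr p + \<bar>\<zeta> x\<bar> powr p) * wt \<alpha> x)"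
      unfolding psum_def using abs_diff_powr_le[OF p] wt_pos
      by (intro sum_mono mult_right_mono) (auto intro: less_imp_le)
    also have "\<dots> = 2 powr p * (psum p \<alpha> m (\<omega>s n) + psum p \<alpha> m \<zeta>)"
      unfolding psum_def sum.distrib[symmetric] sum_distrib_left
          by (intro sum.cong) (auto simp: algebra_simps)
    also have "\<dots> \<le> 2 powr p * (C + D)"
      using C D by (intro mult_left_mono add_mono) auto
    finally show ?thesis .
  qed
  then show "\<exists>C. \<forall>n m. psum p \<alpha> m (\<omega>s n - \<zeta>) \<le> C" by blast
qed

text \<open>Passing from \<open>\<alpha>\<close> to a smaller admissible \<open>\<beta>\<close> makes the tails of the sums uniformly small,
  which turns pointwise convergence into convergence in norm.\<close>

lemma infsum_tail_bound:
  assumes \<beta>: "\<beta> \<le> \<alpha>" and C: "\<And>m. psum p \<beta> m \<omega> \<le> C"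
  shows "(\<Sum>\<^sub>\<infinity>x. \<bar>\<omega> x\<bar> powr p * wt \<alpha> x) \<le> psum p \<alpha> N \<omega> + exp (- ((\<alpha> - \<beta>) * real N)) * C"
proof (rule infsum_le_psum_bound)
  fix m
  have C0: "0 \<le> C" using C[of 0] psum_nonneg[of p \<beta> 0 \<omega>] by simp
  show "psum p \<alpha> m \<omega> \<le> psum p \<alpha> N \<omega> + exp (- ((\<alpha> - \<beta>) * real N)) * C"
  proof (cases "m \<le> N")
    case True
    then show ?thesis using psum_mono[OF True, of p \<alpha> \<omega>] C0 by (simp add: add_increasing2)
  next
    case False
    then have sub: "ballV N \<subseteq> ballV m" by (intro ballV_mono) simp
    have "psum p \<alpha> m \<omega> - psum p \<alpha> N \<omega> = (\<Sum>x\<in>ballV m - ballV N. \<bar>\<omega> x\<bar> powr p * wt \<alpha> x)"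
      unfolding psum_def by (rule sum_diff[OF finite_ballV sub, symmetric])
    also have "\<dots> \<le> (\<Sum>x\<in>ballV m - ballV N. exp (- ((\<alpha> - \<beta>) * real N)) * (\<bar>\<omega> x\<bar> powr p * wt \<beta> x))"
    proof (rule sum_mono)
      fix x assume "x \<in> ballV m - ballV N"
      then have "real N \<le> real (gdist E o\<^sub>0 x)" by (simp add: ballV_def)
      then have "(\<alpha> - \<beta>) * real N \<le> (\<alpha> - \<beta>) * real (gdist E o\<^sub>0 x)" using \<beta> by (intro mult_left_mono) auto
      then have "wt \<alpha> x \<le> exp (- ((\<alpha> - \<beta>) * real N)) * wt \<beta> x"
        unfolding wgt_def by (simp add: algebra_simps flip: exp_add)
      then show "\<bar>\<omega> x\<bar> powr p * wt \<alpha> x \<le> exp (- ((\<alpha> - \<beta>) * real N)) * (\<bar>\<omega> x\<bar> powr p * wt \<beta> x)"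
        using mult_left_mono[of "wt \<alpha> x" "exp (- ((\<alpha> - \<beta>) * real N)) * wt \<beta> x" "\<bar>\<omega> x\<bar> powr p"]
        by (simp add: mult.left_commute)
    qed
    also have "\<dots> = exp (- ((\<alpha> - \<beta>) * real N)) * (\<Sum>x\<in>ballV m - ballV N. \<bar>\<omega> x\<bar> powr p * wt \<beta> x)"
      by (simp add: sum_distrib_left)
    also have "\<dots> \<le> exp (- ((\<alpha> - \<beta>) * real N)) * C"
      using order_trans[OF finite_sum_le_psum C, of "ballV m - ballV N" m] by (intro mult_left_mono) auto
    finally show ?thesis by simp
  qed
qed

lemma psum_le_infsum:
  assumes "in_Lp E o\<^sub>0 p \<alpha> \<omega>" shows "psum p \<alpha> N \<omega> \<le> (\<Sum>\<^sub>\<infinity>x. \<bar>\<omega> x\<bar> powr p * wt \<alpha> x)"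
  using assms unfolding in_Lp_def psum_def
      by (intro finite_sum_le_infsum finite_ballV psum_term_nonneg) auto

lemma nice_conv_infsum:
  assumes nc: "nice_conv \<omega>s \<omega>" and g: "good p \<alpha>"
  shows "(\<lambda>n. \<Sum>\<^sub>\<infinity>x. \<bar>\<omega>s n x\<bar> powr p * wt \<alpha> x) \<longlonglongrightarrow> (\<Sum>\<^sub>\<infinity>x. \<bar>\<omega> x\<bar> powr p * wt \<alpha> x)"
proof (rule LIMSEQ_I)
  fix e :: real assume e: "0 < e"
  \<comment> \<open>A strictly smaller admissible rate exists because the lower end
    \<open>alow\<close> of the range is excluded.\<close>
  define \<beta> where "\<beta> = (\<alpha> + alow) / 2"
  have \<beta>: "\<beta> < \<alpha>" and g\<beta>: "good p \<beta>" using g by (auto simp: adm_def \<beta>_def field_simps)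
  obtain C where C: "\<And>n m. psum p \<beta> m (\<omega>s n) \<le> C" "\<And>m. psum p \<beta> m \<omega> \<le> C"
    using nice_conv_limit[OF nc g\<beta>] by metis
  have "(\<lambda>N. exp (- ((\<alpha> - \<beta>) * real N)) * C) \<longlonglongrightarrow> 0 * C"
  proof (intro tendsto_mult tendsto_const)
    have "filterlim (\<lambda>N. (\<alpha> - \<beta>) * real N) at_top sequentially"
      using \<beta> by (intro filterlim_tendsto_pos_mult_at_top[OF tendsto_const] filterlim_real_sequentially) simp
    then have "filterlim (\<lambda>N. - ((\<alpha> - \<beta>) * real N)) at_bot sequentially"
      by (simp add: filterlim_uminus_at_bot)
    then show "(\<lambda>N. exp (- ((\<alpha> - \<beta>) * real N))) \<longlonglongrightarrow> 0"
      by (rule filterlim_compose[OF exp_at_bot])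
  qed
  then have "\<forall>\<^sub>F N in sequentially. exp (- ((\<alpha> - \<beta>) * real N)) * C < e / 3"
    by (rule order_tendstoD(2)) (use e in simp)
  then obtain N where N: "exp (- ((\<alpha> - \<beta>) * real N)) * C < e / 3"
    unfolding eventually_sequentially by blast
  have p: "0 < p" using good_p_pos[OF g] by simp
  have "(\<lambda>n. psum p \<alpha> N (\<omega>s n)) \<longlonglongrightarrow> psum p \<alpha> N \<omega>"
    using nc p by (intro psum_tendsto) (auto simp: nice_conv_def)
  then obtain n0 where n0: "\<And>n. n0 \<le> n \<Longrightarrow> norm (psum p \<alpha> N (\<omega>s n) - psum p \<alpha> N \<omega>) < e / 3"
    using LIMSEQ_D[of _ _ "e / 3"] e by (metis divide_pos_pos zero_less_numeral)
  have L: "in_Lp E o\<^sub>0 p \<alpha> \<omega>" "\<And>n. in_Lp E o\<^sub>0 p \<alpha> (\<omega>s n)"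
    using nice_conv_Omega_t[OF nc] g by (auto simp: Omega_t_def)
  show "\<exists>no. \<forall>n\<ge>no. norm ((\<Sum>\<^sub>\<infinity>x. \<bar>\<omega>s n x\<bar> powr p * wt \<alpha> x) - (\<Sum>\<^sub>\<infinity>x. \<bar>\<omega> x\<bar> powr p * wt \<alpha> x)) < e"
  proof (intro exI[of _ n0] allI impI)
    fix n assume n: "n0 \<le> n"
    show "norm ((\<Sum>\<^sub>\<infinity>x. \<bar>\<omega>s n x\<bar> powr p * wt \<alpha> x) - (\<Sum>\<^sub>\<infinity>x. \<bar>\<omega> x\<bar> powr p * wt \<alpha> x)) < e"
      using n0[OF n] N e
        infsum_tail_bound[OF less_imp_le[OF \<beta>] C(1)[of _ n], where N=N]
        infsum_tail_bound[OF less_imp_le[OF \<beta>] C(2), where N=N]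
        psum_le_infsum[OF L(1), of N] psum_le_infsum[OF L(2)[of n], of N]
      unfolding real_norm_def by linarith
  qed
qed

text \<open>Induction over the generation of the topology leaves only the subbasic balls, where
  membership is decided by the limit of the norms.\<close>

lemma nice_conv_eventually_open:
  assumes nc: "nice_conv \<omega>s \<omega>" and U: "openin \<T>\<^sub>t U" "\<omega> \<in> U"
  shows "\<forall>\<^sub>F n in sequentially. \<omega>s n \<in> U"
proof -
  have "generate_topology_on (insert \<Omega>\<^sub>t {{\<eta> \<in> \<Omega>\<^sub>t. lp_norm E o\<^sub>0 p \<alpha> (\<eta> - \<zeta>) < \<epsilon>} |\<zeta> p \<alpha> \<epsilon>.
      \<zeta> \<in> \<Omega>\<^sub>t \<and> good p \<alpha> \<and> 0 < \<epsilon>}) U"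
    using U(1) unfolding Omega_t_top_def by (rule openin_topology_generated_by)
  then show ?thesis using U(2)
  proof induction
    case Empty then show ?case by simp
  next
    case (Int a b) then show ?case by (auto intro: eventually_conj simp: eventually_conj_iff)
  next
    case (UN K)
    then obtain k where "k \<in> K" "\<omega> \<in> k" by blast
    with UN.IH[of k] show ?case by (auto elim: eventually_mono)
  next
    case (Basis s)
    show ?case
    proof (cases "s = \<Omega>\<^sub>t")
      case True then show ?thesis using nice_conv_Omega_t[OF nc] by simp
    next
      case False
      with Basis obtain \<zeta> p \<alpha> \<epsilon> where s: "s = {\<eta> \<in> \<Omega>\<^sub>t. lp_norm E o\<^sub>0 p \<alpha> (\<eta> - \<zeta>) < \<epsilon>}"
        and \<zeta>: "\<zeta> \<in> \<Omega>\<^sub>t" and g: "good p \<alpha>" by auto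
      have "(\<lambda>n. lp_norm E o\<^sub>0 p \<alpha> (\<omega>s n - \<zeta>)) \<longlonglongrightarrow> lp_norm E o\<^sub>0 p \<alpha> (\<omega> - \<zeta>)"
        unfolding lp_norm_def
        by (intro tendsto_powr' nice_conv_infsum[OF nice_conv_diff[OF nc \<zeta>] g] tendsto_const disjI2)
          (use good_p_pos[OF g] in \<open>auto intro!: always_eventually infsum_nonneg psum_term_nonneg\<close>)
      moreover have "lp_norm E o\<^sub>0 p \<alpha> (\<omega> - \<zeta>) < \<epsilon>" using Basis.prems s by simp
      ultimately have "\<forall>\<^sub>F n in sequentially. lp_norm E o\<^sub>0 p \<alpha> (\<omega>s n - \<zeta>) < \<epsilon>"
        by (rule order_tendstoD(2))
      then show ?thesis unfolding s using nice_conv_Omega_t[OF nc] by (auto elim: eventually_mono)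
    qed
  qed
qed

lemma nice_conv_continuous:
  assumes nc: "nice_conv \<omega>s \<omega>" and f: "continuous_map \<T>\<^sub>t euclideanreal f"
  shows "(\<lambda>n. f (\<omega>s n)) \<longlonglongrightarrow> f \<omega>"
proof (rule topological_tendstoI)
  fix S :: "real set" assume "open S" "f \<omega> \<in> S"
  then have "openin \<T>\<^sub>t {x \<in> topspace \<T>\<^sub>t. f x \<in> S}"
    using f by (intro openin_continuous_map_preimage[OF f]) simp
  moreover have "\<omega> \<in> {x \<in> topspace \<T>\<^sub>t. f x \<in> S}"
    using \<open>f \<omega> \<in> S\<close> nice_conv_Omega_t[OF nc] by simp
  ultimately have "\<forall>\<^sub>F n in sequentially. \<omega>s n \<in> {x \<in> topspace \<T>\<^sub>t. f x \<in> S}"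
    by (rule nice_conv_eventually_open[OF nc])
  then show "\<forall>\<^sub>F n in sequentially. f (\<omega>s n) \<in> S"
    by (rule eventually_mono) simp
qed

subsection \<open>Approximation by cylinder functions\<close>

definition cut :: "nat \<Rightarrow> ('v \<Rightarrow> real) \<Rightarrow> ('v \<Rightarrow> real)" where
  "cut n \<omega> = (\<lambda>x. if x \<in> ballV n then \<omega> x else 0)"

lemma psum_cut_le:
  assumes "0 < p" shows "psum p \<alpha> m (cut n \<omega>) \<le> psum p \<alpha> m \<omega>" "psum p \<alpha> m (cut n \<omega>) \<le> psum p \<alpha> n \<omega>"
proof -
  show "psum p \<alpha> m (cut n \<omega>) \<le> psum p \<alpha> m \<omega>"
    unfolding psum_def cut_def using psum_term_nonneg[of \<omega>] by (intro sum_mono) auto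
  have "psum p \<alpha> m (cut n \<omega>) = (\<Sum>x\<in>ballV m \<inter> ballV n. \<bar>\<omega> x\<bar> powr p * wt \<alpha> x)"
    unfolding psum_def cut_def by (rule sum.mono_neutral_cong_right) (use finite_ballV in auto)
  also have "\<dots> \<le> psum p \<alpha> n \<omega>" by (rule finite_sum_le_psum) auto
  finally show "psum p \<alpha> m (cut n \<omega>) \<le> psum p \<alpha> n \<omega>" .
qed

lemma cut_in_Omega_t: "cut n \<omega> \<in> \<Omega>\<^sub>t"
  unfolding Omega_t_def in_Lp_iff using psum_cut_le(2) good_p_pos by blast

text \<open>Once cut, only finitely many coordinates vary, so convergence in the product topology
  already bounds every norm. Hence a function continuous on tempered configurations, composed with
  \<open>cut n\<close>, is continuous on the whole product space.\<close>

lemma nice_conv_cut_fixed: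
  assumes "\<omega>s \<longlonglongrightarrow> \<omega>" shows "nice_conv (\<lambda>k. cut n (\<omega>s k)) (cut n \<omega>)"
  unfolding nice_conv_def
proof (intro conjI allI impI)
  show "(\<lambda>k. cut n (\<omega>s k) x) \<longlonglongrightarrow> cut n \<omega> x" for x
    using tendsto_fun_coordinates[OF assms, of x] by (simp add: cut_def)
  fix p \<alpha> assume g: "good p \<alpha>"
  then have p: "0 < p" using good_p_pos by simp
  have "(\<lambda>k. psum p \<alpha> n (\<omega>s k)) \<longlonglongrightarrow> psum p \<alpha> n \<omega>"
    by (rule psum_tendsto[OF p tendsto_fun_coordinates[OF assms]])
  then have "Bseq (\<lambda>k. psum p \<alpha> n (\<omega>s k))" by (intro convergent_imp_Bseq convergentI)
  then obtain C where C: "\<And>k. norm (psum p \<alpha> n (\<omega>s k)) \<le> C" unfolding Bseq_def by blast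
  have "psum p \<alpha> m (cut n (\<omega>s k)) \<le> C" for k m
    using psum_cut_le(2)[OF p, of \<alpha> m n "\<omega>s k"] C[of k] by simp
  then show "\<exists>C. \<forall>k m. psum p \<alpha> m (cut n (\<omega>s k)) \<le> C" by blast
qed

lemma cut_tendsto:
  fixes \<nu> :: "nat \<Rightarrow> nat"
  assumes "filterlim \<nu> at_top sequentially" "(\<lambda>k. \<omega>s k x) \<longlonglongrightarrow> \<omega> x"
  shows "(\<lambda>k. cut (\<nu> k) (\<omega>s k) x) \<longlonglongrightarrow> \<omega> x"
  using assms(2)
proof (rule Lim_transform_eventually)
  have "\<forall>\<^sub>F k in sequentially. gdist E o\<^sub>0 x \<le> \<nu> k"
    using assms(1) unfolding filterlim_at_top by blast
  then show "\<forall>\<^sub>F k in sequentially. \<omega>s k x = cut (\<nu> k) (\<omega>s k) x"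
    by eventually_elim (simp add: cut_def ballV_def)
qed

lemma nice_conv_cut:
  assumes "\<omega> \<in> \<Omega>\<^sub>t" shows "nice_conv (\<lambda>n. cut n \<omega>) \<omega>"
  unfolding nice_conv_def
proof (intro conjI allI impI)
  show "(\<lambda>k. cut k \<omega> x) \<longlonglongrightarrow> \<omega> x" for x
    by (rule cut_tendsto) (auto intro: filterlim_ident)
  fix p \<alpha> assume g: "good p \<alpha>"
  then have "in_Lp E o\<^sub>0 p \<alpha> \<omega>" using assms by (auto simp: Omega_t_def)
  then obtain C where C: "\<forall>m. psum p \<alpha> m \<omega> \<le> C" unfolding in_Lp_iff ..
  have "psum p \<alpha> m (cut n \<omega>) \<le> C" for n m
    using psum_cut_le(1)[of p \<alpha> m n \<omega>] good_p_pos[OF g] C by (meson order_trans)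
  then show "\<exists>C. \<forall>n m. psum p \<alpha> m (cut n \<omega>) \<le> C" by blast
qed

lemma fcyl_meas_cut:
  assumes f: "continuous_map \<T>\<^sub>t euclideanreal f"
  shows "fcyl_meas (\<lambda>\<omega>. f (cut n \<omega>))"
proof (rule fcyl_measI[OF _ finite_ballV[of n]])
  have "continuous_on UNIV (\<lambda>\<omega>. f (cut n \<omega>))"
    by (rule continuous_on_sequentiallyI) (rule nice_conv_continuous[OF nice_conv_cut_fixed f])
  then show "(\<lambda>\<omega>. f (cut n \<omega>)) \<in> borel_measurable borel"
    by (rule borel_measurable_continuous_onI)
  show "f (cut n \<omega>) = f (cut n \<eta>)" if "\<And>x. x \<in> ballV n \<Longrightarrow> \<omega> x = \<eta> x" for \<omega> \<eta>
  proof -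
    have "cut n \<omega> = cut n \<eta>" using that by (auto simp: cut_def)
    then show ?thesis by simp
  qed
qed

text \<open>Continuity for the finer topology still gives Borel measurability for the product
  topology, since on tempered configurations \<open>f\<close> is the pointwise limit of the
  functions \<open>f (cut n \<omega>)\<close>.\<close>

lemma measurable_on_Omega_t:
  assumes f: "continuous_map \<T>\<^sub>t euclideanreal f"
  shows "(\<lambda>\<omega>. indicator \<Omega>\<^sub>t \<omega> * f \<omega>) \<in> borel_measurable borel"
proof (rule borel_measurable_LIMSEQ_real)
  show "(\<lambda>n. indicator \<Omega>\<^sub>t \<omega> * f (cut n \<omega>)) \<longlonglongrightarrow> indicator \<Omega>\<^sub>t \<omega> * f \<omega>" for \<omega>
    using nice_conv_continuous[OF nice_conv_cut f, of \<omega>] by (cases "\<omega> \<in> \<Omega>\<^sub>t") auto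
  show "(\<lambda>\<omega>. indicator \<Omega>\<^sub>t \<omega> * f (cut n \<omega>)) \<in> borel_measurable borel" for n
  proof -
    have [measurable]: "(\<lambda>\<omega>. f (cut n \<omega>)) \<in> borel_measurable borel"
      using fcyl_meas_cut[OF f] by (simp add: fcyl_meas_def)
    show ?thesis by measurable
  qed
qed

text \<open>Boundedness for the cofinal family gives boundedness in all admissible norms. These sets
  play the part of compact ones: sequences in them have nicely convergent subsequences.\<close>

definition Kset :: "(nat \<Rightarrow> real) \<Rightarrow> ('v \<Rightarrow> real) set" where
  "Kset c = {\<omega>. \<forall>k m. psum (pk k) (\<alpha>k k) m \<omega> \<le> c k}"

lemma Kset_bounds:
  assumes "good p \<alpha>" obtains C where "\<And>\<omega> m. \<omega> \<in> Kset c \<Longrightarrow> psum p \<alpha> m \<omega> \<le> C"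
proof -
  obtain k D where "0 \<le> D" and D: "\<And>n \<omega>. psum p \<alpha> n \<omega> \<le> D + psum (pk k) (\<alpha>k k) n \<omega>"
    using psum_dominated[OF assms] by metis
  have "psum p \<alpha> m \<omega> \<le> D + c k" if "\<omega> \<in> Kset c" for \<omega> m
  proof -
    have "psum (pk k) (\<alpha>k k) m \<omega> \<le> c k" using that by (auto simp: Kset_def)
    then show ?thesis using D[of m \<omega>] by linarith
  qed
  then show thesis using that by blast
qed

lemma Kset_measurable [measurable]: "Kset c \<in> sets borel"
proof -
  have "Kset c = (\<Inter>k. \<Inter>m. {\<omega> \<in> space borel. psum (pk k) (\<alpha>k k) m \<omega> \<le> c k})" by (auto simp: Kset_def)
  also have "\<dots> \<in> sets borel" by measurable
  finally show ?thesis .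
qed

lemma Kset_subset: "Kset c \<subseteq> \<Omega>\<^sub>t"
proof
  fix \<omega> assume "\<omega> \<in> Kset c"
  then show "\<omega> \<in> \<Omega>\<^sub>t" unfolding Omega_t_iff in_Lp_iff Kset_def by blast
qed

text \<open>A compactness argument by contradiction: along a subsequence the bad configurations
  converge pointwise, and both they and their cuts, having bounded norms and growing radii, converge
  nicely to the same limit, where continuity of \<open>f\<close> forbids a gap of size
  \<open>e\<close>.\<close>

lemma uniform_cut_approx:
  assumes f: "continuous_map \<T>\<^sub>t euclideanreal f" and e: "0 < e"
  obtains N where "\<And>n \<omega>. N \<le> n \<Longrightarrow> \<omega> \<in> Kset c \<Longrightarrow> \<bar>f (cut n \<omega>) - f \<omega>\<bar> \<le> e"
proof (rule ccontr)
  assume "\<not> thesis"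
  have "\<exists>n \<omega>. N \<le> n \<and> \<omega> \<in> Kset c \<and> e < \<bar>f (cut n \<omega>) - f \<omega>\<bar>" for N
  proof (rule ccontr)
    assume "\<nexists>n \<omega>. N \<le> n \<and> \<omega> \<in> Kset c \<and> e < \<bar>f (cut n \<omega>) - f \<omega>\<bar>"
    then have "\<bar>f (cut n \<omega>) - f \<omega>\<bar> \<le> e" if "N \<le> n" "\<omega> \<in> Kset c" for n \<omega>
      using that not_le by blast
    with \<open>\<not> thesis\<close> that show False by blast
  qed
  then have "\<forall>N. \<exists>n \<omega>. N \<le> n \<and> \<omega> \<in> Kset c \<and> e < \<bar>f (cut n \<omega>) - f \<omega>\<bar>" ..
  then obtain \<nu> \<omega>s where "\<forall>N. N \<le> \<nu> N \<and> \<omega>s N \<in> Kset c \<and> e < \<bar>f (cut (\<nu> N) (\<omega>s N)) - f (\<omega>s N)\<bar>"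
    unfolding choice_iff by (elim exE)
  then have \<nu>: "\<And>N. N \<le> \<nu> N" and \<omega>s: "\<And>N. \<omega>s N \<in> Kset c"
    and far: "\<And>N. e < \<bar>f (cut (\<nu> N) (\<omega>s N)) - f (\<omega>s N)\<bar>" by simp_all
  \<comment> \<open>The bound with index 0 alone confines each coordinate to an interval, which puts
    the sequence into a compact product.\<close>
  define R where "R x = (c 0 / wt (\<alpha>k 0) x) powr (1 / pk 0)" for x
  have p0: "0 < pk 0" using good_p_pos[OF good_k[of 0]] by simp
  have "\<bar>\<omega>s N x\<bar> \<le> R x" for N x
  proof -
    have "\<bar>\<omega>s N x\<bar> powr pk 0 * wt (\<alpha>k 0) x \<le> psum (pk 0) (\<alpha>k 0) (gdist E o\<^sub>0 x) (\<omega>s N)"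
      using finite_sum_le_psum[of "{x}" "gdist E o\<^sub>0 x" "\<omega>s N"] in_ballV by auto
    also have "\<dots> \<le> c 0" using \<omega>s[of N] by (auto simp: Kset_def)
    finally have "\<bar>\<omega>s N x\<bar> powr pk 0 \<le> c 0 / wt (\<alpha>k 0) x"
      using wt_pos[of "\<alpha>k 0" x] by (simp add: pos_le_divide_eq)
    then have "(\<bar>\<omega>s N x\<bar> powr pk 0) powr (1 / pk 0) \<le> R x"
      unfolding R_def using p0 by (intro powr_mono2) auto
    then show ?thesis using p0 by (simp add: powr_powr)
  qed
  then have "\<forall>N. \<omega>s N \<in> {\<omega>. \<forall>x. \<omega> x \<in> {- R x..R x}}" by (auto simp: abs_le_iff minus_le_iff)
  from seq_compactE[OF compact_imp_seq_compact[OF compact_Pi_Icc] this]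
  obtain \<omega> s where "\<omega> \<in> {\<omega>. \<forall>x. \<omega> x \<in> {- R x..R x}}"
    and s: "strict_mono (s :: nat \<Rightarrow> nat)" and lim: "(\<omega>s \<circ> s) \<longlonglongrightarrow> \<omega>" .
  have pt: "(\<lambda>k. \<omega>s (s k) x) \<longlonglongrightarrow> \<omega> x" for x
    using tendsto_fun_coordinates[OF lim, of x] by simp
  have "nice_conv (\<lambda>k. \<omega>s (s k)) \<omega>"
    unfolding nice_conv_def
  proof (intro conjI allI impI pt)
    fix p \<alpha> assume "good p \<alpha>"
    then show "\<exists>C. \<forall>n m. psum p \<alpha> m (\<omega>s (s n)) \<le> C" using Kset_bounds[of p \<alpha> c] \<omega>s by metis
  qed
  from nice_conv_continuous[OF this f] have l1: "(\<lambda>k. f (\<omega>s (s k))) \<longlonglongrightarrow> f \<omega>" .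
  have "nice_conv (\<lambda>k. cut (\<nu> (s k)) (\<omega>s (s k))) \<omega>"
    unfolding nice_conv_def
  proof (intro conjI allI impI)
    have "filterlim (\<lambda>k. \<nu> (s k)) at_top sequentially"
      unfolding filterlim_at_top_ge[of _ _ 0]
    proof (intro allI impI)
      fix Z :: nat
      have "\<forall>\<^sub>F k in sequentially. Z \<le> k" by (rule eventually_ge_at_top)
      then show "\<forall>\<^sub>F k in sequentially. Z \<le> \<nu> (s k)"
        by eventually_elim (meson \<nu> s order_trans seq_suble)
    qed
    then show "(\<lambda>k. cut (\<nu> (s k)) (\<omega>s (s k)) x) \<longlonglongrightarrow> \<omega> x" for x
      by (rule cut_tendsto[OF _ pt])
    fix p \<alpha> assume g: "good p \<alpha>"
    obtain C where C: "\<And>\<omega> m. \<omega> \<in> Kset c \<Longrightarrow> psum p \<alpha> m \<omega> \<le> C" using Kset_bounds[OF g, of c] by metis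
    have "psum p \<alpha> m (cut (\<nu> (s n)) (\<omega>s (s n))) \<le> C" for n m
      using psum_cut_le(1)[of p] good_p_pos[OF g] C[OF \<omega>s] by (meson order_trans)
    then show "\<exists>C. \<forall>n m. psum p \<alpha> m (cut (\<nu> (s n)) (\<omega>s (s n))) \<le> C" by blast
  qed
  from nice_conv_continuous[OF this f] have l2: "(\<lambda>k. f (cut (\<nu> (s k)) (\<omega>s (s k)))) \<longlonglongrightarrow> f \<omega>" .
  have "(\<lambda>k. \<bar>f (cut (\<nu> (s k)) (\<omega>s (s k))) - f (\<omega>s (s k))\<bar>) \<longlonglongrightarrow> \<bar>f \<omega> - f \<omega>\<bar>"
    by (intro tendsto_rabs tendsto_diff l1 l2)
  then have "e \<le> \<bar>f \<omega> - f \<omega>\<bar>"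
    by (rule tendsto_lowerbound) (use far in \<open>auto intro!: always_eventually less_imp_le\<close>)
  then show False using e by simp
qed

text \<open>By Markov's inequality the k-th norm exceeds its bound with probability at most
  \<open>e / 2^(k + 1)\<close>, and these sum to \<open>e\<close>; the added 1 keeps the bound
  positive.\<close>

definition Kbound :: "real \<Rightarrow> nat \<Rightarrow> real" where
  "Kbound e k = (Kmom (pk k) (\<alpha>k k) + 1) * 2 ^ Suc k / e"

lemma tightness:
  assumes mu: "sets \<mu> = sets borel" "prob_space \<mu>" and e: "0 < e"
    and mom: "\<And>k m. (\<integral>\<^sup>+\<omega>. ennreal (psum (pk k) (\<alpha>k k) m \<omega>) \<partial>\<mu>) \<le> ennreal (Kmom (pk k) (\<alpha>k k))"
  shows "measure \<mu> (- Kset (Kbound e)) \<le> e"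
proof -
  interpret prob_space \<mu> by fact
  note [measurable_cong] = mu(1)
  let ?c = "Kbound e" and ?K = "\<lambda>k. Kmom (pk k) (\<alpha>k k)"
  \<comment> \<open>Taking the supremum over the balls first lets one Markov inequality per
    \<open>k\<close> control all radii simultaneously.\<close>
  let ?S = "\<lambda>k \<omega>. SUP m. ennreal (psum (pk k) (\<alpha>k k) m \<omega>)"
  have K0: "0 \<le> ?K k" for k by (rule Kmom(1)[OF good_k])
  have c0: "0 < ?c k" for k unfolding Kbound_def using K0[of k] e
      by (intro divide_pos_pos mult_pos_pos) auto
  have ind: "indicator (- Kset ?c) \<omega> \<le> (\<Sum>k. ennreal (1 / ?c k) * ?S k \<omega>)" for \<omega>
  proof (cases "\<omega> \<in> Kset ?c")
    case False
    then obtain k m where km: "?c k < psum (pk k) (\<alpha>k k) m \<omega>" by (auto simp: Kset_def not_le)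
    have "1 \<le> ennreal (1 / ?c k) * ennreal (psum (pk k) (\<alpha>k k) m \<omega>)"
      using km c0[of k] psum_nonneg[of "pk k" "\<alpha>k k" m \<omega>] by (simp flip: ennreal_mult)
    also have "\<dots> \<le> ennreal (1 / ?c k) * ?S k \<omega>"
      by (intro mult_left_mono SUP_upper) auto
    also have "\<dots> \<le> (\<Sum>k. ennreal (1 / ?c k) * ?S k \<omega>)"
      using sum_le_suminf[of "\<lambda>k. ennreal (1 / ?c k) * ?S k \<omega>" "{k}"] by simp
    finally show ?thesis using False by simp
  qed simp
  have Sle: "(\<integral>\<^sup>+\<omega>. ?S k \<omega> \<partial>\<mu>) \<le> ennreal (?K k)" for k
  proof -
    have "(\<integral>\<^sup>+\<omega>. ?S k \<omega> \<partial>\<mu>) = (SUP m. \<integral>\<^sup>+\<omega>. ennreal (psum (pk k) (\<alpha>k k) m \<omega>) \<partial>\<mu>)"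
      by (rule nn_integral_monotone_convergence_SUP) (auto intro!: incseq_SucI le_funI ennreal_leI psum_mono)
    also have "\<dots> \<le> ennreal (?K k)" by (intro SUP_least mom)
    finally show ?thesis .
  qed
  have sp: "space \<mu> = UNIV" using sets_eq_imp_space_eq[OF mu(1)] by simp
  have Kc: "- Kset ?c \<in> sets \<mu>"
    using sets.compl_sets[OF Kset_measurable[of ?c]] mu(1) by (simp add: Compl_eq_Diff_UNIV)
  have "emeasure \<mu> (- Kset ?c) = (\<integral>\<^sup>+\<omega>. indicator (- Kset ?c) \<omega> \<partial>\<mu>)"
    using Kc by simp
  also have "\<dots> \<le> (\<integral>\<^sup>+\<omega>. (\<Sum>k. ennreal (1 / ?c k) * ?S k \<omega>) \<partial>\<mu>)"
    by (rule nn_integral_mono) (rule ind)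
  also have "\<dots> = (\<Sum>k. \<integral>\<^sup>+\<omega>. ennreal (1 / ?c k) * ?S k \<omega> \<partial>\<mu>)"
    by (rule nn_integral_suminf) measurable
  also have "\<dots> = (\<Sum>k. ennreal (1 / ?c k) * (\<integral>\<^sup>+\<omega>. ?S k \<omega> \<partial>\<mu>))"
    by (subst nn_integral_cmult) auto
  also have "\<dots> \<le> (\<Sum>k. ennreal (e * (1/2) ^ Suc k))"
  proof (rule suminf_le)
    fix k
    have "ennreal (1 / ?c k) * (\<integral>\<^sup>+\<omega>. ?S k \<omega> \<partial>\<mu>) \<le> ennreal (1 / ?c k) * ennreal (?K k)"
      by (intro mult_left_mono Sle) auto
    also have "\<dots> = ennreal (?K k / ?c k)" using K0[of k] c0[of k] by (simp flip: ennreal_mult)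
    also have "\<dots> \<le> ennreal (e * (1/2) ^ Suc k)"
    proof (rule ennreal_leI)
      have "?K k / ?c k \<le> (?K k + 1) / ?c k" using c0[of k] by (intro divide_right_mono) auto
      also have "\<dots> = e * (1/2) ^ Suc k"
        unfolding Kbound_def using K0[of k] e by (simp add: field_simps power_divide add_nonneg_eq_0_iff)
      finally show "?K k / ?c k \<le> e * (1/2) ^ Suc k" .
    qed
    finally show "ennreal (1 / ?c k) * (\<integral>\<^sup>+\<omega>. ?S k \<omega> \<partial>\<mu>) \<le> ennreal (e * (1/2) ^ Suc k)" .
  qed auto
  also have "\<dots> = ennreal e"
  proof -
    have "(\<lambda>k. e * (1/2) ^ Suc k) sums (e * 1)" by (intro sums_mult power_half_series)
    then show ?thesis using e by (subst suminf_ennreal2) (auto simp: sums_iff)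
  qed
  finally show ?thesis using e by (simp add: emeasure_eq_measure)
qed

subsection \<open>Encoding measures by their values on cylinder sets\<close>

definition prob_borel :: "('v \<Rightarrow> real) measure set" where
  "prob_borel = {\<mu>. sets \<mu> = sets borel \<and> prob_space \<mu>}"

definition tempered_Gibbs :: "('v \<Rightarrow> real) measure set" where
  "tempered_Gibbs = {\<mu> \<in> Gibbs E W V. emeasure \<mu> \<Omega>\<^sub>t = 1}"

text \<open>Turns measures into points of a product of real lines, whose topology is convergence on
  cylinder events; the value 0 elsewhere imposes nothing on other events.\<close>

definition enc :: "('v \<Rightarrow> real) measure \<Rightarrow> ('v \<Rightarrow> real) set \<Rightarrow> real" where
  "enc \<mu> A = (if A \<in> fcyl then measure \<mu> A else 0)"

abbreviation "dec \<equiv> inv_into prob_borel enc"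

lemma inj_on_enc: "inj_on enc prob_borel"
proof (rule inj_onI)
  fix \<mu> \<nu> :: "('v \<Rightarrow> real) measure" assume m: "\<mu> \<in> prob_borel" "\<nu> \<in> prob_borel" and eq: "enc \<mu> = enc \<nu>"
  have "emeasure \<mu> A = emeasure \<nu> A" if "A \<in> fcyl" for A
    using fun_cong[OF eq, of A] that m
    by (simp add: enc_def prob_borel_def finite_measure.emeasure_eq_measure prob_space.finite_measure)
  then show "\<mu> = \<nu>" using m by (intro measure_eqI_fcyl) (auto simp: prob_borel_def)
qed

lemma dec_enc [simp]: "\<mu> \<in> prob_borel \<Longrightarrow> dec (enc \<mu>) = \<mu>"
  by (rule inv_into_f_f[OF inj_on_enc])

lemma tempered_Gibbs_prob: "\<mu> \<in> tempered_Gibbs \<Longrightarrow> \<mu> \<in> prob_borel"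
  by (simp add: tempered_Gibbs_def prob_borel_def Gibbs_iff)

lemma tempered_Gibbs_moment:
  assumes \<mu>: "\<mu> \<in> tempered_Gibbs" and g: "good p \<alpha>"
  shows "(\<integral>\<^sup>+\<omega>. ennreal (psum p \<alpha> m \<omega>) \<partial>\<mu>) \<le> ennreal (Kmom p \<alpha>)"
proof (rule Gibbs_moment[OF g])
  show "\<mu> \<in> Gibbs E W V" using \<mu> by (simp add: tempered_Gibbs_def)
  have m: "sets \<mu> = sets borel" "prob_space \<mu>" using tempered_Gibbs_prob[OF \<mu>]
      by (auto simp: prob_borel_def)
  have "measure \<mu> \<Omega>\<^sub>t = 1" using \<mu> by (simp add: tempered_Gibbs_def measure_def)
  then have "AE \<omega> in \<mu>. \<omega> \<in> \<Omega>\<^sub>t"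
    using prob_space.AE_in_set_eq_1[OF m(2)] m(1) by simp
  then show "AE \<omega> in \<mu>. in_Lp E o\<^sub>0 p \<alpha> \<omega>"
    by eventually_elim (use g in \<open>auto simp: Omega_t_def\<close>)
qed

text \<open>Tychonoff's theorem supplies a cluster point among set functions with values in the unit
  interval; it is then shown to encode a tempered Gibbs measure, so no limit leaves the range of the
  encoding.\<close>

lemma cluster_point_enc:
  assumes F: "F \<noteq> bot"
    and P: "\<forall>\<^sub>F \<phi> in F. \<phi> \<in> enc ` prob_borel"
    and dlr: "\<And>\<Lambda> A. finite \<Lambda> \<Longrightarrow> \<Lambda> \<noteq> {} \<Longrightarrow> A \<in> fcyl \<Longrightarrow>
      \<forall>\<^sub>F \<phi> in F. emeasure (dec \<phi>) A = (\<integral>\<^sup>+\<xi>. emeasure (ker \<Lambda> \<xi>) A \<partial>dec \<phi>)"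
    and mom: "\<And>p \<alpha> m. good p \<alpha> \<Longrightarrow>
      \<forall>\<^sub>F \<phi> in F. (\<integral>\<^sup>+\<omega>. ennreal (psum p \<alpha> m \<omega>) \<partial>dec \<phi>) \<le> ennreal (Kmom p \<alpha>)"
  obtains \<mu> where "\<mu> \<in> tempered_Gibbs" "inf (nhds (enc \<mu>)) F \<noteq> bot"
proof -
  let ?U = "{\<phi>::('v \<Rightarrow> real) set \<Rightarrow> real. \<forall>A. \<phi> A \<in> {0..1}}"
  have "\<forall>\<^sub>F \<phi> in F. \<phi> \<in> ?U"
    using P
  proof eventually_elim
    case (elim \<phi>)
    then obtain \<mu> where "\<mu> \<in> prob_borel" "\<phi> = enc \<mu>" by auto
    then show ?case by (auto simp: enc_def prob_borel_def prob_space.prob_le_1)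
  qed
  then obtain \<psi> where \<psi>: "inf (nhds \<psi>) F \<noteq> bot"
    using compact_Pi_Icc[of "\<lambda>_. 0" "\<lambda>_. 1", unfolded compact_filter] F by blast
  \<comment> \<open>Along this refined filter the cluster point becomes a limit, while everything
    eventual along \<open>F\<close> remains so.\<close>
  define G where "G = inf (nhds \<psi>) F"
  have GF: "G \<le> F" and GN: "G \<le> nhds \<psi>" and Gb: "G \<noteq> bot" using \<psi> by (auto simp: G_def)
  note evG = filter_leD[OF GF]
  have lim: "((\<lambda>\<phi>. \<phi> A) \<longlongrightarrow> \<psi> A) G" for A
    by (rule tendsto_fun_coordinates) (use GN in \<open>simp add: filterlim_def filtermap_ident\<close>)
  have dec: "\<forall>\<^sub>F \<phi> in G. dec \<phi> \<in> prob_borel \<and> enc (dec \<phi>) = \<phi>"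
    using evG[OF P] by eventually_elim auto
  obtain \<mu> where mu: "\<mu> \<in> Gibbs E W V" "emeasure \<mu> \<Omega>\<^sub>t = 1" "\<And>A. A \<in> fcyl \<Longrightarrow> measure \<mu> A = \<psi> A"
  proof (rule cluster_point_Gibbs[of G dec \<psi>])
    show "G \<noteq> bot" by (rule Gb)
    show "\<forall>\<^sub>F \<phi> in G. sets (dec \<phi>) = sets borel \<and> prob_space (dec \<phi>)"
      using dec by eventually_elim (auto simp: prob_borel_def)
    show "((\<lambda>\<phi>. measure (dec \<phi>) A) \<longlongrightarrow> \<psi> A) G" if A: "A \<in> fcyl" for A
      using lim[of A]
    proof (rule Lim_transform_eventually)
      show "\<forall>\<^sub>F \<phi> in G. \<phi> A = measure (dec \<phi>) A"
        using dec
      proof eventually_elim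
        case (elim \<phi>)
        then have "\<phi> A = enc (dec \<phi>) A" by simp
        also have "\<dots> = measure (dec \<phi>) A" using A by (simp add: enc_def)
        finally show ?case .
      qed
    qed
  qed (use dlr mom evG in auto)
  have "enc \<mu> = \<psi>"
  proof
    fix A show "enc \<mu> A = \<psi> A"
    proof (cases "A \<in> fcyl")
      case False
      have "((\<lambda>\<phi>. \<phi> A) \<longlongrightarrow> 0) G"
      proof (rule tendsto_eventually)
        show "\<forall>\<^sub>F \<phi> in G. \<phi> A = 0"
          using evG[OF P] by eventually_elim (use False in \<open>auto simp: enc_def\<close>)
      qed
      then show ?thesis using tendsto_unique[OF Gb lim[of A]] False by (simp add: enc_def)
    qed (simp add: enc_def mu(3))
  qed
  then show thesis using that[of \<mu>] mu \<psi> by (simp add: tempered_Gibbs_def)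
qed

lemma compact_enc_tempered_Gibbs: "compact (enc ` tempered_Gibbs)"
  unfolding compact_filter
proof (intro allI impI)
  fix F assume F: "F \<noteq> bot" and ev: "\<forall>\<^sub>F \<phi> in F. \<phi> \<in> enc ` tempered_Gibbs"
  have dec: "\<forall>\<^sub>F \<phi> in F. dec \<phi> \<in> tempered_Gibbs \<and> \<phi> \<in> enc ` prob_borel"
    using ev by eventually_elim (auto simp: tempered_Gibbs_prob)
  obtain \<mu> where "\<mu> \<in> tempered_Gibbs" "inf (nhds (enc \<mu>)) F \<noteq> bot"
  proof (rule cluster_point_enc[OF F])
    show "\<forall>\<^sub>F \<phi> in F. \<phi> \<in> enc ` prob_borel" using dec by eventually_elim simp
    show "\<forall>\<^sub>F \<phi> in F. emeasure (dec \<phi>) A = (\<integral>\<^sup>+\<xi>. emeasure (ker \<Lambda> \<xi>) A \<partial>dec \<phi>)"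
      if "finite \<Lambda>" "\<Lambda> \<noteq> {}" "A \<in> fcyl" for \<Lambda> A
      using dec
    proof eventually_elim
      case (elim \<phi>)
      then have "dec \<phi> \<in> Gibbs E W V" by (simp add: tempered_Gibbs_def)
      then show ?case using that fcyl_sets[OF that(3)] unfolding Gibbs_iff by simp
    qed
    show "\<forall>\<^sub>F \<phi> in F. (\<integral>\<^sup>+\<omega>. ennreal (psum p \<alpha> m \<omega>) \<partial>dec \<phi>) \<le> ennreal (Kmom p \<alpha>)" if "good p \<alpha>" for p \<alpha> m
      using dec by eventually_elim (use tempered_Gibbs_moment that in blast)
  qed
  then show "\<exists>\<phi>\<in>enc ` tempered_Gibbs. inf (nhds \<phi>) F \<noteq> bot" by blast
qed

text \<open>Zero boundary values annihilate the boundary term of the moment bound, leaving exactly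
  the constant \<open>Kmom\<close>; consistency gives the Gibbs equation for
  \<open>\<Lambda>\<close> in every ball containing it.\<close>

lemma tempered_Gibbs_nonempty: "tempered_Gibbs \<noteq> {}"
proof -
  let ?k = "\<lambda>n. ker (ballV n) (\<lambda>_. 0)"
  have k: "?k n \<in> prob_borel" for n
    by (simp add: prob_borel_def prob_space_ker[OF finite_ballV])
  define F where "F = filtermap (\<lambda>n. enc (?k n)) sequentially"
  have F: "F \<noteq> bot" by (simp add: F_def filtermap_bot_iff)
  obtain \<mu> where "\<mu> \<in> tempered_Gibbs" "inf (nhds (enc \<mu>)) F \<noteq> bot"
  proof (rule cluster_point_enc[OF F])
    show "\<forall>\<^sub>F \<phi> in F. \<phi> \<in> enc ` prob_borel"
      using k by (auto simp: F_def eventually_filtermap)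
    show "\<forall>\<^sub>F \<phi> in F. emeasure (dec \<phi>) A = (\<integral>\<^sup>+\<xi>. emeasure (ker \<Lambda> \<xi>) A \<partial>dec \<phi>)"
      if L: "finite \<Lambda>" and A: "A \<in> fcyl" for \<Lambda> A
    proof -
      obtain n0 where n0: "\<Lambda> \<subseteq> ballV n0" using finite_subset_ballV[OF L] .
      have "emeasure (?k n) A = (\<integral>\<^sup>+\<xi>. emeasure (ker \<Lambda> \<xi>) A \<partial>?k n)" if "n0 \<le> n" for n
        using ker_consistent[OF finite_ballV,
            of \<Lambda> n "indicator A" "\<lambda>_. 0"] n0 ballV_mono[OF that] fcyl_sets[OF A]
        by (simp add: subset_trans)
      then show ?thesis
        by (auto simp: F_def eventually_filtermap eventually_sequentially k)
    qed
    show "\<forall>\<^sub>F \<phi> in F. (\<integral>\<^sup>+\<omega>. ennreal (psum p \<alpha> m \<omega>) \<partial>dec \<phi>) \<le> ennreal (Kmom p \<alpha>)" if g: "good p \<alpha>" for p \<alpha> m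
    proof -
      have "(\<integral>\<^sup>+\<omega>. ennreal (psum p \<alpha> m \<omega>) \<partial>?k n) \<le> ennreal (Kmom p \<alpha>)" if "m \<le> n" for n
        using ker_ball_moment[OF g that, of "\<lambda>_. 0"] good_p_pos[OF g] by simp
      then show ?thesis
        by (auto simp: F_def eventually_filtermap eventually_sequentially k)
    qed
  qed
  then show ?thesis by auto
qed

subsection \<open>Continuity of integrals\<close>

text \<open>The integrands differ by at most \<open>e\<close> on the tight set and by at most
  \<open>2 * B\<close> off it, where every tempered Gibbs measure has mass at most \<open>e\<close>.
  The bound is thus uniform in \<open>\<mu>\<close>.\<close>

lemma integral_cut_approx:
  assumes \<mu>: "\<mu> \<in> tempered_Gibbs" and f: "continuous_map \<T>\<^sub>t euclideanreal f"
    and B: "\<And>\<omega>. \<omega> \<in> \<Omega>\<^sub>t \<Longrightarrow> \<bar>f \<omega>\<bar> \<le> B" and e: "0 < e"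
    and n: "\<And>\<omega>. \<omega> \<in> Kset (Kbound e) \<Longrightarrow> \<bar>f (cut n \<omega>) - f \<omega>\<bar> \<le> e"
  shows "\<bar>(\<integral>\<omega>. f (cut n \<omega>) \<partial>\<mu>) - (\<integral>\<omega>. f \<omega> \<partial>restrict_space \<mu> \<Omega>\<^sub>t)\<bar> \<le> e + 2 * B * e"
proof -
  have m: "sets \<mu> = sets borel" "prob_space \<mu>" using tempered_Gibbs_prob[OF \<mu>]
      by (auto simp: prob_borel_def)
  interpret prob_space \<mu> by (rule m(2))
  note [measurable_cong] = m(1)
  have B0: "0 \<le> B" using B[OF cut_in_Omega_t[of 0 "\<lambda>_. 0"]] by linarith
  let ?g = "\<lambda>\<omega>. f (cut n \<omega>)" and ?h = "\<lambda>\<omega>. indicator \<Omega>\<^sub>t \<omega> * f \<omega>" and ?K = "Kset (Kbound e)"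
  have [measurable]: "?g \<in> borel_measurable borel" using fcyl_meas_cut[OF f] by (simp add: fcyl_meas_def)
  have [measurable]: "?h \<in> borel_measurable borel" by (rule measurable_on_Omega_t[OF f])
  have Kc[measurable]: "- ?K \<in> sets borel"
    using sets.compl_sets[OF Kset_measurable[of "Kbound e"]] by (simp add: Compl_eq_Diff_UNIV)
  have gi: "integrable \<mu> ?g"
    by (rule integrable_const_bound[of _ B]) (use B[OF cut_in_Omega_t] in auto)
  have hB: "\<bar>?h \<omega>\<bar> \<le> B" for \<omega> using B[of \<omega>] B0 by (cases "\<omega> \<in> \<Omega>\<^sub>t") auto
  have hi: "integrable \<mu> ?h"
    by (rule integrable_const_bound[of _ B]) (use hB in auto)
  have ki: "integrable \<mu> (\<lambda>\<omega>. e + 2 * B * indicator (- ?K) \<omega>)"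
    by (rule integrable_const_bound[of _ "e + 2 * B"]) (use e B0 in \<open>auto split: split_indicator\<close>)
  have pt: "\<bar>?g \<omega> - ?h \<omega>\<bar> \<le> e + 2 * B * indicator (- ?K) \<omega>" for \<omega>
  proof (cases "\<omega> \<in> ?K")
    case True
    then have "\<omega> \<in> \<Omega>\<^sub>t" using Kset_subset by blast
    then show ?thesis using n[OF True] True by simp
  next
    case False
    have "\<bar>?g \<omega>\<bar> \<le> B" by (rule B[OF cut_in_Omega_t])
    then show ?thesis using hB[of \<omega>] e False by simp
  qed
  have "\<Omega>\<^sub>t \<inter> space \<mu> \<in> sets \<mu>" using m(1) by (intro sets.Int) auto
  then have "(\<integral>\<omega>. f \<omega> \<partial>restrict_space \<mu> \<Omega>\<^sub>t) = (\<integral>\<omega>. ?h \<omega> \<partial>\<mu>)"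
    by (subst integral_restrict_space) auto
  then have "\<bar>(\<integral>\<omega>. f (cut n \<omega>) \<partial>\<mu>) - (\<integral>\<omega>. f \<omega> \<partial>restrict_space \<mu> \<Omega>\<^sub>t)\<bar> = \<bar>\<integral>\<omega>. ?g \<omega> - ?h \<omega> \<partial>\<mu>\<bar>"
    using gi hi by simp
  also have "\<dots> \<le> (\<integral>\<omega>. \<bar>?g \<omega> - ?h \<omega>\<bar> \<partial>\<mu>)" by (rule integral_abs_bound)
  also have "\<dots> \<le> (\<integral>\<omega>. e + 2 * B * indicator (- ?K) \<omega> \<partial>\<mu>)"
    using gi hi ki pt by (intro integral_mono) auto
  also have "\<dots> = e + 2 * B * measure \<mu> (- ?K)"
  proof -
    have ii: "integrable \<mu> (indicat_real (- ?K))"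
      using Kc m(1) by (intro integrable_real_indicator) (auto simp: less_top[symmetric])
    then have "(\<integral>\<omega>. e + 2 * B * indicator (- ?K) \<omega> \<partial>\<mu>) = (\<integral>\<omega>. e \<partial>\<mu>) + (\<integral>\<omega>. 2 * B * indicator (- ?K) \<omega> \<partial>\<mu>)"
      by (intro Bochner_Integration.integral_add) auto
    also have "\<dots> = e + 2 * B * measure \<mu> (- ?K)"
      using Kc m(1) sets_eq_imp_space_eq[OF m(1)] prob_space by simp
    finally show ?thesis .
  qed
  also have "\<dots> \<le> e + 2 * B * e"
    using tightness[OF m e tempered_Gibbs_moment[OF \<mu> good_k]] B0
        by (intro add_left_mono mult_left_mono) auto
  finally show ?thesis .
qed

text \<open>A uniform limit of continuous functions: for each \<open>n\<close> the integrand depends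
  on finitely many coordinates, so its integral is continuous for convergence on cylinder
  events.\<close>

lemma continuous_on_integral:
  assumes f: "continuous_map \<T>\<^sub>t euclideanreal f" and B: "\<And>\<omega>. \<omega> \<in> \<Omega>\<^sub>t \<Longrightarrow> \<bar>f \<omega>\<bar> \<le> B"
  shows "continuous_on (enc ` tempered_Gibbs) (\<lambda>\<phi>. \<integral>\<omega>. f \<omega> \<partial>restrict_space (dec \<phi>) \<Omega>\<^sub>t)"
proof (rule uniform_limit_theorem[where F=sequentially and f="\<lambda>n \<phi>. \<integral>\<omega>. f (cut n \<omega>) \<partial>dec \<phi>"])
  let ?\<Phi> = "enc ` tempered_Gibbs"
  have B0: "0 \<le> B" using B[OF cut_in_Omega_t[of 0 "\<lambda>_. 0"]] by linarith
  show "\<forall>\<^sub>F n in sequentially. continuous_on ?\<Phi> (\<lambda>\<phi>. \<integral>\<omega>. f (cut n \<omega>) \<partial>dec \<phi>)"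
  proof (intro always_eventually allI, unfold continuous_on_def, intro ballI)
    fix n \<phi> assume "\<phi> \<in> ?\<Phi>"
    then obtain \<mu> where \<mu>: "\<mu> \<in> tempered_Gibbs" "\<phi> = enc \<mu>" by auto
    have m: "sets \<mu> = sets borel" "prob_space \<mu>" using tempered_Gibbs_prob[OF \<mu>(1)]
        by (auto simp: prob_borel_def)
    have ev: "\<forall>\<^sub>F \<psi> in at \<phi> within ?\<Phi>. \<psi> \<in> ?\<Phi>"
      by (simp add: eventually_at_topological) blast
    have "((\<lambda>\<psi>. \<integral>\<omega>. f (cut n \<omega>) \<partial>dec \<psi>) \<longlongrightarrow> (\<integral>\<omega>. f (cut n \<omega>) \<partial>\<mu>)) (at \<phi> within ?\<Phi>)"
    proof (rule tendsto_integral_fcyl[OF _ m _ fcyl_meas_cut[OF f] B[OF cut_in_Omega_t]])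
      show "\<forall>\<^sub>F \<psi> in at \<phi> within ?\<Phi>. sets (dec \<psi>) = sets borel \<and> prob_space (dec \<psi>)"
        using ev
      proof eventually_elim
        case (elim \<psi>)
        then have "dec \<psi> \<in> prob_borel" by (auto simp: tempered_Gibbs_prob)
        then show ?case by (simp add: prob_borel_def)
      qed
      fix A :: "('v \<Rightarrow> real) set" assume A: "A \<in> fcyl"
      have "((\<lambda>\<psi>. \<psi> A) \<longlongrightarrow> \<phi> A) (at \<phi> within ?\<Phi>)"
        by (rule tendsto_fun_coordinates[OF tendsto_ident_at])
      moreover have "\<phi> A = measure \<mu> A" using \<mu>(2) A by (simp add: enc_def)
      moreover have "\<forall>\<^sub>F \<psi> in at \<phi> within ?\<Phi>. \<psi> A = measure (dec \<psi>) A"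
        using ev by eventually_elim (use A in \<open>auto simp: tempered_Gibbs_prob\<close>, simp add: enc_def)
      ultimately show "((\<lambda>\<psi>. measure (dec \<psi>) A) \<longlongrightarrow> measure \<mu> A) (at \<phi> within ?\<Phi>)"
        using Lim_transform_eventually by fastforce
    qed
    then show "((\<lambda>\<psi>. \<integral>\<omega>. f (cut n \<omega>) \<partial>dec \<psi>) \<longlongrightarrow> (\<integral>\<omega>. f (cut n \<omega>) \<partial>dec \<phi>)) (at \<phi> within ?\<Phi>)"
      using \<mu> tempered_Gibbs_prob by simp
  qed
  show "uniform_limit ?\<Phi> (\<lambda>n \<phi>. \<integral>\<omega>. f (cut n \<omega>) \<partial>dec \<phi>) (\<lambda>\<phi>. \<integral>\<omega>. f \<omega>
      \<partial>restrict_space (dec \<phi>) \<Omega>\<^sub>t) sequentially"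
  proof (rule uniform_limitI)
    fix \<epsilon> :: real assume \<epsilon>: "0 < \<epsilon>"
    \<comment> \<open>Chosen so that the uniform error \<open>e + 2 * B * e\<close> equals
      \<open>\<epsilon> / 2\<close>.\<close>
    define e where "e = \<epsilon> / (2 * (1 + 2 * B))"
    have e: "0 < e" using \<epsilon> B0 by (simp add: e_def)
    have "e + 2 * B * e = e * (1 + 2 * B)" by (simp add: algebra_simps)
    also have "\<dots> = \<epsilon> / 2" unfolding e_def using B0 by (simp add: field_simps)
    finally have e2: "e + 2 * B * e < \<epsilon>" using \<epsilon> by simp
    obtain N where N: "\<And>n \<omega>. N \<le> n \<Longrightarrow> \<omega> \<in> Kset (Kbound e) \<Longrightarrow> \<bar>f (cut n \<omega>) - f \<omega>\<bar> \<le> e"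
      using uniform_cut_approx[OF f e, of "Kbound e"] by metis
    show "\<forall>\<^sub>F n in sequentially. \<forall>\<phi>\<in>?\<Phi>. dist (\<integral>\<omega>. f (cut n \<omega>) \<partial>dec \<phi>) (\<integral>\<omega>. f \<omega>
        \<partial>restrict_space (dec \<phi>) \<Omega>\<^sub>t) < \<epsilon>"
      using eventually_ge_at_top[of N]
    proof eventually_elim
      case (elim n)
      show ?case
      proof
        fix \<phi> assume "\<phi> \<in> ?\<Phi>"
        then have "dec \<phi> \<in> tempered_Gibbs" by (auto simp: tempered_Gibbs_prob)
        from integral_cut_approx[OF this f B e N[OF elim]] e2
        show "dist (\<integral>\<omega>. f (cut n \<omega>) \<partial>dec \<phi>) (\<integral>\<omega>. f \<omega> \<partial>restrict_space (dec \<phi>) \<Omega>\<^sub>t) < \<epsilon>"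
          unfolding dist_real_def by linarith
      qed
    qed
  qed
qed simp

section \<open>Transfer to the weak topology on tempered configurations\<close>

lemma restrict_in_probs_on:
  assumes "\<mu> \<in> tempered_Gibbs" shows "restrict_space \<mu> \<Omega>\<^sub>t \<in> probs_on \<Omega>\<^sub>t"
proof -
  have m: "sets \<mu> = sets borel" "prob_space \<mu>" using tempered_Gibbs_prob[OF assms]
      by (auto simp: prob_borel_def)
  have "sets (restrict_space \<mu> \<Omega>\<^sub>t) = sets (restrict_space borel \<Omega>\<^sub>t)"
    by (rule sets_restrict_space_cong[OF m(1)])
  moreover have "prob_space (restrict_space \<mu> \<Omega>\<^sub>t)"
    using assms m(1) by (intro prob_space_restrict_space) (auto simp: tempered_Gibbs_def)
  ultimately show ?thesis by (simp add: probs_on_def)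
qed

lemma compactin_tempered_Gibbs:
  "compactin (weak_top \<T>\<^sub>t) ((\<lambda>\<mu>. restrict_space \<mu> \<Omega>\<^sub>t) ` tempered_Gibbs)"
proof -
  let ?\<Phi> = "enc ` tempered_Gibbs" and ?h = "\<lambda>\<phi>. restrict_space (dec \<phi>) \<Omega>\<^sub>t"
  have dec: "dec \<phi> \<in> tempered_Gibbs" if "\<phi> \<in> ?\<Phi>" for \<phi> using that by (auto simp: tempered_Gibbs_prob)
  have "continuous_map (top_of_set ?\<Phi>) (weak_top \<T>\<^sub>t) ?h"
    unfolding weak_top_def topspace_Omega_t
  proof (rule continuous_on_generated_topo)
    fix S assume "S \<in> {{\<nu> \<in> probs_on \<Omega>\<^sub>t. (\<integral>x. f x \<partial>\<nu>) \<in> U} | f U.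
        continuous_map \<T>\<^sub>t euclideanreal f \<and> (\<exists>B. \<forall>x\<in>\<Omega>\<^sub>t. \<bar>f x\<bar> \<le> B) \<and> open U}"
    then obtain f U B where S: "S = {\<nu> \<in> probs_on \<Omega>\<^sub>t. (\<integral>x. f x \<partial>\<nu>) \<in> U}"
      and f: "continuous_map \<T>\<^sub>t euclideanreal f" and B: "\<And>x. x \<in> \<Omega>\<^sub>t \<Longrightarrow> \<bar>f x\<bar> \<le> B" and U: "open U"
      by blast
    have "?h -` S \<inter> topspace (top_of_set ?\<Phi>) = ?\<Phi> \<inter> (\<lambda>\<phi>. \<integral>\<omega>. f \<omega> \<partial>restrict_space (dec \<phi>) \<Omega>\<^sub>t) -` U"
      unfolding S using restrict_in_probs_on[OF dec] by auto
    moreover have "openin (top_of_set ?\<Phi>) \<dots>"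
      by (rule continuous_openin_preimage_gen[OF continuous_on_integral[OF f B] U])
    ultimately show "openin (top_of_set ?\<Phi>) (?h -` S \<inter> topspace (top_of_set ?\<Phi>))" by simp
  next
    \<comment> \<open>The constant test function with \<open>U = UNIV\<close> makes the set of all
      probability measures on \<open>\<Omega>\<^sub>t\<close> a generator, so the image lies in the
      underlying space of the weak topology.\<close>
    have "?h \<phi> \<in> {\<nu> \<in> probs_on \<Omega>\<^sub>t. (\<integral>x. 0 \<partial>\<nu>) \<in> (UNIV :: real set)}" if "\<phi> \<in> ?\<Phi>" for \<phi>
      using restrict_in_probs_on[OF dec[OF that]] by simp
    moreover have "{\<nu> \<in> probs_on \<Omega>\<^sub>t. (\<integral>x. 0 \<partial>\<nu>) \<in> (UNIV :: real set)} \<in> {{\<nu>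
        \<in> probs_on \<Omega>\<^sub>t. (\<integral>x. f x \<partial>\<nu>) \<in> U} | f U.
        continuous_map \<T>\<^sub>t euclideanreal f \<and> (\<exists>B. \<forall>x\<in>\<Omega>\<^sub>t. \<bar>f x\<bar> \<le> B) \<and> open U}"
      by (intro CollectI exI[of _ "\<lambda>_. 0"] exI[of _ UNIV]) auto
    ultimately show "?h ` topspace (top_of_set ?\<Phi>) \<subseteq> \<Union> {{\<nu> \<in> probs_on \<Omega>\<^sub>t. (\<integral>x. f x \<partial>\<nu>) \<in> U} | f U.
        continuous_map \<T>\<^sub>t euclideanreal f \<and> (\<exists>B. \<forall>x\<in>\<Omega>\<^sub>t. \<bar>f x\<bar> \<le> B) \<and> open U}"
      unfolding topspace_euclidean_subtopology by blast
  qed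
  moreover have "compactin (top_of_set ?\<Phi>) ?\<Phi>"
    using compact_enc_tempered_Gibbs by (simp add: compactin_subtopology)
  ultimately have "compactin (weak_top \<T>\<^sub>t) (?h ` ?\<Phi>)" by (rule image_compactin[rotated])
  moreover have "?h ` ?\<Phi> = (\<lambda>\<mu>. restrict_space \<mu> \<Omega>\<^sub>t) ` tempered_Gibbs"
    unfolding image_image by (intro image_cong) (auto simp: tempered_Gibbs_prob)
  ultimately show ?thesis by simp
qed

end

theorem theorem3p2:
  fixes E :: "'v::countable \<Rightarrow> 'v \<Rightarrow> bool"
    and o\<^sub>0 :: 'v
    and W :: "real \<Rightarrow> real \<Rightarrow> real" and V :: "real \<Rightarrow> real"
    and \<theta> I\<^sub>W J\<^sub>W r a\<^sub>V c\<^sub>V q \<alpha>up :: real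
  assumes sym: "\<And>x y. E x y \<Longrightarrow> E y x"
    and irrefl: "\<And>x. \<not> E x x"
    and loc_fin: "\<And>x. finite {y. E x y}"
    and connected: "\<And>x y. E\<^sup>*\<^sup>* x y"
    and theta_pos: "0 < \<theta>"
    and Theta_some: "\<exists>\<alpha>>0. Theta_finite E o\<^sub>0 \<alpha> \<theta>"
    and W_cont: "continuous_on UNIV (\<lambda>(u, v). W u v)"
    and W_sym: "\<And>u v. W u v = W v u"
    and IW: "0 < I\<^sub>W" and JW: "0 < J\<^sub>W" and r_pos: "0 < r"
    and W_bound: "\<And>u v. \<bar>W u v\<bar> \<le> (I\<^sub>W + J\<^sub>W * (\<bar>u\<bar> powr r + \<bar>v\<bar> powr r)) / 2"
    and V_cont: "continuous_on UNIV V"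
    and aV: "0 < a\<^sub>V" and cV: "0 < c\<^sub>V"
    and V_bound: "\<And>u. V u \<ge> a\<^sub>V * \<bar>u\<bar> powr q - c\<^sub>V"
    and q_gt: "q > r + r / \<theta>"
    and alpha_up: "\<alpha>up > alpha_low E o\<^sub>0 \<theta>"
    and Theta_range: "\<And>\<alpha>. alpha_low E o\<^sub>0 \<theta> < \<alpha> \<Longrightarrow> \<alpha> \<le> \<alpha>up \<Longrightarrow> Theta_finite E o\<^sub>0 \<alpha> \<theta>"
  shows "(\<lambda>\<mu>. restrict_space \<mu> (Omega_t E o\<^sub>0 \<theta> r q \<alpha>up)) `
            {\<mu> \<in> Gibbs E W V. emeasure \<mu> (Omega_t E o\<^sub>0 \<theta> r q \<alpha>up) = 1} \<noteq> {}
       \<and> compactin (weak_top (Omega_t_top E o\<^sub>0 \<theta> r q \<alpha>up))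
           ((\<lambda>\<mu>. restrict_space \<mu> (Omega_t E o\<^sub>0 \<theta> r q \<alpha>up)) `
              {\<mu> \<in> Gibbs E W V. emeasure \<mu> (Omega_t E o\<^sub>0 \<theta> r q \<alpha>up) = 1})"
proof -
  interpret spin_model E o\<^sub>0 W V \<theta> I\<^sub>W J\<^sub>W r a\<^sub>V c\<^sub>V q \<alpha>up
    by unfold_locales (fact assms)+
  show ?thesis
    using tempered_Gibbs_nonempty compactin_tempered_Gibbs
    unfolding tempered_Gibbs_def by blast
qed

end
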